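(* Consider the problem of minimizing $F=f+\psi$ and the Contracting Proximal Tensor Method as in the context, in the convex case $\sigma_d(\psi)=0$. For a given $\varepsilon>0$, let the inner accuracy be fixed as $$\delta=\Bigl(\frac{p!\,\varepsilon}{L_p(f)}\Bigr)^{\frac p{p+1}}\frac{\gamma_0}{2^p(p+1)^{p+1}}.$$ Then, in order to achieve $F(x_K)-F^*\le\varepsilon$ it is enough to perform $$K=\left\lfloor1+2^{\frac1p}\Bigl(\frac{2^{p-1}(p+1)^{p+2}L_p(f)\,\beta_d(x_0;x^* )}{\varepsilon\,p!}\Bigr)^{\frac1{p+1}}\right\rfloor$$ iterations of the method. The total number of oracle calls $N_K=\sum_{k=0}^{K-1}t_k$ (the total number of inner tensor steps in these $K$ iterations) is bounded as $$N_K\le K\cdot\left(3+\frac{p+1}p\log\Bigl(4\bigl(1+\tfrac1{\gamma_0}\bigr)(p+1)^{\frac1p}K^p\Bigr)\right).$$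
   Context: $\mathbb{E}$ is a finite-dimensional real vector space with Euclidean norm $\|x\|=\langle Bx,x\rangle^{1/2}$, where $B:\mathbb{E}\to\mathbb{E}^*$ is a fixed symmetric positive-definite linear operator; $\|s\|_*=\sup\{\langle s,h\rangle:\|h\|\le1\}$ on $\mathbb{E}^*$; the norm of a $p$-linear symmetric form is $\|D\|=\sup\{D[h_1,\dots,h_p]:\|h_i\|\le1\}$. Problem: minimize $F=f+\psi$, where $f$ is convex and differentiable (at least $p$ times) on its open domain, $\psi:\mathbb{E}\to\mathbb{R}\cup\{+\infty\}$ is proper closed convex, $\operatorname{dom}\psi\subset\operatorname{dom}f$; a solution $x^*$ exists and $F^*=F(x^* )$. For a fixed integer $p\ge1$, $\|D^pf(x)-D^pf(y)\|\le L_p(f)\|x-y\|$ for $x,y\in\operatorname{dom}f$, with $0<L_p(f)<+\infty$. Let $d(x)=\frac1{p+1}\|x-x_0\|^{p+1}$ and $\beta_d(x;y)=d(y)-d(x)-\langle\nabla d(x),y-x\rangle$. The constant $\sigma_d(\psi)\ge0$ is such that $\psi(y)-\psi(x)-\langle\psi'(x),y-x\rangle\ge\sigma_d(\psi)\beta_d(x;y)$ for all $x,y\in\operatorname{dom}\psi$, $\psi'(x)\in\partial\psi(x)$; here the method is run with $\sigma_d(\psi)=0$. Tensor step: for $h=g+\phi$ with $g$ smooth convex and $\phi$ closed convex, with $\Omega_p(g,x;y)=g(x)+\sum_{i=1}^p\frac1{i!}D^ig(x)[y-x]^i$, $$T_M(h;x)=\operatorname*{argmin}_{y\in\mathbb{E}}\Bigl\{\Omega_p(g,x;y)+\frac{M}{(p+1)!}\|y-x\|^{p+1}+\phi(y)\Bigr\},$$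 and for $T=T_M(h;x)$, $h'(T)=\nabla g(T)-\nabla_y\Omega_p(g,x;T)-\frac M{p!}\|T-x\|^{p-1}B(T-x)\in\partial h(T)$. Contracting Proximal Tensor Method (case $\sigma_d(\psi)=0$). Choose $x_0\in\operatorname{dom}F$, inner accuracy $\delta>0$, $\gamma_0>0$. Set $v_0=x_0$, $A_0=0$, $c=\frac{p!\,\gamma_0}{2^{p-1}(p+1)^{p+2}L_p(f)}$. For $k\ge0$: (1) $a_{k+1}=c(p+1)(k+1)^p$; (2) $A_{k+1}=A_k+a_{k+1}$; (3) $g_{k+1}(x)=A_{k+1}f\bigl(\frac{a_{k+1}x+A_kx_k}{A_{k+1}}\bigr)$, $\phi_{k+1}(x)=a_{k+1}\psi(x)+\gamma_k\beta_d(v_k;x)$, $h_{k+1}=g_{k+1}+\phi_{k+1}$; (4) set $z_0=v_k$, $t_k=0$, $M=pL_p(f)\frac{a_{k+1}^{p+1}}{A_{k+1}^p}$; repeat $z_{t_k+1}=T_M(h_{k+1};z_{t_k})$, $t_k:=t_k+1$ until $\|h_{k+1}'(z_{t_k})\|_*\le\delta$; set $v_{k+1}=z_{t_k}$ (so $t_k$ is the final number of inner tensor steps at iteration $k$); (5) $x_{k+1}=\frac{a_{k+1}v_{k+1}+A_kx_k}{A_{k+1}}$; (6) $\gamma_{k+1}=\gamma_k+a_{k+1}\sigma_d(\psi)=\gamma_k$. One oracle call is one tensor step. *)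

theory Defs
  imports "HOL-Analysis.Analysis"
begin

text \<open>
  The dual space is represented by linear functions into the reals, so \<open>B x\<close> is the functional
  which the operator \<open>B\<close> assigns to \<open>x\<close>, and \<open>B x h\<close> is its value at \<open>h\<close>.
  The topology and the derivatives are those of the ambient finite-dimensional type; they do not
  depend on \<open>B\<close>.
\<close>

definition pos_def_operator :: "('a::euclidean_space \<Rightarrow> 'a \<Rightarrow> real) \<Rightarrow> bool" where
  "pos_def_operator B \<longleftrightarrow>
     bilinear B \<and> (\<forall>x y. B x y = B y x) \<and> (\<forall>x. x \<noteq> 0 \<longrightarrow> 0 < B x x)"

definition nrm :: "('a::euclidean_space \<Rightarrow> 'a \<Rightarrow> real) \<Rightarrow> 'a \<Rightarrow> real" where
  "nrm B x = sqrt (B x x)"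

definition dual_nrm :: "('a::euclidean_space \<Rightarrow> 'a \<Rightarrow> real) \<Rightarrow> ('a \<Rightarrow> real) \<Rightarrow> real" where
  "dual_nrm B s = (SUP h\<in>{h. nrm B h \<le> 1}. s h)"

text \<open>A \<open>p\<close>-linear form takes the list of its \<open>p\<close> arguments.\<close>

definition form_nrm ::
    "('a::euclidean_space \<Rightarrow> 'a \<Rightarrow> real) \<Rightarrow> nat \<Rightarrow> ('a list \<Rightarrow> real) \<Rightarrow> real" where
  "form_nrm B p \<Phi> = (SUP hs\<in>{hs. length hs = p \<and> (\<forall>h\<in>set hs. nrm B h \<le> 1)}. \<Phi> hs)"

text \<open>\<open>nderiv f [h\<^sub>1, \<dots>, h\<^sub>i] x\<close> is \<open>D\<^sup>i f(x)[h\<^sub>1, \<dots>, h\<^sub>i]\<close>.\<close>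

primrec nderiv :: "('a::euclidean_space \<Rightarrow> real) \<Rightarrow> 'a list \<Rightarrow> 'a \<Rightarrow> real" where
  "nderiv f [] = f"
| "nderiv f (h # hs) = (\<lambda>x. frechet_derivative (nderiv f hs) (at x) h)"

text \<open>
  In finite dimension, a map into the \<open>i\<close>-linear forms is (Frechet) differentiable iff its
  evaluation at each list of \<open>i\<close> vectors is; so this is \<open>p\<close>-fold Frechet differentiability.
\<close>

definition times_differentiable_on :: "nat \<Rightarrow> ('a::euclidean_space \<Rightarrow> real) \<Rightarrow> 'a set \<Rightarrow> bool" where
  "times_differentiable_on p f D \<longleftrightarrow>
     (\<forall>hs. length hs < p \<longrightarrow> (\<forall>x\<in>D. nderiv f hs differentiable (at x)))"

definition grad :: "('a::euclidean_space \<Rightarrow> real) \<Rightarrow> 'a \<Rightarrow> 'a \<Rightarrow> real" where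
  "grad f x = frechet_derivative f (at x)"

definition edom :: "('a \<Rightarrow> ereal) \<Rightarrow> 'a set" where
  "edom \<psi> = {x. \<psi> x < \<infinity>}"

definition proper_closed_convex :: "('a::euclidean_space \<Rightarrow> ereal) \<Rightarrow> bool" where
  "proper_closed_convex \<psi> \<longleftrightarrow>
     (\<forall>x. \<psi> x \<noteq> -\<infinity>) \<and> edom \<psi> \<noteq> {} \<and>
     closed {(x, r::real). \<psi> x \<le> ereal r} \<and> convex {(x, r::real). \<psi> x \<le> ereal r}"

definition subdiff :: "('a::euclidean_space \<Rightarrow> ereal) \<Rightarrow> 'a \<Rightarrow> ('a \<Rightarrow> real) set" where
  "subdiff \<psi> x = {s. linear s \<and> (\<forall>y. \<psi> x + ereal (s (y - x)) \<le> \<psi> y)}"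

definition prox_fn ::
    "('a::euclidean_space \<Rightarrow> 'a \<Rightarrow> real) \<Rightarrow> nat \<Rightarrow> 'a \<Rightarrow> 'a \<Rightarrow> real" where
  "prox_fn B p x0 x = 1 / (real p + 1) * nrm B (x - x0) ^ (p + 1)"

definition bregman :: "('a::euclidean_space \<Rightarrow> real) \<Rightarrow> 'a \<Rightarrow> 'a \<Rightarrow> real" where
  "bregman d x y = d y - d x - grad d x (y - x)"

definition rel_convexity_const ::
    "('a::euclidean_space \<Rightarrow> real) \<Rightarrow> ('a \<Rightarrow> ereal) \<Rightarrow> real \<Rightarrow> bool" where
  "rel_convexity_const d \<psi> \<sigma> \<longleftrightarrow> 0 \<le> \<sigma> \<and>
     (\<forall>x\<in>edom \<psi>. \<forall>y\<in>edom \<psi>. \<forall>s\<in>subdiff \<psi> x.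
        \<psi> y - \<psi> x - ereal (s (y - x)) \<ge> ereal (\<sigma> * bregman d x y))"

definition taylor :: "nat \<Rightarrow> ('a::euclidean_space \<Rightarrow> real) \<Rightarrow> 'a \<Rightarrow> 'a \<Rightarrow> real" where
  "taylor p g x y = g x + (\<Sum>i=1..p. 1 / fact i * nderiv g (replicate i (y - x)) x)"

definition tensor_step ::
    "('a::euclidean_space \<Rightarrow> 'a \<Rightarrow> real) \<Rightarrow> nat \<Rightarrow> real \<Rightarrow> ('a \<Rightarrow> real) \<Rightarrow> ('a \<Rightarrow> ereal) \<Rightarrow> 'a \<Rightarrow> 'a" where
  "tensor_step B p M g \<phi> x =
     arg_min (\<lambda>y. ereal (taylor p g x y + M / fact (p + 1) * nrm B (y - x) ^ (p + 1)) + \<phi> y)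
       (\<lambda>_. True)"

text \<open>The subgradient \<open>h'(T)\<close> of \<open>h = g + \<phi>\<close> at the result \<open>T\<close> of a tensor step from \<open>x\<close>.\<close>

definition step_subgrad ::
    "('a::euclidean_space \<Rightarrow> 'a \<Rightarrow> real) \<Rightarrow> nat \<Rightarrow> real \<Rightarrow> ('a \<Rightarrow> real) \<Rightarrow> 'a \<Rightarrow> 'a \<Rightarrow> 'a \<Rightarrow> real" where
  "step_subgrad B p M g x T =
     (\<lambda>u. grad g T u - grad (taylor p g x) T u - M / fact p * nrm B (T - x) ^ (p - 1) * B (T - x) u)"

text \<open>
  A run of the Contracting Proximal Tensor Method: \<open>z k i\<close> is the \<open>i\<close>-th inner iterate at outer
  iteration \<open>k\<close>. The inner sequence is continued past the stopping test, but only
  \<open>z k 0, \<dots>, z k (t k)\<close> belong to the method; \<open>t k\<close> is the first index passing the test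
  (and is meaningful only if such an index exists). The value \<open>a 0\<close> is not used.
\<close>

definition contracting_scale :: "nat \<Rightarrow> real \<Rightarrow> real \<Rightarrow> real" where
  "contracting_scale p L \<gamma>0 = fact p * \<gamma>0 / (2 ^ (p - 1) * (real p + 1) ^ (p + 2) * L)"

definition contracted ::
    "('a::euclidean_space \<Rightarrow> real) \<Rightarrow> (nat \<Rightarrow> real) \<Rightarrow> (nat \<Rightarrow> real) \<Rightarrow> (nat \<Rightarrow> 'a) \<Rightarrow> nat \<Rightarrow> 'a \<Rightarrow> real" where
  "contracted f a A x k =
     (\<lambda>y. A (Suc k) * f ((a (Suc k) *\<^sub>R y + A k *\<^sub>R x k) /\<^sub>R A (Suc k)))"

definition prox_term ::
    "('a::euclidean_space \<Rightarrow> real) \<Rightarrow> ('a \<Rightarrow> ereal) \<Rightarrow> (nat \<Rightarrow> real) \<Rightarrow> (nat \<Rightarrow> real) \<Rightarrow> (nat \<Rightarrow> 'a)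
      \<Rightarrow> nat \<Rightarrow> 'a \<Rightarrow> ereal" where
  "prox_term d \<psi> a \<gamma> v k =
     (\<lambda>y. ereal (a (Suc k)) * \<psi> y + ereal (\<gamma> k * bregman d (v k) y))"

definition inner_const :: "nat \<Rightarrow> real \<Rightarrow> (nat \<Rightarrow> real) \<Rightarrow> (nat \<Rightarrow> real) \<Rightarrow> nat \<Rightarrow> real" where
  "inner_const p L a A k = real p * L * (a (Suc k) ^ (p + 1) / A (Suc k) ^ p)"

definition inner_stop ::
    "('a::euclidean_space \<Rightarrow> 'a \<Rightarrow> real) \<Rightarrow> nat \<Rightarrow> ('a \<Rightarrow> real) \<Rightarrow> real \<Rightarrow> real
      \<Rightarrow> (nat \<Rightarrow> real) \<Rightarrow> (nat \<Rightarrow> real) \<Rightarrow> (nat \<Rightarrow> 'a) \<Rightarrow> (nat \<Rightarrow> nat \<Rightarrow> 'a) \<Rightarrow> nat \<Rightarrow> nat \<Rightarrow> bool" where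
  "inner_stop B p f L \<delta> a A x z k i \<longleftrightarrow> 1 \<le> i \<and>
     dual_nrm B (step_subgrad B p (inner_const p L a A k) (contracted f a A x k)
       (z k (i - 1)) (z k i)) \<le> \<delta>"

definition cpt_run ::
    "('a::euclidean_space \<Rightarrow> 'a \<Rightarrow> real) \<Rightarrow> nat \<Rightarrow> ('a \<Rightarrow> real) \<Rightarrow> ('a \<Rightarrow> ereal)
      \<Rightarrow> real \<Rightarrow> real \<Rightarrow> real \<Rightarrow> real \<Rightarrow> 'a
      \<Rightarrow> (nat \<Rightarrow> real) \<Rightarrow> (nat \<Rightarrow> real) \<Rightarrow> (nat \<Rightarrow> real)
      \<Rightarrow> (nat \<Rightarrow> 'a) \<Rightarrow> (nat \<Rightarrow> 'a) \<Rightarrow> (nat \<Rightarrow> nat \<Rightarrow> 'a) \<Rightarrow> (nat \<Rightarrow> nat) \<Rightarrow> bool" where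
  "cpt_run B p f \<psi> L \<sigma> \<gamma>0 \<delta> x0 a A \<gamma> x v z t \<longleftrightarrow>
     x 0 = x0 \<and> v 0 = x0 \<and> A 0 = 0 \<and> \<gamma> 0 = \<gamma>0 \<and>
     (\<forall>k.
        a (Suc k) = contracting_scale p L \<gamma>0 * (real p + 1) * (real k + 1) ^ p \<and>
        A (Suc k) = A k + a (Suc k) \<and>
        z k 0 = v k \<and>
        (\<forall>i. z k (Suc i) = tensor_step B p (inner_const p L a A k)
               (contracted f a A x k) (prox_term (prox_fn B p x0) \<psi> a \<gamma> v k) (z k i)) \<and>
        t k = (LEAST i. inner_stop B p f L \<delta> a A x z k i) \<and>
        v (Suc k) = z k (t k) \<and>
        x (Suc k) = (a (Suc k) *\<^sub>R v (Suc k) + A k *\<^sub>R x k) /\<^sub>R A (Suc k) \<and>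
        \<gamma> (Suc k) = \<gamma> k + a (Suc k) * \<sigma>)"

end

theory Submission
  imports Defs
begin

text \<open>
  Write \<open>N\<close> for the norm, \<open>d\<close> for the prox-function, \<open>\<beta>(x; y)\<close> for its Bregman distance and
  \<open>\<sigma> = \<gamma>\<^sub>0 / 2 ^ (p - 1)\<close>.

  \<^bold>\<open>Outer iterations.\<close> The potential \<open>A\<^sub>k (F x\<^sub>k - F\<^sup>*) + \<gamma>\<^sub>0 \<beta>(v\<^sub>k; x\<^sup>*)\<close> would not increase if the
  subproblems were solved exactly, because \<open>h\<^sub>k\<^sub>+\<^sub>1\<close> is convex and keeps the Bregman distance to its
  minimizer as a surplus. A residual of dual norm \<open>\<delta>\<close> at \<open>v\<^sub>k\<^sub>+\<^sub>1\<close> adds at most \<open>\<delta> N (v\<^sub>k\<^sub>+\<^sub>1 - x\<^sup>*)\<close>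
  (\<open>potential_step\<close>), and this distance is itself bounded by the potential, as \<open>d\<close> is uniformly convex
  of degree \<open>p + 1\<close>. The resulting recursion, with a constant \<open>b\<close>,
  \<open>S\<^sub>k\<^sub>+\<^sub>1 \<le> S\<^sub>k + \<delta> b S\<^sub>k\<^sub>+\<^sub>1 ^ (1 / (p + 1))\<close> makes
  \<open>S\<^sub>k ^ (p / (p + 1))\<close> grow by at most \<open>\<delta> b\<close> per iteration (\<open>outer_invariant\<close>). The prescribed \<open>\<delta>\<close>
  makes \<open>2 \<delta> b\<close> equal to \<open>(c \<epsilon>) ^ (p / (p + 1))\<close>, and \<open>K\<close> is just large enough for the initial value to
  take no more than half of \<open>(c \<epsilon> K ^ (p + 1)) ^ (p / (p + 1))\<close>. Since \<open>A\<^sub>K \<ge> c K ^ (p + 1)\<close>, accuracy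
  \<open>\<epsilon>\<close> follows (\<open>accuracy\<close>).

  \<^bold>\<open>Inner iterations.\<close> The growth of \<open>a\<^sub>k\<close> is chosen so that the Lipschitz constants \<open>L\<^sub>k\<close> of the
  contracted functions satisfy \<open>(p + 1) L\<^sub>k / p! \<le> \<sigma>\<close> (\<open>condition_number\<close>). Let \<open>w\<close> minimize a subproblem
  and let \<open>T\<close> be a tensor step from \<open>x\<close>. The regularized Taylor model is convex (\<open>model_ge_tangent\<close>), so
  both \<open>T\<close> and \<open>w\<close> are strong minimizers, with surplus \<open>\<gamma>\<^sub>0 \<beta>(T; w)\<close> and \<open>\<gamma>\<^sub>0 \<beta>(w; T)\<close>. Adding the two
  inequalities yields the symmetric Bregman distance, which is at least \<open>N (T - w) ^ (p + 1) / 2 ^ (p - 1)\<close>,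
  and so \<open>N (x - w) ^ (p + 1)\<close> is divided by \<open>p + 1\<close>, or by \<open>4\<close> if \<open>p = 1\<close>. What is left of the
  regularizer, or the triangle inequality if \<open>p = 1\<close>, bounds \<open>N (T - x)\<close>, and with it
  the residual tested by the stopping criterion
  (\<open>step_contraction\<close>, \<open>tensor_steps_residual\<close>).

  \<^bold>\<open>Counting.\<close> The potential also bounds the distance from the starting point \<open>v\<^sub>k\<close> to the minimizer of the
  subproblem, uniformly in \<open>k < K\<close> (\<open>subproblem_minimizer\<close>). Every inner loop therefore needs a reduction
  of the residual by the same factor \<open>2 (p + 1) K ^ p\<close>, and the logarithm of this factor to the base given
  by the contraction is compared with the stated bound in \<open>step_count_bound\<close>. The estimate holds
  for each iteration separately.

  Three analytic tools are developed on the way: symmetry of iterated derivatives under pointwise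
  differentiability (\<open>second_derivative_symmetric\<close>), the Taylor remainder for a function whose \<open>p\<close>-th
  derivative is Lipschitz (\<open>taylor_remainder\<close>), and existence of the minimizers
  (\<open>attains_minimum\<close>).
\<close>

section \<open>Multilinear forms\<close>

text \<open>
  The defining supremum of \<^const>\<open>form_nrm\<close> is meaningful only for a form that is bounded on the
  unit ball; multilinearity gives this by expanding every argument in the basis.
\<close>

definition multilinear :: "nat \<Rightarrow> ('a::euclidean_space list \<Rightarrow> real) \<Rightarrow> bool" where
  "multilinear p \<Phi> \<longleftrightarrow>
     (\<forall>us ws. length us + length ws + 1 = p \<longrightarrow> linear (\<lambda>h. \<Phi> (us @ h # ws)))"

lemma multilinear_Cons:
  assumes "multilinear (Suc p) \<Phi>"
  shows "multilinear p (\<lambda>hs. \<Phi> (b # hs))"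
  unfolding multilinear_def
proof (intro allI impI)
  fix us ws :: "'a list" assume "length us + length ws + 1 = p"
  then show "linear (\<lambda>h. \<Phi> (b # us @ h # ws))"
    using assms[unfolded multilinear_def, rule_format, of "b # us" ws] by simp
qed

lemma multilinear_bounded:
  "multilinear p \<Phi> \<Longrightarrow> \<exists>C\<ge>0. \<forall>hs. length hs = p \<longrightarrow> \<bar>\<Phi> hs\<bar> \<le> C * prod_list (map norm hs)"
proof (induction p arbitrary: \<Phi>)
  case 0
  show ?case by (rule exI[of _ "\<bar>\<Phi> []\<bar>"]) simp
next
  case (Suc p)
  have "\<forall>b. \<exists>C\<ge>0. \<forall>hs. length hs = p \<longrightarrow> \<bar>\<Phi> (b # hs)\<bar> \<le> C * prod_list (map norm hs)"
    using Suc.IH[OF multilinear_Cons[OF Suc.prems]] by blast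
  then obtain C where C: "\<And>b. 0 \<le> C b"
      "\<And>b hs. length hs = p \<Longrightarrow> \<bar>\<Phi> (b # hs)\<bar> \<le> C b * prod_list (map norm hs)"
    by metis
  have "\<bar>\<Phi> (h # hs)\<bar> \<le> (\<Sum>b\<in>Basis. C b) * prod_list (map norm (h # hs))" if l: "length hs = p" for h hs
  proof -
    have lin: "linear (\<lambda>h. \<Phi> (h # hs))"
      using Suc.prems[unfolded multilinear_def, rule_format, of "[]" hs] l by simp
    have "\<Phi> (h # hs) = \<Phi> ((\<Sum>b\<in>Basis. (h \<bullet> b) *\<^sub>R b) # hs)"
      by (simp add: euclidean_representation)
    also have "\<dots> = (\<Sum>b\<in>Basis. (h \<bullet> b) * \<Phi> (b # hs))"
      by (simp add: linear_sum[OF lin] linear_scale[OF lin])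
    also have "\<bar>\<dots>\<bar> \<le> (\<Sum>b\<in>Basis. \<bar>(h \<bullet> b) * \<Phi> (b # hs)\<bar>)"
      by (rule sum_abs)
    also have "\<dots> \<le> (\<Sum>b\<in>Basis. norm h * (C b * prod_list (map norm hs)))"
      by (intro sum_mono) (auto simp: abs_mult Basis_le_norm C l intro!: mult_mono)
    also have "\<dots> = (\<Sum>b\<in>Basis. C b) * prod_list (map norm (h # hs))"
      by (simp add: sum_distrib_right sum_distrib_left algebra_simps)
    finally show ?thesis .
  qed
  then show ?case
    using C(1) by (intro exI[of _ "\<Sum>b\<in>Basis. C b"]) (auto simp: length_Suc_conv sum_nonneg)
qed

lemma prod_list_nonneg_map: "(\<And>x. 0 \<le> f x) \<Longrightarrow> 0 \<le> prod_list (map f xs)" for f :: "_ \<Rightarrow> real"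
  by (induction xs) auto

lemma multilinear_scale:
  "multilinear p \<Phi> \<Longrightarrow> length hs = p
    \<Longrightarrow> \<Phi> (map (\<lambda>h. c h *\<^sub>R h) hs) = prod_list (map c hs) * \<Phi> hs"
proof (induction p arbitrary: \<Phi> hs)
  case (Suc p)
  from Suc.prems(2) obtain h hs' where hs: "hs = h # hs'" "length hs' = p"
    by (auto simp: length_Suc_conv)
  have lin: "linear (\<lambda>h. \<Phi> (h # map (\<lambda>h. c h *\<^sub>R h) hs'))"
    using Suc.prems(1)[unfolded multilinear_def, rule_format, of "[]"] hs by simp
  have "\<Phi> (map (\<lambda>h. c h *\<^sub>R h) hs) = c h * \<Phi> (h # map (\<lambda>h. c h *\<^sub>R h) hs')"
    using linear_scale[OF lin, of "c h" h] by (simp add: hs)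
  also have "\<Phi> (h # map (\<lambda>h. c h *\<^sub>R h) hs') = prod_list (map c hs') * \<Phi> (h # hs')"
    by (rule Suc.IH[OF multilinear_Cons[OF Suc.prems(1)] hs(2)])
  finally show ?case by (simp add: hs mult.assoc)
qed simp

section \<open>The norm of a positive definite operator\<close>

locale pos_def_norm =
  fixes B :: "'a::euclidean_space \<Rightarrow> 'a \<Rightarrow> real"
  assumes pos_def: "pos_def_operator B"
begin

abbreviation N :: "'a \<Rightarrow> real" where "N \<equiv> nrm B"

lemma bilinear_B: "bilinear B"
  and B_commute: "B x y = B y x"
  and B_pos: "x \<noteq> 0 \<Longrightarrow> 0 < B x x"
  using pos_def unfolding pos_def_operator_def by blast+

lemmas B_simps =
  bilinear_ladd[OF bilinear_B] bilinear_radd[OF bilinear_B]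
  bilinear_lsub[OF bilinear_B] bilinear_rsub[OF bilinear_B]
  bilinear_lmul[OF bilinear_B] bilinear_rmul[OF bilinear_B]
  bilinear_lneg[OF bilinear_B] bilinear_rneg[OF bilinear_B]
  bilinear_lzero[OF bilinear_B] bilinear_rzero[OF bilinear_B]

lemma B_nonneg: "0 \<le> B x x"
  using B_pos[of x] by (cases "x = 0") (auto simp: B_simps)

lemma N_nonneg [simp]: "0 \<le> N x"
  by (simp add: nrm_def B_nonneg)

lemma N_square: "(N x)\<^sup>2 = B x x"
  by (simp add: nrm_def B_nonneg)

lemma N_zero [simp]: "N 0 = 0"
  by (simp add: nrm_def B_simps)

lemma N_eq_0_iff [simp]: "N x = 0 \<longleftrightarrow> x = 0"
  using B_pos[of x] by (cases "x = 0") (auto simp: nrm_def B_simps)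

lemma N_scaleR: "N (c *\<^sub>R x) = \<bar>c\<bar> * N x"
proof -
  have "B (c *\<^sub>R x) (c *\<^sub>R x) = c\<^sup>2 * B x x"
    by (simp add: B_simps power2_eq_square)
  then show ?thesis by (simp add: nrm_def real_sqrt_mult)
qed

lemma N_minus [simp]: "N (- x) = N x"
  using N_scaleR[of "-1" x] by simp

lemma N_minus_commute: "N (x - y) = N (y - x)"
  using N_minus[of "x - y"] by simp

lemma Cauchy_Schwarz_N: "\<bar>B x y\<bar> \<le> N x * N y"
proof (cases "x = 0")
  case True
  then show ?thesis by (simp add: B_simps)
next
  case False
  define c where "c = B x y / B x x"
  have pos: "0 < B x x" using False by (rule B_pos)
  have "0 \<le> B (y - c *\<^sub>R x) (y - c *\<^sub>R x)" by (rule B_nonneg)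
  also have "\<dots> = B y y - 2 * c * B x y + c\<^sup>2 * B x x"
    by (simp add: B_simps B_commute[of y x] algebra_simps power2_eq_square)
  also have "\<dots> = B y y - (B x y)\<^sup>2 / B x x"
    using pos by (simp add: c_def power2_eq_square field_simps)
  finally have "(B x y)\<^sup>2 \<le> B x x * B y y"
    using pos by (simp add: field_simps)
  then have "\<bar>B x y\<bar>\<^sup>2 \<le> (N x * N y)\<^sup>2"
    by (simp add: power_mult_distrib N_square)
  then show ?thesis by (rule power2_le_imp_le) simp
qed

lemma N_triangle: "N (x + y) \<le> N x + N y"
proof (rule power2_le_imp_le)
  have "(N (x + y))\<^sup>2 = (N x)\<^sup>2 + 2 * B x y + (N y)\<^sup>2"
    by (simp add: N_square B_simps B_commute[of y x])
  also have "\<dots> \<le> (N x + N y)\<^sup>2"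
    using Cauchy_Schwarz_N[of x y] by (simp add: power2_sum)
  finally show "(N (x + y))\<^sup>2 \<le> (N x + N y)\<^sup>2" .
qed simp

lemma N_triangle_diff: "N (x - z) \<le> N (x - y) + N (y - z)"
  using N_triangle[of "x - y" "y - z"] by simp

lemma continuous_on_N [continuous_intros]:
  "continuous_on S g \<Longrightarrow> continuous_on S (\<lambda>x. N (g x))"
proof -
  interpret bounded_bilinear B
    using bilinear_B by (simp add: bilinear_conv_bounded_bilinear)
  show "continuous_on S g \<Longrightarrow> continuous_on S (\<lambda>x. N (g x))"
    unfolding nrm_def by (intro continuous_intros continuous_on)
qed

lemma norm_le_N: obtains C where "0 < C" "\<And>x. norm x \<le> C * N x"
proof -
  have "compact (sphere (0::'a) 1)" by simp
  moreover have "sphere (0::'a) 1 \<noteq> {}" by simp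
  ultimately obtain u where u: "u \<in> sphere 0 1" "\<And>y. y \<in> sphere 0 1 \<Longrightarrow> N u \<le> N y"
    using continuous_attains_inf[of "sphere 0 1" N] continuous_on_N[OF continuous_on_id]
    by auto
  have Nu: "0 < N u" using u(1) N_nonneg[of u] by (auto simp: less_le)
  have "norm x \<le> 1 / N u * N x" for x
  proof (cases "x = 0")
    case False
    then have "N u \<le> N (x /\<^sub>R norm x)" by (intro u) simp
    also have "\<dots> = N x / norm x" by (simp add: N_scaleR divide_inverse mult.commute)
    finally show ?thesis using Nu False by (simp add: field_simps)
  qed simp
  then show ?thesis using Nu by (intro that[of "1 / N u"]) auto
qed

lemma bounded_linear_le_N:
  assumes "linear s"
  shows "\<exists>C\<ge>0. \<forall>h. \<bar>s h\<bar> \<le> C * N h"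
proof -
  obtain C where C: "0 < C" "\<And>x. norm (s x) \<le> C * norm x"
    using linear_bounded_pos[OF assms] by blast
  obtain C' where C': "0 < C'" "\<And>x. norm x \<le> C' * N x" using norm_le_N by blast
  have "\<bar>s h\<bar> \<le> (C * C') * N h" for h
    using order_trans[OF C(2)[of h] mult_left_mono[OF C'(2)[of h], of C]] C(1)
    by (simp add: mult.assoc)
  then show ?thesis using C(1) C'(1) by (intro exI[of _ "C * C'"]) auto
qed

lemma dual_nrm_leI:
  assumes "\<And>h. N h \<le> 1 \<Longrightarrow> s h \<le> G"
  shows "dual_nrm B s \<le> G"
  unfolding dual_nrm_def using assms by (intro cSUP_least) (auto intro: exI[of _ 0])

lemma le_dual_nrm:
  assumes "linear s"
  shows "s h \<le> dual_nrm B s * N h"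
proof (cases "h = 0")
  case True
  then show ?thesis using linear_0[OF assms] by simp
next
  case False
  obtain C where C: "0 \<le> C" "\<And>h. \<bar>s h\<bar> \<le> C * N h"
    using bounded_linear_le_N[OF assms] by blast
  have bdd: "bdd_above (s ` {h. N h \<le> 1})"
  proof (rule bdd_aboveI2)
    fix h assume "h \<in> {h. N h \<le> 1}"
    then show "s h \<le> C"
      using C(2)[of h] mult_left_mono[of "N h" 1 C] C(1) by auto
  qed
  have pos: "0 < N h" using False N_nonneg[of h] by (simp add: less_le)
  have "s (h /\<^sub>R N h) \<le> dual_nrm B s"
    unfolding dual_nrm_def using bdd pos
    by (intro cSUP_upper) (auto simp: N_scaleR divide_simps)
  then show ?thesis
    using pos linear_scale[OF assms] by (simp add: field_simps)
qed

lemma le_form_nrm: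
  assumes ml: "multilinear p \<Phi>" and l: "length hs = p"
  shows "\<Phi> hs \<le> form_nrm B p \<Phi> * prod_list (map N hs)"
proof (cases "0 \<in> set hs")
  case True
  have "\<Phi> hs = \<Phi> (map (\<lambda>h. (if h = 0 then 0 else 1) *\<^sub>R h) hs)"
    by (rule arg_cong[where f = \<Phi>], rule map_idI[symmetric]) auto
  also have "\<dots> = 0"
    using True by (simp add: multilinear_scale[OF ml l] prod_list_zero_iff)
  moreover have "prod_list (map N hs) = 0"
    using True by (force simp: prod_list_zero_iff)
  ultimately show ?thesis by simp
next
  case False
  let ?S = "{hs. length hs = p \<and> (\<forall>h\<in>set hs. N h \<le> 1)}"
  obtain C where C: "0 \<le> C" "\<And>hs. length hs = p \<Longrightarrow> \<bar>\<Phi> hs\<bar> \<le> C * prod_list (map norm hs)"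
    using multilinear_bounded[OF ml] by blast
  obtain C' where C': "0 < C'" "\<And>x. norm x \<le> C' * N x" using norm_le_N by blast
  have pl: "prod_list (map norm hs) \<le> C' ^ length hs" if "\<forall>h\<in>set hs. N h \<le> 1" for hs :: "'a list"
    using that
  proof (induction hs)
    case (Cons h hs)
    have "norm h \<le> C' * 1"
      using Cons.prems C' order_trans[OF C'(2)[of h] mult_left_mono[of "N h" 1 C']] by simp
    then show ?case
      using Cons C'(1) by (auto intro!: mult_mono prod_list_nonneg_map)
  qed simp
  have bdd: "bdd_above (\<Phi> ` ?S)"
  proof (rule bdd_aboveI2)
    fix hs assume "hs \<in> ?S"
    then show "\<Phi> hs \<le> C * C' ^ p"
      using C(2)[of hs] mult_left_mono[OF pl[of hs] C(1)] by auto
  qed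
  let ?u = "map (\<lambda>h. (1 / N h) *\<^sub>R h) hs"
  have "\<Phi> ?u \<le> form_nrm B p \<Phi>"
    unfolding form_nrm_def using bdd False l
    by (intro cSUP_upper) (auto simp: N_scaleR)
  moreover have "\<Phi> ?u = prod_list (map (\<lambda>h. 1 / N h) hs) * \<Phi> hs"
    by (rule multilinear_scale[OF ml l])
  moreover have "prod_list (map (\<lambda>h. 1 / N h) hs) = 1 / prod_list (map N hs)"
    by (induction hs) auto
  moreover have "0 < prod_list (map N hs)"
    using False by (induction hs) (auto simp: less_le)
  ultimately show ?thesis by (simp add: field_simps)
qed

lemma abs_le_form_nrm:
  assumes ml: "multilinear (Suc p) \<Phi>" and l: "length hs = Suc p"
  shows "\<bar>\<Phi> hs\<bar> \<le> form_nrm B (Suc p) \<Phi> * prod_list (map N hs)"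
proof -
  from l obtain h hs' where hs: "hs = h # hs'" "length hs' = p"
    by (auto simp: length_Suc_conv)
  have "linear (\<lambda>h. \<Phi> (h # hs'))"
    using ml[unfolded multilinear_def, rule_format, of "[]" hs'] hs by simp
  then have "- \<Phi> hs = \<Phi> (- h # hs')"
    using linear_neg[of "\<lambda>h. \<Phi> (h # hs')" h] hs by simp
  also have "\<dots> \<le> form_nrm B (Suc p) \<Phi> * prod_list (map N hs)"
    using le_form_nrm[OF ml, of "- h # hs'"] hs by simp
  finally show ?thesis using le_form_nrm[OF ml l] by simp
qed

end

section \<open>The power prox-function\<close>

lemma has_real_derivative_line:
  fixes g :: "'a::real_normed_vector \<Rightarrow> real"
  assumes "(g has_derivative g') (at (x + \<tau> *\<^sub>R u))"
  shows "((\<lambda>s. g (x + s *\<^sub>R u)) has_real_derivative g' u) (at \<tau>)"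
proof -
  have "((\<lambda>s. x + s *\<^sub>R u) has_derivative (\<lambda>s. s *\<^sub>R u)) (at \<tau>)"
    by (auto intro!: derivative_eq_intros)
  from has_derivative_compose[OF this assms]
  have "((\<lambda>s. g (x + s *\<^sub>R u)) has_derivative (\<lambda>s. g' (s *\<^sub>R u))) (at \<tau>)" .
  moreover have "(\<lambda>s. g' (s *\<^sub>R u)) = (*) (g' u)"
    using linear_scale[OF has_derivative_linear[OF assms]] by (auto simp: fun_eq_iff)
  ultimately show ?thesis by (simp add: has_field_derivative_def)
qed

lemma power_mean_le:
  fixes a b :: real
  assumes "0 \<le> a" "0 \<le> b"
  shows "2 * ((a + b) / 2) ^ m \<le> a ^ m + b ^ m"
proof (induction m)
  case (Suc m)
  have "0 \<le> (a - b) * (a ^ m - b ^ m)"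
    using assms power_mono[of a b m] power_mono[of b a m]
    by (cases "a \<le> b") (auto intro: mult_nonneg_nonneg mult_nonpos_nonpos)
  then have "(a + b) / 2 * (a ^ m + b ^ m) \<le> a ^ Suc m + b ^ Suc m"
    by (simp add: algebra_simps)
  moreover have "2 * ((a + b) / 2) ^ Suc m \<le> (a + b) / 2 * (a ^ m + b ^ m)"
    using mult_left_mono[OF Suc.IH, of "(a + b) / 2"] assms by simp
  ultimately show ?case by linarith
qed simp

context pos_def_norm
begin

lemma B_line: "B (y + s *\<^sub>R u) (y + s *\<^sub>R u) = B y y + 2 * s * B y u + s\<^sup>2 * B u u"
  by (simp add: B_simps B_commute[of u y] algebra_simps power2_eq_square)

text \<open>
  Differentiability refers to the ambient norm, so \<open>O\<close>-estimates in \<open>N\<close> have to be transferred.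
\<close>

lemma N_le_norm: obtains C where "0 < C" "\<And>x. N x \<le> C * norm x"
proof -
  interpret bounded_bilinear B
    using bilinear_B by (simp add: bilinear_conv_bounded_bilinear)
  obtain K where K: "0 < K" "\<And>x y. norm (B x y) \<le> norm x * norm y * K"
    using pos_bounded by blast
  have "N x \<le> sqrt K * norm x" for x
  proof (rule power2_le_imp_le)
    have "(N x)\<^sup>2 \<le> K * (norm x)\<^sup>2"
      unfolding N_square using K(2)[of x x] by (simp add: power2_eq_square mult.commute)
    then show "(N x)\<^sup>2 \<le> (sqrt K * norm x)\<^sup>2"
      using K(1) by (simp add: power_mult_distrib)
  qed (use K in simp)
  then show ?thesis using K(1) by (intro that[of "sqrt K"]) auto
qed

text \<open>Away from \<open>x0\<close> this is the chain rule for \<open>sqrt\<close>; at \<open>x0\<close> the derivative vanishes since \<open>p \<ge> 1\<close>.\<close>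

lemma has_derivative_N_power:
  assumes "1 \<le> p"
  shows "((\<lambda>x. N (x - x0) ^ (p + 1)) has_derivative
           (\<lambda>u. (real p + 1) * N (y - x0) ^ (p - 1) * B (y - x0) u)) (at y)"
proof (cases "y = x0")
  case True
  obtain C where C: "0 < C" "\<And>x. N x \<le> C * norm x" using N_le_norm by blast
  have lim: "((\<lambda>x. C * N (x - x0) ^ p) \<longlongrightarrow> 0) (at x0)"
  proof -
    have "continuous_on UNIV (\<lambda>x. C * N (x - x0) ^ p)"
      by (intro continuous_intros)
    then have "((\<lambda>x. C * N (x - x0) ^ p) \<longlongrightarrow> C * N (x0 - x0) ^ p) (at x0)"
      using continuous_on_eq_continuous_at[OF open_UNIV] isCont_def by blast
    then show ?thesis using assms by (simp add: power_0_left)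
  qed
  have "((\<lambda>x. norm (N (x - x0) ^ (p + 1) - N (x0 - x0) ^ (p + 1) - 0) / norm (x - x0)) \<longlongrightarrow> 0) (at x0)"
  proof (rule tendsto_sandwich[OF _ _ tendsto_const lim])
    show "\<forall>\<^sub>F x in at x0. norm (N (x - x0) ^ (p + 1) - N (x0 - x0) ^ (p + 1) - 0) / norm (x - x0)
        \<le> C * N (x - x0) ^ p"
    proof (rule always_eventually, intro allI)
      fix x
      have "N (x - x0) ^ (p + 1) \<le> C * norm (x - x0) * N (x - x0) ^ p"
        using mult_right_mono[OF C(2)[of "x - x0"], of "N (x - x0) ^ p"] by simp
      then show "norm (N (x - x0) ^ (p + 1) - N (x0 - x0) ^ (p + 1) - 0) / norm (x - x0)
        \<le> C * N (x - x0) ^ p"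
        using C(1) by (cases "x = x0") (auto simp: field_simps abs_mult)
    qed
  qed (auto intro: always_eventually)
  then have "((\<lambda>x. N (x - x0) ^ (p + 1)) has_derivative (\<lambda>_. 0)) (at x0)"
    by (simp add: has_derivative_iff_norm)
  then show ?thesis using True by (simp add: B_simps)
next
  case False
  interpret bounded_bilinear B
    using bilinear_B by (simp add: bilinear_conv_bounded_bilinear)
  have pos: "0 < B (y - x0) (y - x0)" using False by (intro B_pos) simp
  have "((\<lambda>x. sqrt (B (x - x0) (x - x0)) ^ (p + 1)) has_derivative
      (\<lambda>u. real (p + 1) * ((B (y - x0) u + B u (y - x0)) * (inverse (sqrt (B (y - x0) (y - x0))) / 2))
         * sqrt (B (y - x0) (y - x0)) ^ p)) (at y)"
    by (rule derivative_eq_intros FDERIV refl pos | simp)+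
  moreover have "(\<lambda>u. real (p + 1) * ((B (y - x0) u + B u (y - x0)) * (inverse (sqrt (B (y - x0) (y - x0))) / 2))
         * sqrt (B (y - x0) (y - x0)) ^ p) = (\<lambda>u. (real p + 1) * N (y - x0) ^ (p - 1) * B (y - x0) u)"
  proof
    fix u
    show "real (p + 1) * ((B (y - x0) u + B u (y - x0)) * (inverse (sqrt (B (y - x0) (y - x0))) / 2))
         * sqrt (B (y - x0) (y - x0)) ^ p = (real p + 1) * N (y - x0) ^ (p - 1) * B (y - x0) u"
      using assms pos False by (cases p) (auto simp: nrm_def B_commute[of u] field_simps)
  qed
  ultimately show ?thesis by (simp add: nrm_def)
qed

lemma grad_prox_fn:
  assumes "1 \<le> p"
  shows "(prox_fn B p x0 has_derivative grad (prox_fn B p x0) y) (at y)"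
    and "grad (prox_fn B p x0) y u = N (y - x0) ^ (p - 1) * B (y - x0) u"
proof -
  have "(prox_fn B p x0 has_derivative (\<lambda>u. N (y - x0) ^ (p - 1) * B (y - x0) u)) (at y)"
    unfolding prox_fn_def
    using has_derivative_mult_right[OF has_derivative_N_power[OF assms], of "1 / (real p + 1)"]
    by (simp add: mult.assoc add_eq_0_iff_both_eq_0)
  moreover from this have "grad (prox_fn B p x0) y = (\<lambda>u. N (y - x0) ^ (p - 1) * B (y - x0) u)"
    unfolding grad_def by (rule frechet_derivative_at[symmetric])
  ultimately show "(prox_fn B p x0 has_derivative grad (prox_fn B p x0) y) (at y)"
    "grad (prox_fn B p x0) y u = N (y - x0) ^ (p - 1) * B (y - x0) u" by auto
qed

text \<open>
  Put \<open>a = x - x0\<close>, \<open>b = y - x0\<close> and \<open>m = p - 1\<close>. The right side is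
  \<open>(|a|^m + |b|^m) |a - b|\<^sup>2 / 2 + (|a|^m - |b|^m) (|a|\<^sup>2 - |b|\<^sup>2) / 2\<close>, whose second summand is
  nonnegative, while \<open>|a|^m + |b|^m \<ge> 2 (|a - b| / 2)^m\<close> by the power mean and triangle inequalities. The
  constant is attained at \<open>b = - a\<close>. It is \<open>p + 1\<close> times that of the bound for a single Bregman distance in
  \<open>bregman_prox_fn_ge\<close>, whereas adding two such bounds gives only the factor \<open>2\<close>.
\<close>

lemma prox_fn_monotone:
  assumes "1 \<le> p"
  shows "(1 / 2) ^ (p - 1) * N (x - y) ^ (p + 1)
    \<le> grad (prox_fn B p x0) x (x - y) - grad (prox_fn B p x0) y (x - y)"
proof -
  define a b where "a = x - x0" and "b = y - x0"
  define m where "m = p - 1"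
  have p: "p = Suc m" using assms by (simp add: m_def)
  have xy: "x - y = a - b" by (simp add: a_def b_def)
  have sq: "(N (a - b))\<^sup>2 = (N a)\<^sup>2 + (N b)\<^sup>2 - 2 * B a b"
    by (simp add: N_square B_simps B_commute[of b a])
  have "(1 / 2) ^ m * N (a - b) ^ m \<le> ((N a + N b) / 2) ^ m"
    unfolding power_mult_distrib[symmetric]
    using N_triangle[of a "- b"] by (intro power_mono) auto
  also have "\<dots> \<le> (N a ^ m + N b ^ m) / 2"
    using power_mean_le[of "N a" "N b" m] by simp
  finally have "(1 / 2) ^ m * N (a - b) ^ m * (N (a - b))\<^sup>2 \<le> (N a ^ m + N b ^ m) / 2 * (N (a - b))\<^sup>2"
    by (rule mult_right_mono) simp
  moreover have "0 \<le> (N a ^ m - N b ^ m) * ((N a)\<^sup>2 - (N b)\<^sup>2)"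
    using power_mono[of "N a" "N b"] power_mono[of "N b" "N a"]
    by (cases "N a \<le> N b") (auto intro: mult_nonneg_nonneg mult_nonpos_nonpos)
  moreover have "grad (prox_fn B p x0) x (x - y) - grad (prox_fn B p x0) y (x - y)
      = N a ^ m * ((N a)\<^sup>2 - B a b) - N b ^ m * (B a b - (N b)\<^sup>2)"
    unfolding grad_prox_fn(2)[OF assms] xy
    by (simp add: N_square B_simps B_commute[of b a] m_def flip: a_def b_def)
  moreover have "\<dots> = (N a ^ m + N b ^ m) / 2 * (N (a - b))\<^sup>2
      + (N a ^ m - N b ^ m) * ((N a)\<^sup>2 - (N b)\<^sup>2) / 2"
    unfolding sq by (simp add: field_simps)
  moreover have "(1 / 2) ^ (p - 1) * N (x - y) ^ (p + 1) = (1 / 2) ^ m * N (a - b) ^ m * (N (a - b))\<^sup>2"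
    by (simp add: p xy power2_eq_square)
  ultimately show ?thesis by simp
qed

lemma linear_grad_prox_fn: "1 \<le> p \<Longrightarrow> linear (grad (prox_fn B p x0) x)"
  using has_derivative_linear grad_prox_fn(1) by blast

text \<open>
  This is \<open>prox_fn_monotone\<close> integrated along the segment from \<open>x\<close> to \<open>y\<close>: the derivative
  of \<open>\<tau> \<mapsto> \<beta>(x; x + \<tau> (y - x))\<close> is at least a multiple of \<open>\<tau> ^ p\<close>.
\<close>

lemma bregman_prox_fn_ge:
  assumes p: "1 \<le> p"
  shows "(1 / 2) ^ (p - 1) / (real p + 1) * N (x - y) ^ (p + 1) \<le> bregman (prox_fn B p x0) x y"
proof -
  let ?d = "prox_fn B p x0"
  define c where "c = (1 / 2) ^ (p - 1) / (real p + 1) * N (y - x) ^ (p + 1)"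
  have nz: "1 + real p \<noteq> 0" "real p + 1 \<noteq> 0" by linarith+
  define u where "u = y - x"
  define \<phi> where "\<phi> \<tau> = ?d (x + \<tau> *\<^sub>R u) - \<tau> * grad ?d x u - c * \<tau> ^ (p + 1)" for \<tau>
  have "\<phi> 0 \<le> \<phi> 1"
  proof (rule DERIV_nonneg_imp_nondecreasing[where f = \<phi>])
    fix \<tau> :: real assume \<tau>: "0 \<le> \<tau>" "\<tau> \<le> 1"
    let ?D = "grad ?d (x + \<tau> *\<^sub>R u) u - grad ?d x u - c * ((real p + 1) * \<tau> ^ p)"
    have "(\<phi> has_real_derivative ?D) (at \<tau>)"
      unfolding \<phi>_def
      by (rule derivative_eq_intros has_real_derivative_line[OF grad_prox_fn(1)[OF p]] refl
        | simp add: add.commute)+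
    moreover have "0 \<le> ?D"
    proof (cases "\<tau> = 0")
      case True
      then show ?thesis using p by (simp add: power_0_left)
    next
      case False
      have "(1 / 2) ^ (p - 1) * N (\<tau> *\<^sub>R u) ^ (p + 1) \<le> \<tau> * (grad ?d (x + \<tau> *\<^sub>R u) u - grad ?d x u)"
        using prox_fn_monotone[OF p, of "x + \<tau> *\<^sub>R u" x x0]
          linear_scale[OF linear_grad_prox_fn[OF p]] by (simp add: right_diff_distrib)
      then have "\<tau> * (c * ((real p + 1) * \<tau> ^ p)) \<le> \<tau> * (grad ?d (x + \<tau> *\<^sub>R u) u - grad ?d x u)"
        using \<tau> nz by (simp add: c_def N_scaleR u_def power_mult_distrib mult_ac)
      then show ?thesis using False \<tau> by simp
    qed
    ultimately show "\<exists>D. (\<phi> has_real_derivative D) (at \<tau>) \<and> 0 \<le> D" by blast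
  qed simp
  then show ?thesis
    by (simp add: \<phi>_def u_def c_def bregman_def N_minus_commute[of x y])
qed

lemma bregman_prox_fn_nonneg: "1 \<le> p \<Longrightarrow> 0 \<le> bregman (prox_fn B p x0) x y"
  by (rule order_trans[OF _ bregman_prox_fn_ge]) auto

lemma bregman_prox_fn_has_derivative:
  assumes "1 \<le> p"
  shows "(bregman (prox_fn B p x0) v has_derivative
           (\<lambda>u. grad (prox_fn B p x0) y u - grad (prox_fn B p x0) v u)) (at y)"
proof -
  have lin: "((\<lambda>y. grad (prox_fn B p x0) v (y - v)) has_derivative grad (prox_fn B p x0) v) (at y)"
    by (rule has_derivative_compose[of "\<lambda>y. y - v" "\<lambda>h. h" y UNIV,
        OF _ linear_imp_has_derivative[OF linear_grad_prox_fn[OF assms]]])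
      (auto intro!: derivative_eq_intros)
  show ?thesis
    unfolding bregman_def
    by (auto intro!: derivative_eq_intros lin grad_prox_fn(1)[OF assms])
qed

lemma bregman_three_point:
  assumes "1 \<le> p"
  shows "bregman (prox_fn B p x0) v y = bregman (prox_fn B p x0) v w + bregman (prox_fn B p x0) w y
    + (grad (prox_fn B p x0) w (y - w) - grad (prox_fn B p x0) v (y - w))"
  using linear_diff[OF linear_grad_prox_fn[OF assms], of x0 v]
  by (simp add: bregman_def)

text \<open>
  The Hessian of \<open>N ^ (p + 1) / (p + 1)\<close> in the direction \<open>u\<close> is at least \<open>N y ^ (p - 1) (N u)\<^sup>2\<close>.
  At \<open>y = 0\<close> the norm itself is not differentiable, but there the function is \<open>O(s\<^sup>2)\<close> since \<open>p \<ge> 2\<close>.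
\<close>

lemma N_power_second_derivative:
  assumes p: "2 \<le> p"
  shows "\<exists>D. ((\<lambda>s. N (y + s *\<^sub>R u) ^ (p - 1) * B (y + s *\<^sub>R u) u) has_real_derivative D) (at \<tau>)
    \<and> N (y + \<tau> *\<^sub>R u) ^ (p - 1) * (N u)\<^sup>2 \<le> D"
proof (cases "y + \<tau> *\<^sub>R u = 0")
  case True
  then have y: "y = - \<tau> *\<^sub>R u" by (simp add: eq_neg_iff_add_eq_0)
  have line: "N (y + s *\<^sub>R u) ^ (p - 1) * B (y + s *\<^sub>R u) u
      = \<bar>s - \<tau>\<bar> ^ (p - 1) * (s - \<tau>) * (N u ^ (p - 1) * B u u)" for s
  proof -
    have "y + s *\<^sub>R u = (s - \<tau>) *\<^sub>R u" by (simp add: y scaleR_left_diff_distrib)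
    then show ?thesis by (simp add: N_scaleR B_simps power_mult_distrib)
  qed
  have "((\<lambda>s. \<bar>s - \<tau>\<bar> ^ (p - 1) * (s - \<tau>) * (N u ^ (p - 1) * B u u)) has_real_derivative 0) (at \<tau>)"
    unfolding has_field_derivative_iff
  proof (rule Lim_transform_eventually)
    have "isCont (\<lambda>s. \<bar>s - \<tau>\<bar> ^ (p - 1) * (N u ^ (p - 1) * B u u)) \<tau>"
      by (intro continuous_intros)
    then show "((\<lambda>s. \<bar>s - \<tau>\<bar> ^ (p - 1) * (N u ^ (p - 1) * B u u)) \<longlongrightarrow> 0) (at \<tau>)"
      using p by (simp add: isCont_def power_0_left)
    show "\<forall>\<^sub>F s in at \<tau>. \<bar>s - \<tau>\<bar> ^ (p - 1) * (N u ^ (p - 1) * B u u) =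
        (\<bar>s - \<tau>\<bar> ^ (p - 1) * (s - \<tau>) * (N u ^ (p - 1) * B u u)
         - \<bar>\<tau> - \<tau>\<bar> ^ (p - 1) * (\<tau> - \<tau>) * (N u ^ (p - 1) * B u u)) / (s - \<tau>)"
      by (auto simp: eventually_at_filter)
  qed
  then show ?thesis
    unfolding line using True p by (intro exI[of _ 0]) (simp add: power_0_left)
next
  case False
  define b where "b = B (y + \<tau> *\<^sub>R u) u"
  define n where "n = N (y + \<tau> *\<^sub>R u)"
  have n: "0 < n" using False N_nonneg[of "y + \<tau> *\<^sub>R u"] by (simp add: n_def less_le)
  have dN: "((\<lambda>s. N (y + s *\<^sub>R u)) has_real_derivative b / n) (at \<tau>)"
  proof -
    have pos: "0 < B y y + 2 * \<tau> * B y u + \<tau>\<^sup>2 * B u u"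
      using B_pos[OF False] by (simp add: B_line)
    have half_cancel: "inverse r / 2 * (2 * b) = b / r" for r
      by (simp add: field_simps)
    have q: "((\<lambda>s. B y y + 2 * s * B y u + s\<^sup>2 * B u u) has_real_derivative 2 * b) (at \<tau>)"
      by (auto intro!: derivative_eq_intros simp: b_def B_simps)
    have "((\<lambda>s. sqrt (B y y + 2 * s * B y u + s\<^sup>2 * B u u)) has_real_derivative
        inverse (sqrt (B y y + 2 * \<tau> * B y u + \<tau>\<^sup>2 * B u u)) / 2 * (2 * b)) (at \<tau>)"
      by (rule DERIV_chain2[OF DERIV_real_sqrt[OF pos] q])
    moreover have "inverse (sqrt (B y y + 2 * \<tau> * B y u + \<tau>\<^sup>2 * B u u)) / 2 * (2 * b) = b / n"
      unfolding n_def nrm_def B_line by (rule half_cancel)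
    moreover have "(\<lambda>s. N (y + s *\<^sub>R u)) = (\<lambda>s. sqrt (B y y + 2 * s * B y u + s\<^sup>2 * B u u))"
      unfolding nrm_def B_line ..
    ultimately show ?thesis by metis
  qed
  obtain m where m: "p = m + 2" using p by (metis add.commute le_Suc_ex)
  let ?D = "real (m + 1) * (b / n * n ^ m) * b + B u u * n ^ (m + 1)"
  have "((\<lambda>s. N (y + s *\<^sub>R u) ^ (m + 1)) has_real_derivative real (m + 1) * (b / n * n ^ m)) (at \<tau>)"
    using DERIV_power[OF dN, of "m + 1"] by (simp add: n_def)
  moreover have "((\<lambda>s. B (y + s *\<^sub>R u) u) has_real_derivative B u u) (at \<tau>)"
    unfolding bilinear_ladd[OF bilinear_B] bilinear_lmul[OF bilinear_B]
    by (auto intro!: derivative_eq_intros)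
  ultimately have "((\<lambda>s. N (y + s *\<^sub>R u) ^ (m + 1) * B (y + s *\<^sub>R u) u) has_real_derivative ?D) (at \<tau>)"
    unfolding b_def n_def by (rule DERIV_mult)
  moreover have "0 \<le> real (m + 1) * (b / n * n ^ m) * b"
  proof -
    have eq: "real (m + 1) * (b / n * n ^ m) * b = real (m + 1) * (b\<^sup>2 * n ^ m / n)"
      by (simp add: power2_eq_square)
    show ?thesis unfolding eq using n by simp
  qed
  ultimately show ?thesis
    by (intro exI[of _ ?D]) (simp add: m N_square n_def mult.commute)
qed

end

section \<open>Iterated derivatives\<close>

text \<open>
  The second difference of \<open>G\<close> over the parallelogram spanned by \<open>t h\<close> and \<open>t k\<close> is
  \<open>t\<^sup>2 D\<^sup>2 G(x)[h, k] + o(t\<^sup>2)\<close>: the mean value theorem along \<open>h\<close> reduces it to a difference of first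
  derivatives in the direction \<open>h\<close>, and differentiability of these at the single point \<open>x\<close> suffices.
\<close>

lemma second_difference:
  fixes G :: "'a::real_normed_vector \<Rightarrow> real"
  assumes D: "open D" "x \<in> D"
    and G: "\<And>y. y \<in> D \<Longrightarrow> (G has_derivative G' y) (at y)"
    and H: "((\<lambda>y. G' y h) has_derivative H) (at x)"
    and \<epsilon>: "0 < \<epsilon>"
  shows "\<exists>r>0. \<forall>t. 0 < t \<and> t < r \<longrightarrow>
    \<bar>G (x + t *\<^sub>R h + t *\<^sub>R k) - G (x + t *\<^sub>R h) - G (x + t *\<^sub>R k) + G x - t\<^sup>2 * H k\<bar> \<le> \<epsilon> * t\<^sup>2"
proof -
  define c where "c = norm h + norm k + 1"
  have c: "0 < c" by (simp add: c_def add_nonneg_pos)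
  have lin: "linear H" using H by (rule has_derivative_linear)
  obtain \<rho>1 where \<rho>1: "0 < \<rho>1" "ball x \<rho>1 \<subseteq> D"
    using D open_contains_ball by blast
  have "0 < \<epsilon> / (2 * c)" using c \<epsilon> by simp
  then obtain \<rho>2 where \<rho>2: "0 < \<rho>2"
      "\<And>y. norm (y - x) < \<rho>2 \<Longrightarrow> \<bar>G' y h - G' x h - H (y - x)\<bar> \<le> \<epsilon> / (2 * c) * norm (y - x)"
    using H unfolding has_derivative_at_alt real_norm_def by blast
  define r where "r = min \<rho>1 \<rho>2 / c"
  have r: "0 < r" using \<rho>1 \<rho>2 c by (simp add: r_def)
  moreover have "\<bar>G (x + t *\<^sub>R h + t *\<^sub>R k) - G (x + t *\<^sub>R h) - G (x + t *\<^sub>R k) + G x - t\<^sup>2 * H k\<bar> \<le> \<epsilon> * t\<^sup>2"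
    if t: "0 < t" "t < r" for t
  proof -
    have tc: "t * c < \<rho>1" "t * c < \<rho>2"
      using t(2) c by (auto simp: r_def field_simps)
    have near: "norm (s *\<^sub>R h + q *\<^sub>R k) \<le> t * c" if "0 \<le> s" "s \<le> t" "0 \<le> q" "q \<le> t" for s q
    proof -
      have "norm (s *\<^sub>R h + q *\<^sub>R k) \<le> s * norm h + q * norm k"
        using norm_triangle_ineq[of "s *\<^sub>R h" "q *\<^sub>R k"] that by simp
      also have "\<dots> \<le> t * norm h + t * norm k"
        using that by (intro add_mono mult_right_mono) auto
      also have "\<dots> \<le> t * c" using t by (simp add: c_def algebra_simps)
      finally show ?thesis .
    qed
    have inD: "x + (s *\<^sub>R h + q *\<^sub>R k) \<in> D" if "0 \<le> s" "s \<le> t" "0 \<le> q" "q \<le> t" for s q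
    proof -
      have "norm (s *\<^sub>R h + q *\<^sub>R k) < \<rho>1" using near[OF that] tc(1) by simp
      then have "x + (s *\<^sub>R h + q *\<^sub>R k) \<in> ball x \<rho>1"
        by (metis add_diff_cancel_left' dist_commute dist_norm mem_ball)
      then show ?thesis using \<rho>1(2) by blast
    qed
    define \<phi> where "\<phi> s = G (x + t *\<^sub>R k + s *\<^sub>R h) - G (x + s *\<^sub>R h)" for s
    define \<phi>' where "\<phi>' s = G' (x + t *\<^sub>R k + s *\<^sub>R h) h - G' (x + s *\<^sub>R h) h" for s
    have "(\<phi> has_real_derivative \<phi>' s) (at s)" if "0 \<le> s" "s \<le> t" for s
      unfolding \<phi>_def \<phi>'_def
      using inD[of s t] inD[of s 0] that t
      by (intro DERIV_diff has_real_derivative_line G) (auto simp: algebra_simps)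
    then obtain \<sigma> where \<sigma>: "0 < \<sigma>" "\<sigma> < t" "\<phi> t - \<phi> 0 = (t - 0) * \<phi>' \<sigma>"
      using MVT2[OF t(1), of \<phi> \<phi>'] by blast
    have bd: "\<bar>G' (x + (s *\<^sub>R h + q *\<^sub>R k)) h - G' x h - H (s *\<^sub>R h + q *\<^sub>R k)\<bar> \<le> \<epsilon> / 2 * t"
      if "0 \<le> s" "s \<le> t" "0 \<le> q" "q \<le> t" for s q
    proof -
      have "\<bar>G' (x + (s *\<^sub>R h + q *\<^sub>R k)) h - G' x h - H (s *\<^sub>R h + q *\<^sub>R k)\<bar>
          \<le> \<epsilon> / (2 * c) * norm (s *\<^sub>R h + q *\<^sub>R k)"
        using \<rho>2(2)[of "x + (s *\<^sub>R h + q *\<^sub>R k)"] near[OF that] tc(2) by simp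
      also have "\<dots> \<le> \<epsilon> / (2 * c) * (t * c)"
        using near[OF that] \<epsilon> c by (intro mult_left_mono) auto
      finally show ?thesis using c by simp
    qed
    have "\<bar>\<phi>' \<sigma> - t * H k\<bar> \<le> \<epsilon> * t"
    proof -
      define X where "X q = G' (x + (\<sigma> *\<^sub>R h + q *\<^sub>R k)) h - G' x h - H (\<sigma> *\<^sub>R h + q *\<^sub>R k)" for q
      have "\<bar>X t\<bar> \<le> \<epsilon> / 2 * t" "\<bar>X 0\<bar> \<le> \<epsilon> / 2 * t"
        using bd[of \<sigma> t] bd[of \<sigma> 0] \<sigma>(1,2) t(1) by (simp_all add: X_def)
      moreover have "\<phi>' \<sigma> - t * H k = X t - X 0"
        by (simp add: \<phi>'_def X_def linear_add[OF lin] linear_scale[OF lin] algebra_simps)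
      ultimately show ?thesis using abs_triangle_ineq4[of "X t" "X 0"] by simp
    qed
    then have "t * \<bar>\<phi>' \<sigma> - t * H k\<bar> \<le> t * (\<epsilon> * t)"
      using t(1) by (intro mult_left_mono) auto
    moreover have "t * \<bar>\<phi>' \<sigma> - t * H k\<bar> = \<bar>t * \<phi>' \<sigma> - t\<^sup>2 * H k\<bar>"
      using t(1) abs_mult[of t "\<phi>' \<sigma> - t * H k"] by (simp add: power2_eq_square algebra_simps)
    moreover have "t * \<phi>' \<sigma> = G (x + t *\<^sub>R h + t *\<^sub>R k) - G (x + t *\<^sub>R h) - G (x + t *\<^sub>R k) + G x"
      using \<sigma>(3) by (simp add: \<phi>_def add.commute add.left_commute)
    ultimately show ?thesis by (simp add: power2_eq_square mult.left_commute)
  qed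
  ultimately show ?thesis by blast
qed

lemma second_derivative_symmetric:
  fixes G :: "'a::real_normed_vector \<Rightarrow> real"
  assumes D: "open D" "x \<in> D"
    and G: "\<And>y. y \<in> D \<Longrightarrow> (G has_derivative G' y) (at y)"
    and H: "((\<lambda>y. G' y h) has_derivative H) (at x)"
    and K: "((\<lambda>y. G' y k) has_derivative K) (at x)"
  shows "H k = K h"
proof (rule ccontr)
  assume "H k \<noteq> K h"
  define \<epsilon> where "\<epsilon> = \<bar>H k - K h\<bar> / 3"
  have \<epsilon>: "0 < \<epsilon>" using \<open>H k \<noteq> K h\<close> by (simp add: \<epsilon>_def)
  obtain r1 where r1: "0 < r1" "\<And>t. 0 < t \<Longrightarrow> t < r1 \<Longrightarrow>
      \<bar>G (x + t *\<^sub>R h + t *\<^sub>R k) - G (x + t *\<^sub>R h) - G (x + t *\<^sub>R k) + G x - t\<^sup>2 * H k\<bar> \<le> \<epsilon> * t\<^sup>2"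
    using second_difference[OF D G H \<epsilon>] by blast
  obtain r2 where r2: "0 < r2" "\<And>t. 0 < t \<Longrightarrow> t < r2 \<Longrightarrow>
      \<bar>G (x + t *\<^sub>R k + t *\<^sub>R h) - G (x + t *\<^sub>R k) - G (x + t *\<^sub>R h) + G x - t\<^sup>2 * K h\<bar> \<le> \<epsilon> * t\<^sup>2"
    using second_difference[OF D G K \<epsilon>] by blast
  define t where "t = min r1 r2 / 2"
  have t: "0 < t" "t < r1" "t < r2" using r1(1) r2(1) by (auto simp: t_def)
  have "x + t *\<^sub>R k + t *\<^sub>R h = x + t *\<^sub>R h + t *\<^sub>R k" by (simp add: algebra_simps)
  then have "\<bar>t\<^sup>2 * H k - t\<^sup>2 * K h\<bar> \<le> 2 * (\<epsilon> * t\<^sup>2)"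
    using r1(2)[OF t(1,2)] r2(2)[OF t(1,3)] by (simp only:)
  also have "\<bar>t\<^sup>2 * H k - t\<^sup>2 * K h\<bar> = t\<^sup>2 * (3 * \<epsilon>)"
    using abs_mult[of "t\<^sup>2" "H k - K h"] by (simp add: \<epsilon>_def right_diff_distrib)
  finally show False using t(1) \<epsilon> by simp
qed

lemma linear_basis_sum:
  fixes l :: "'a::euclidean_space \<Rightarrow> real"
  assumes "linear l"
  shows "(\<Sum>b\<in>Basis. (h \<bullet> b) * l b) = l h"
proof -
  have "l h = l (\<Sum>b\<in>Basis. (h \<bullet> b) *\<^sub>R b)" by (simp add: euclidean_representation)
  then show ?thesis by (simp add: linear_sum[OF assms] linear_scale[OF assms])
qed

locale smooth_function =
  fixes p :: nat and g :: "'a::euclidean_space \<Rightarrow> real" and D :: "'a set"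
  assumes open_D: "open D" and smooth: "times_differentiable_on p g D"
begin

abbreviation G where "G \<equiv> nderiv g"

lemma nderiv_has_derivative:
  assumes "x \<in> D" "length hs < p"
  shows "(G hs has_derivative (\<lambda>h. G (h # hs) x)) (at x)"
  using smooth assms unfolding times_differentiable_on_def
  by (simp add: frechet_derivative_works[symmetric])

text \<open>
  Identities between iterated derivatives that hold throughout the open set \<open>D\<close> may be differentiated
  once more. This is the induction step of the next two lemmas.
\<close>

lemma nderiv_Cons_eqI:
  assumes x: "x \<in> D" and l: "length hs < p"
    and F: "(F has_derivative F') (at x)" and eq: "\<And>y. y \<in> D \<Longrightarrow> F y = G hs y"
  shows "G (u # hs) x = F' u"
proof -
  have "(G hs has_derivative F') (at x)"
    using has_derivative_transform_within_open[OF F open_D x eq] .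
  then show ?thesis
    using has_derivative_unique[OF _ nderiv_has_derivative[OF x l]] by (metis)
qed

lemma linear_nderiv:
  "x \<in> D \<Longrightarrow> length us + length ws < p \<Longrightarrow> linear (\<lambda>h. G (us @ h # ws) x)"
proof (induction us arbitrary: x)
  case Nil
  then show ?case using has_derivative_linear[OF nderiv_has_derivative[of x ws]] by simp
next
  case (Cons u us)
  have l: "length (us @ h # ws) < p" for h using Cons.prems(2) by simp
  have lin: "linear (\<lambda>h. G (us @ h # ws) y)" if "y \<in> D" for y
    using Cons.IH[OF that] Cons.prems(2) by simp
  note der = nderiv_has_derivative[OF Cons.prems(1) l]
  show ?case
  proof (rule linearI)
    fix h k
    show "G ((u # us) @ (h + k) # ws) x = G ((u # us) @ h # ws) x + G ((u # us) @ k # ws) x"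
      using nderiv_Cons_eqI[OF Cons.prems(1) l has_derivative_add[OF der der], where u = u]
        linear_add[OF lin] by simp
  next
    fix c h
    show "G ((u # us) @ (c *\<^sub>R h) # ws) x = c *\<^sub>R G ((u # us) @ h # ws) x"
      using nderiv_Cons_eqI[OF Cons.prems(1) l has_derivative_mult_right[OF der], where u = u]
        linear_scale[OF lin] by simp
  qed
qed

lemma nderiv_swap:
  "x \<in> D \<Longrightarrow> length us + length ws + 2 \<le> p \<Longrightarrow> G (us @ h # k # ws) x = G (us @ k # h # ws) x"
proof (induction us arbitrary: x)
  case Nil
  then have "G (k # h # ws) x = G (h # k # ws) x"
    by (intro second_derivative_symmetric[OF open_D Nil.prems(1), of "G ws" "\<lambda>y v. G (v # ws) y"]
        nderiv_has_derivative) auto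
  then show ?case by simp
next
  case (Cons u us)
  have l: "length (us @ h # k # ws) < p" "length (us @ k # h # ws) < p" using Cons.prems(2) by simp_all
  show ?case
    using nderiv_Cons_eqI[OF Cons.prems(1) l(1) nderiv_has_derivative[OF Cons.prems(1) l(2)]]
      Cons.IH Cons.prems(2) by simp
qed

text \<open>
  The induction moves one of the \<open>i + 1\<close> equal arguments next to \<open>us\<close> and expands it in the
  basis, which leaves \<open>i\<close> equal arguments times a coordinate.
\<close>

lemma has_derivative_nderiv_replicate:
  "x \<in> D \<Longrightarrow> i + length us \<le> p \<Longrightarrow>
    ((\<lambda>h. G (replicate i h @ us) x) has_derivative
     (\<lambda>u. real i * G (replicate (i - 1) h @ u # us) x)) (at h)"
proof (induction i arbitrary: us)
  case (Suc i)
  have lin: "linear (\<lambda>b. G (replicate i h @ b # us) x)" for h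
    using Suc.prems by (intro linear_nderiv) auto
  have eq: "G (replicate (Suc i) h @ us) x = (\<Sum>b\<in>Basis. (h \<bullet> b) * G (replicate i h @ b # us) x)" for h
    unfolding linear_basis_sum[OF lin] by (simp add: replicate_app_Cons_same)
  have "((\<lambda>h. \<Sum>b\<in>Basis. (h \<bullet> b) * G (replicate i h @ b # us) x) has_derivative
     (\<lambda>u. \<Sum>b\<in>Basis. (h \<bullet> b) * (real i * G (replicate (i - 1) h @ u # b # us) x)
        + (u \<bullet> b) * G (replicate i h @ b # us) x)) (at h)"
    using Suc.prems
    by (intro has_derivative_sum has_derivative_mult has_derivative_inner_left has_derivative_ident Suc.IH) auto
  moreover have "(\<Sum>b\<in>Basis. (h \<bullet> b) * (real i * G (replicate (i - 1) h @ u # b # us) x)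
        + (u \<bullet> b) * G (replicate i h @ b # us) x)
      = real (Suc i) * G (replicate (Suc i - 1) h @ u # us) x" (is "?l = _") for u
  proof -
    have "?l = real i * (\<Sum>b\<in>Basis. (h \<bullet> b) * G (replicate (i - 1) h @ u # b # us) x)
        + (\<Sum>b\<in>Basis. (u \<bullet> b) * G (replicate i h @ b # us) x)"
      by (simp add: sum.distrib sum_distrib_left mult.left_commute)
    also have "(\<Sum>b\<in>Basis. (u \<bullet> b) * G (replicate i h @ b # us) x) = G (replicate i h @ u # us) x"
      by (rule linear_basis_sum[OF lin])
    also have "real i * (\<Sum>b\<in>Basis. (h \<bullet> b) * G (replicate (i - 1) h @ u # b # us) x)
        = real i * G (replicate i h @ u # us) x"
    proof (cases i)
      case (Suc j)
      have "linear (\<lambda>b. G ((replicate j h @ [u]) @ b # us) x)"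
        using Suc.prems Suc by (intro linear_nderiv) auto
      from linear_basis_sum[OF this, of h]
      have "(\<Sum>b\<in>Basis. (h \<bullet> b) * G (replicate j h @ u # b # us) x) = G (replicate j h @ u # h # us) x"
        by simp
      also have "\<dots> = G (replicate j h @ h # u # us) x"
        using Suc.prems Suc by (intro nderiv_swap) auto
      finally show ?thesis by (simp add: Suc replicate_app_Cons_same)
    qed simp
    finally show ?thesis by (simp add: algebra_simps)
  qed
  ultimately show ?case unfolding eq by simp
qed simp

text \<open>The Taylor polynomial at \<open>x\<close> of the derivative of \<open>g\<close> in the directions \<open>us\<close>, to total order \<open>p\<close>.\<close>

definition deriv_taylor :: "'a list \<Rightarrow> 'a \<Rightarrow> 'a \<Rightarrow> real" where
  "deriv_taylor us x y = (\<Sum>i\<le>p - length us. G (replicate i (y - x) @ us) x / fact i)"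

lemma taylor_eq_deriv_taylor: "taylor p g x y = deriv_taylor [] x y"
proof -
  have "{..p} = insert 0 {1..p}" by auto
  then show ?thesis by (simp add: taylor_def deriv_taylor_def)
qed

lemma deriv_taylor_has_derivative:
  assumes x: "x \<in> D" and l: "length us < p"
  shows "(deriv_taylor us x has_derivative (\<lambda>u. deriv_taylor (u # us) x y)) (at y)"
proof -
  obtain n where n: "p - length us = Suc n" using l by (metis Suc_diff_Suc)
  have "((\<lambda>y. G (replicate i (y - x) @ us) x / fact i) has_derivative
      (\<lambda>u. real i * G (replicate (i - 1) (y - x) @ u # us) x / fact i)) (at y)" if "i \<le> Suc n" for i
  proof -
    have "i + length us \<le> p" using that n l by linarith
    from has_derivative_nderiv_replicate[OF x this]
    have "((\<lambda>y. G (replicate i (y - x) @ us) x) has_derivative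
      (\<lambda>u. real i * G (replicate (i - 1) (y - x) @ u # us) x)) (at y)"
      by (intro has_derivative_compose[of "\<lambda>y. y - x" "\<lambda>h. h" y UNIV "\<lambda>h. G (replicate i h @ us) x"])
        (auto intro!: derivative_eq_intros)
    then show ?thesis using has_derivative_mult_left[of _ _ _ "1 / fact i"] by fastforce
  qed
  then have "(deriv_taylor us x has_derivative
      (\<lambda>u. \<Sum>i\<le>Suc n. real i * G (replicate (i - 1) (y - x) @ u # us) x / fact i)) (at y)"
    unfolding deriv_taylor_def[abs_def] n by (intro has_derivative_sum) auto
  moreover have "(\<Sum>i\<le>Suc n. real i * G (replicate (i - 1) (y - x) @ u # us) x / fact i)
      = deriv_taylor (u # us) x y" for u
  proof -
    have "(\<Sum>i\<le>Suc n. real i * G (replicate (i - 1) (y - x) @ u # us) x / fact i)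
      = (\<Sum>i\<le>n. real (Suc i) * G (replicate i (y - x) @ u # us) x / fact (Suc i))"
      by (subst sum.atMost_Suc_shift) simp
    also have "\<dots> = (\<Sum>i\<le>n. G (replicate i (y - x) @ u # us) x / fact i)"
      by (intro sum.cong refl) (simp add: fact_Suc divide_simps del: of_nat_Suc)
    moreover have "p - length (u # us) = n" using n by simp
    ultimately show ?thesis by (simp only: deriv_taylor_def)
  qed
  ultimately show ?thesis by simp
qed

lemma multilinear_nderiv_diff:
  assumes "x \<in> D" "y \<in> D"
  shows "multilinear p (\<lambda>hs. G hs x - G hs y)"
  unfolding multilinear_def
  using assms by (auto intro!: linear_compose_sub linear_nderiv)

end

text \<open>
  Induction on the order: the derivative of the remainder of \<open>\<phi> 0\<close> is the remainder of \<open>\<phi> 1\<close>, and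
  comparison with the derivative of \<open>c \<tau> ^ (n + 2) / (n + 2)!\<close> integrates the bound.
\<close>

lemma taylor_remainder_1d:
  fixes \<phi> :: "nat \<Rightarrow> real \<Rightarrow> real"
  assumes "\<And>i \<tau>. i < n \<Longrightarrow> 0 \<le> \<tau> \<Longrightarrow> \<tau> \<le> 1 \<Longrightarrow> (\<phi> i has_real_derivative \<phi> (Suc i) \<tau>) (at \<tau>)"
    and "\<And>\<tau>. 0 \<le> \<tau> \<Longrightarrow> \<tau> \<le> 1 \<Longrightarrow> \<bar>\<phi> n \<tau> - \<phi> n 0\<bar> \<le> c * \<tau>"
    and "0 \<le> \<tau>" "\<tau> \<le> 1"
  shows "\<bar>\<phi> 0 \<tau> - (\<Sum>i\<le>n. \<phi> i 0 * \<tau> ^ i / fact i)\<bar> \<le> c * \<tau> ^ (n + 1) / fact (n + 1)"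
  using assms
proof (induction n arbitrary: \<phi> \<tau>)
  case 0
  then show ?case by simp
next
  case (Suc n)
  define R where "R \<tau> = \<phi> 0 \<tau> - (\<Sum>i\<le>Suc n. \<phi> i 0 * \<tau> ^ i / fact i)" for \<tau>
  define R' where "R' \<tau> = \<phi> 1 \<tau> - (\<Sum>i\<le>n. \<phi> (Suc i) 0 * \<tau> ^ i / fact i)" for \<tau>
  define b where "b \<tau> = c * \<tau> ^ (n + 2) / fact (n + 2)" for \<tau>
  have R: "(R has_real_derivative R' \<tau>) (at \<tau>)" if "0 \<le> \<tau>" "\<tau> \<le> 1" for \<tau>
  proof -
    have "((\<lambda>\<tau>. \<phi> 0 \<tau> - (\<Sum>i\<le>Suc n. \<phi> i 0 * \<tau> ^ i / fact i)) has_real_derivative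
        \<phi> 1 \<tau> - (\<Sum>i\<le>Suc n. \<phi> i 0 * (real i * \<tau> ^ (i - 1)) / fact i)) (at \<tau>)"
      using Suc.prems(1)[of 0 \<tau>] that
      by (intro DERIV_diff DERIV_sum) (auto intro!: derivative_eq_intros)
    moreover have "(\<Sum>i\<le>Suc n. \<phi> i 0 * (real i * \<tau> ^ (i - 1)) / fact i)
        = (\<Sum>i\<le>n. \<phi> (Suc i) 0 * \<tau> ^ i / fact i)"
      by (subst sum.atMost_Suc_shift)
        (auto intro!: sum.cong simp: fact_Suc divide_simps simp del: of_nat_Suc)
    ultimately show ?thesis unfolding R_def[abs_def] R'_def by simp
  qed
  have R'_le: "\<bar>R' \<tau>\<bar> \<le> c * \<tau> ^ (n + 1) / fact (n + 1)" if "0 \<le> \<tau>" "\<tau> \<le> 1" for \<tau>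
    using Suc.IH[of "\<lambda>i. \<phi> (Suc i)" \<tau>] Suc.prems(1,2) that by (simp add: R'_def)
  have b: "(b has_real_derivative c * \<tau> ^ (n + 1) / fact (n + 1)) (at \<tau>)" for \<tau>
  proof -
    have "(b has_real_derivative c * (real (n + 2) * \<tau> ^ (n + 1)) / fact (n + 2)) (at \<tau>)"
      unfolding b_def[abs_def] using DERIV_cdivide[OF DERIV_cmult[OF DERIV_pow[of "n + 2" \<tau> UNIV]], of c "fact (n + 2)"]
      by simp
    moreover have "c * (real (n + 2) * \<tau> ^ (n + 1)) / fact (n + 2) = c * \<tau> ^ (n + 1) / fact (n + 1)"
      using fact_Suc[of "n + 1", where 'a = real] by (simp add: divide_simps del: fact_Suc)
    ultimately show ?thesis by simp
  qed
  have R0: "R 0 = 0" "b 0 = 0"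
    by (simp_all add: R_def b_def sum.atMost_Suc_shift)
  have "b 0 - R 0 \<le> b \<tau> - R \<tau>"
  proof (rule DERIV_nonneg_imp_nondecreasing[where f = "\<lambda>\<tau>. b \<tau> - R \<tau>"])
    fix s assume "0 \<le> s" "s \<le> \<tau>"
    then have s: "0 \<le> s" "s \<le> 1" using Suc.prems(4) by auto
    show "\<exists>y. ((\<lambda>\<tau>. b \<tau> - R \<tau>) has_real_derivative y) (at s) \<and> 0 \<le> y"
      by (rule exI, rule conjI[OF DERIV_diff[OF b R[OF s]]]) (use R'_le[OF s] in linarith)
  qed (rule Suc.prems(3))
  moreover have "b 0 + R 0 \<le> b \<tau> + R \<tau>"
  proof (rule DERIV_nonneg_imp_nondecreasing[where f = "\<lambda>\<tau>. b \<tau> + R \<tau>"])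
    fix s assume "0 \<le> s" "s \<le> \<tau>"
    then have s: "0 \<le> s" "s \<le> 1" using Suc.prems(4) by auto
    show "\<exists>y. ((\<lambda>\<tau>. b \<tau> + R \<tau>) has_real_derivative y) (at s) \<and> 0 \<le> y"
      by (rule exI, rule conjI[OF DERIV_add[OF b R[OF s]]]) (use R'_le[OF s] in linarith)
  qed (rule Suc.prems(3))
  ultimately have "\<bar>R \<tau>\<bar> \<le> b \<tau>" using R0 by linarith
  then show ?case by (simp add: R_def b_def)
qed

section \<open>First-order conditions for convex functions\<close>

lemma derivative_le_slope:
  fixes \<phi> :: "real \<Rightarrow> real"
  assumes d: "(\<phi> has_real_derivative d) (at 0)"
    and le: "\<And>\<tau>. 0 < \<tau> \<Longrightarrow> \<tau> \<le> 1 \<Longrightarrow> \<phi> \<tau> \<le> \<phi> 0 + \<tau> * c"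
  shows "d \<le> c"
proof (rule ccontr)
  assume "\<not> d \<le> c"
  moreover have "((\<lambda>\<tau>. \<phi> \<tau> - \<tau> * c) has_real_derivative d - c) (at 0)"
    using d by (auto intro!: derivative_eq_intros)
  ultimately obtain r where r: "0 < r" "\<And>h. 0 < h \<Longrightarrow> h < r \<Longrightarrow> \<phi> 0 - 0 * c < \<phi> (0 + h) - (0 + h) * c"
    using DERIV_pos_inc_right[of "\<lambda>\<tau>. \<phi> \<tau> - \<tau> * c" "d - c" 0] by auto
  define \<tau> where "\<tau> = min (r / 2) 1"
  have "0 < \<tau>" "\<tau> < r" "\<tau> \<le> 1" using r(1) by (auto simp: \<tau>_def)
  then show False using r(2)[of \<tau>] le[of \<tau>] by simp
qed

lemma convex_combination_line: "x + \<tau> *\<^sub>R (y - x) = (1 - \<tau>) *\<^sub>R x + \<tau> *\<^sub>R y"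
  for x y :: "'a::real_vector"
  by (simp add: algebra_simps)

lemma convex_on_line_le:
  assumes "convex_on S f" "x \<in> S" "y \<in> S" "0 \<le> \<tau>" "\<tau> \<le> 1"
  shows "f (x + \<tau> *\<^sub>R (y - x)) \<le> f x + \<tau> * (f y - f x)"
  using convex_onD[OF assms(1), of \<tau> x y] assms
  by (simp add: convex_combination_line algebra_simps)

lemma convex_line_in:
  assumes "convex S" "x \<in> S" "y \<in> S" "0 \<le> \<tau>" "\<tau> \<le> 1"
  shows "x + \<tau> *\<^sub>R (y - x) \<in> S"
  using convexD[OF assms(1), of x y "1 - \<tau>" \<tau>] assms by (simp add: convex_combination_line)

lemma convex_on_ge_tangent:
  assumes cvx: "convex_on S f" and xy: "x \<in> S" "y \<in> S" and der: "(f has_derivative f') (at x)"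
  shows "f x + f' (y - x) \<le> f y"
proof -
  have "f' (y - x) \<le> f y - f x"
  proof (rule derivative_le_slope[where \<phi> = "\<lambda>\<tau>. f (x + \<tau> *\<^sub>R (y - x))"])
    show "((\<lambda>\<tau>. f (x + \<tau> *\<^sub>R (y - x))) has_real_derivative f' (y - x)) (at 0)"
      using der by (intro has_real_derivative_line) simp
  qed (use convex_on_line_le[OF cvx xy] in simp)
  then show ?thesis by simp
qed

text \<open>
  Only \<open>Q\<close> is differentiable; along a segment the increment of \<open>\<psi>\<close> is bounded by that of its chord.
\<close>

lemma composite_first_order_optimality:
  assumes cvx: "convex_on E \<psi>" and T: "T \<in> E" "y \<in> E" and a: "0 \<le> a"
    and min: "\<And>y. y \<in> E \<Longrightarrow> Q T + a * \<psi> T \<le> Q y + a * \<psi> y"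
    and der: "(Q has_derivative Q') (at T)"
  shows "0 \<le> Q' (y - T) + a * \<psi> y - a * \<psi> T"
proof -
  have E: "convex E" using cvx by (simp add: convex_on_def)
  have "- Q' (y - T) \<le> a * (\<psi> y - \<psi> T)"
  proof (rule derivative_le_slope[where \<phi> = "\<lambda>\<tau>. - Q (T + \<tau> *\<^sub>R (y - T))"])
    have "(Q has_derivative Q') (at (T + 0 *\<^sub>R (y - T)))" using der by simp
    then show "((\<lambda>\<tau>. - Q (T + \<tau> *\<^sub>R (y - T))) has_real_derivative - Q' (y - T)) (at 0)"
      by (intro DERIV_minus has_real_derivative_line)
    fix \<tau> :: real assume \<tau>: "0 < \<tau>" "\<tau> \<le> 1"
    then have "Q T + a * \<psi> T \<le> Q (T + \<tau> *\<^sub>R (y - T)) + a * \<psi> (T + \<tau> *\<^sub>R (y - T))"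
      by (intro min convex_line_in E T) auto
    also have "a * \<psi> (T + \<tau> *\<^sub>R (y - T)) \<le> a * (\<psi> T + \<tau> * (\<psi> y - \<psi> T))"
      using \<tau> by (intro mult_left_mono convex_on_line_le[OF cvx] T a) auto
    finally show "- Q (T + \<tau> *\<^sub>R (y - T)) \<le> - Q (T + 0 *\<^sub>R (y - T)) + \<tau> * (a * (\<psi> y - \<psi> T))"
      by (simp add: algebra_simps)
  qed
  then show ?thesis by (simp add: algebra_simps)
qed

section \<open>The regularized Taylor model\<close>

locale tensor_model = pos_def_norm B + smooth_function p g D
  for B :: "'a::euclidean_space \<Rightarrow> 'a \<Rightarrow> real" and p and g :: "'a \<Rightarrow> real" and D +
  fixes L :: real
  assumes p_pos: "1 \<le> p" and L_pos: "0 < L" and convex_g: "convex_on D g"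
    and lipschitz: "\<And>x y hs. x \<in> D \<Longrightarrow> y \<in> D \<Longrightarrow> length hs = p \<Longrightarrow>
      \<bar>nderiv g hs x - nderiv g hs y\<bar> \<le> L * N (x - y) * prod_list (map N hs)"
begin

abbreviation M where "M \<equiv> real p * L"

lemma convex_D: "convex D"
  using convex_g by (simp add: convex_on_def)

lemma grad_g_has_derivative: "x \<in> D \<Longrightarrow> (g has_derivative grad g x) (at x)"
  and grad_g: "grad g x u = G [u] x"
  using nderiv_has_derivative[of x "[]"] p_pos by (auto simp: grad_def)

lemma g_ge_tangent: "x \<in> D \<Longrightarrow> y \<in> D \<Longrightarrow> g x + grad g x (y - x) \<le> g y"
  by (rule convex_on_ge_tangent[OF convex_g _ _ grad_g_has_derivative])

text \<open>
  The one-dimensional estimate along the segment from \<open>x\<close> to \<open>y\<close>, for the derivative of \<open>g\<close> in the fixed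
  directions \<open>us\<close>. The lists of length \<open>0\<close>, \<open>1\<close> and \<open>2\<close> give the bounds for the values, gradients and
  Hessians of the Taylor polynomial.
\<close>

lemma taylor_remainder:
  assumes x: "x \<in> D" and y: "y \<in> D" and l: "length us \<le> p"
  shows "\<bar>G us y - deriv_taylor us x y\<bar>
    \<le> L * N (y - x) ^ (p + 1 - length us) * prod_list (map N us) / fact (p + 1 - length us)"
proof -
  define n where "n = p - length us"
  define h where "h = y - x"
  define c where "c = L * N h ^ (n + 1) * prod_list (map N us)"
  define \<phi> where "\<phi> i \<tau> = G (replicate i h @ us) (x + \<tau> *\<^sub>R h)" for i \<tau>
  have inD: "x + \<tau> *\<^sub>R h \<in> D" if "0 \<le> \<tau>" "\<tau> \<le> 1" for \<tau>
    unfolding h_def by (rule convex_line_in[OF convex_D x y that])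
  have "\<bar>\<phi> 0 1 - (\<Sum>i\<le>n. \<phi> i 0 * 1 ^ i / fact i)\<bar> \<le> c * 1 ^ (n + 1) / fact (n + 1)"
  proof (rule taylor_remainder_1d)
    fix i \<tau> :: real and j assume "j < n" "0 \<le> \<tau>" "\<tau> \<le> 1"
    then have "(G (replicate j h @ us) has_derivative (\<lambda>u. G (u # replicate j h @ us) (x + \<tau> *\<^sub>R h)))
        (at (x + \<tau> *\<^sub>R h))"
      by (intro nderiv_has_derivative inD) (auto simp: n_def)
    from has_real_derivative_line[OF this]
    show "(\<phi> j has_real_derivative \<phi> (Suc j) \<tau>) (at \<tau>)"
      by (simp add: \<phi>_def[abs_def])
  next
    fix \<tau> :: real assume \<tau>: "0 \<le> \<tau>" "\<tau> \<le> 1"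
    have "length (replicate n h @ us) = p" using l by (simp add: n_def)
    from lipschitz[OF inD[OF \<tau>] x this]
    have "\<bar>\<phi> n \<tau> - \<phi> n 0\<bar> \<le> L * (\<tau> * N h) * prod_list (map N (replicate n h @ us))"
      using \<tau> by (simp add: \<phi>_def N_scaleR)
    also have "\<dots> = c * \<tau>" by (simp add: c_def)
    finally show "\<bar>\<phi> n \<tau> - \<phi> n 0\<bar> \<le> c * \<tau>" .
  qed auto
  moreover have "p + 1 - length us = n + 1" using l by (simp add: n_def)
  ultimately show ?thesis
    by (simp add: \<phi>_def c_def deriv_taylor_def h_def flip: n_def)
qed

lemma deriv_taylor_grad:
  assumes "x \<in> D"
  shows "(taylor p g x has_derivative grad (taylor p g x) y) (at y)"
    and "grad (taylor p g x) y u = deriv_taylor [u] x y"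
proof -
  have "(taylor p g x has_derivative (\<lambda>u. deriv_taylor [u] x y)) (at y)"
    using deriv_taylor_has_derivative[OF assms, of "[]" y] p_pos
    by (simp add: taylor_eq_deriv_taylor[abs_def])
  moreover from this have "grad (taylor p g x) y = (\<lambda>u. deriv_taylor [u] x y)"
    unfolding grad_def by (rule frechet_derivative_at[symmetric])
  ultimately show "(taylor p g x has_derivative grad (taylor p g x) y) (at y)"
    "grad (taylor p g x) y u = deriv_taylor [u] x y" by auto
qed

definition model :: "'a \<Rightarrow> 'a \<Rightarrow> real" where
  "model x y = taylor p g x y + M / fact (p + 1) * N (y - x) ^ (p + 1)"

definition model_grad :: "'a \<Rightarrow> 'a \<Rightarrow> 'a \<Rightarrow> real" where
  "model_grad x y u = grad (taylor p g x) y u + M / fact p * N (y - x) ^ (p - 1) * B (y - x) u"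

lemma step_subgrad_eq: "step_subgrad B p M g x T u = grad g T u - model_grad x T u"
  by (simp add: step_subgrad_def model_grad_def)

lemma model_eq: "model x y = taylor p g x y + M / fact p * prox_fn B p x y"
  by (simp add: model_def prox_fn_def add.commute mult.commute)

lemma model_grad_eq: "model_grad x y u = grad (taylor p g x) y u + M / fact p * grad (prox_fn B p x) y u"
  by (simp add: model_grad_def grad_prox_fn(2)[OF p_pos])

lemma model_has_derivative:
  assumes "x \<in> D"
  shows "(model x has_derivative model_grad x y) (at y)"
  unfolding model_eq[abs_def] model_grad_eq[abs_def]
  by (intro has_derivative_add has_derivative_mult_right deriv_taylor_grad(1)[OF assms] grad_prox_fn(1)[OF p_pos])

text \<open>A negative value would make the directional derivative decrease along \<open>u\<close>, against monotonicity of the gradient.\<close>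

lemma convex_second_derivative_nonneg:
  assumes p: "2 \<le> p" and y: "y \<in> D"
  shows "0 \<le> G [u, u] y"
proof (rule ccontr)
  assume neg: "\<not> 0 \<le> G [u, u] y"
  have "(G [u] has_derivative (\<lambda>h. G [h, u] y)) (at (y + 0 *\<^sub>R u))"
    using nderiv_has_derivative[OF y, of "[u]"] p by simp
  from has_real_derivative_line[OF this]
  have "((\<lambda>s. G [u] (y + s *\<^sub>R u)) has_real_derivative G [u, u] y) (at 0)" .
  then obtain r1 where r1: "0 < r1" "\<And>h. 0 < h \<Longrightarrow> h < r1 \<Longrightarrow> G [u] (y + h *\<^sub>R u) < G [u] y"
    using DERIV_neg_dec_right[of "\<lambda>s. G [u] (y + s *\<^sub>R u)" "G [u, u] y" 0] neg by auto
  have "isCont (\<lambda>s. y + s *\<^sub>R u) 0" by (intro continuous_intros)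
  then have "\<forall>\<^sub>F s in at 0. y + s *\<^sub>R u \<in> D"
    using topological_tendstoD[of "\<lambda>s. y + s *\<^sub>R u" y "at 0" D] open_D y by (simp add: isCont_def)
  then obtain r2 where r2: "0 < r2" "\<And>s. s \<noteq> 0 \<Longrightarrow> \<bar>s\<bar> < r2 \<Longrightarrow> y + s *\<^sub>R u \<in> D"
    by (auto simp: eventually_at dist_real_def)
  define s where "s = min r1 r2 / 2"
  have s: "0 < s" "s < r1" "s < r2" using r1(1) r2(1) by (auto simp: s_def)
  have ys: "y + s *\<^sub>R u \<in> D" using r2(2)[of s] s by simp
  have lin: "linear (\<lambda>h. G [h] x)" if "x \<in> D" for x
    using linear_nderiv[OF that, of "[]" "[]"] p by simp
  have "s * G [u] y \<le> s * G [u] (y + s *\<^sub>R u)"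
    using g_ge_tangent[OF y ys] g_ge_tangent[OF ys y] linear_scale[OF lin[OF y], of s u]
      linear_scale[OF lin[OF ys], of "- s" u]
    by (simp add: grad_g)
  then show False using r1(2)[OF s(1,2)] s(1) by simp
qed

text \<open>
  For \<open>p \<ge> 2\<close> the Hessian of the Taylor polynomial falls short of that of \<open>g\<close>, which is positive
  semidefinite, by at most \<open>L / (p - 1)! N ^ (p - 1)\<close>, and the regularizer with \<open>M = p L\<close> has
  exactly this much curvature. For \<open>p = 1\<close> the Taylor polynomial is affine.
\<close>

lemma model_ge_tangent:
  assumes x: "x \<in> D" and T: "T \<in> D" and y: "y \<in> D"
  shows "model x T + model_grad x T (y - T) \<le> model x y"
proof (cases "p = 1")
  case True
  have "linear (\<lambda>h. G ([] @ h # []) x)" using x True by (intro linear_nderiv) auto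
  then have "G [y - x] x = G [T - x] x + G [y - T] x"
    using linear_add[of "\<lambda>h. G [h] x" "T - x" "y - T"] by simp
  then have "taylor p g x y = taylor p g x T + grad (taylor p g x) T (y - T)"
    unfolding deriv_taylor_grad(2)[OF x] deriv_taylor_def by (simp add: True taylor_def)
  moreover have "0 \<le> M / fact p * bregman (prox_fn B p x) T y"
    using L_pos by (intro mult_nonneg_nonneg bregman_prox_fn_nonneg p_pos) auto
  ultimately show ?thesis
    unfolding model_eq model_grad_eq by (simp add: bregman_def algebra_simps)
next
  case False
  then have p: "2 \<le> p" using p_pos by simp
  define u where "u = y - T"
  define \<theta> where "\<theta> \<tau> = model x (T + \<tau> *\<^sub>R u)" for \<tau>
  define \<theta>' where "\<theta>' \<tau> = deriv_taylor [u] x (T + \<tau> *\<^sub>R u)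
    + M / fact p * (N (T - x + \<tau> *\<^sub>R u) ^ (p - 1) * B (T - x + \<tau> *\<^sub>R u) u)" for \<tau>
  have line: "T + \<tau> *\<^sub>R u - x = T - x + \<tau> *\<^sub>R u" for \<tau> by simp
  have \<theta>: "(\<theta> has_real_derivative \<theta>' \<tau>) (at \<tau>)" for \<tau>
    using has_real_derivative_line[OF model_has_derivative[OF x], where x = T and \<tau> = \<tau> and u = u]
    by (simp add: \<theta>_def[abs_def] \<theta>'_def model_grad_def deriv_taylor_grad(2)[OF x] line mult.assoc)
  have mono: "\<theta>' 0 \<le> \<theta>' \<tau>" if \<tau>: "0 \<le> \<tau>" "\<tau> \<le> 1" for \<tau>
  proof (rule DERIV_nonneg_imp_nondecreasing[where f = \<theta>', OF \<tau>(1)])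
    fix s assume s: "0 \<le> s" "s \<le> \<tau>"
    let ?y = "T + s *\<^sub>R u"
    have yD: "?y \<in> D"
      unfolding u_def using s \<tau> by (intro convex_line_in convex_D T y) auto
    obtain d where d: "((\<lambda>s. N (T - x + s *\<^sub>R u) ^ (p - 1) * B (T - x + s *\<^sub>R u) u) has_real_derivative d) (at s)"
      "N (T - x + s *\<^sub>R u) ^ (p - 1) * (N u)\<^sup>2 \<le> d"
      using N_power_second_derivative[OF p] by blast
    have "(\<theta>' has_real_derivative deriv_taylor [u, u] x ?y + M / fact p * d) (at s)"
      unfolding \<theta>'_def[abs_def]
      by (intro DERIV_add DERIV_cmult d(1) has_real_derivative_line deriv_taylor_has_derivative x)
        (use p in auto)
    moreover have "0 \<le> deriv_taylor [u, u] x ?y + M / fact p * d"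
    proof -
      have "\<bar>G [u, u] ?y - deriv_taylor [u, u] x ?y\<bar>
          \<le> L * N (?y - x) ^ (p + 1 - 2) * prod_list (map N [u, u]) / fact (p + 1 - 2)"
        using taylor_remainder[OF x yD, of "[u, u]"] p by simp
      also have "\<dots> = M / fact p * (N (T - x + s *\<^sub>R u) ^ (p - 1) * (N u)\<^sup>2)"
      proof -
        obtain m where "p = Suc m" using p by (cases p) auto
        then show ?thesis by (simp add: line power2_eq_square divide_simps del: of_nat_Suc)
      qed
      also have "\<dots> \<le> M / fact p * d"
        using L_pos by (intro mult_left_mono d(2)) auto
      finally show ?thesis
        using convex_second_derivative_nonneg[OF p yD, of u] by linarith
    qed
    ultimately show "\<exists>z. (\<theta>' has_real_derivative z) (at s) \<and> 0 \<le> z" by blast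
  qed
  have "\<theta> 0 - 0 * \<theta>' 0 \<le> \<theta> 1 - 1 * \<theta>' 0"
  proof (rule DERIV_nonneg_imp_nondecreasing[where f = "\<lambda>\<tau>. \<theta> \<tau> - \<tau> * \<theta>' 0"])
    fix s :: real assume s: "0 \<le> s" "s \<le> 1"
    have "((\<lambda>\<tau>. \<theta> \<tau> - \<tau> * \<theta>' 0) has_real_derivative \<theta>' s - \<theta>' 0) (at s)"
      by (auto intro!: derivative_eq_intros \<theta>)
    then show "\<exists>z. ((\<lambda>\<tau>. \<theta> \<tau> - \<tau> * \<theta>' 0) has_real_derivative z) (at s) \<and> 0 \<le> z"
      using mono[OF s] by (intro exI[of _ "\<theta>' s - \<theta>' 0"]) auto
  qed simp
  then show ?thesis
    by (simp add: \<theta>_def \<theta>'_def u_def model_grad_def deriv_taylor_grad(2)[OF x] mult.assoc)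
qed

lemma taylor_error:
  assumes "x \<in> D" "y \<in> D"
  shows "\<bar>g y - taylor p g x y\<bar> \<le> L / fact (p + 1) * N (y - x) ^ (p + 1)"
  using taylor_remainder[OF assms, of "[]"] by (simp add: taylor_eq_deriv_taylor del: fact_Suc)

lemma model_ge:
  assumes "x \<in> D" "y \<in> D"
  shows "g y + (M - L) / fact (p + 1) * N (y - x) ^ (p + 1) \<le> model x y"
  using taylor_error[OF assms] unfolding model_def by (simp add: algebra_simps diff_divide_distrib del: fact_Suc)

text \<open>
  For \<open>p = 1\<close> the Taylor polynomial is a tangent and lies below \<open>g\<close>, so only the regularizer contributes;
  this saves a factor \<open>2\<close> in the rate. With the constant \<open>L / p!\<close> the rate would be \<open>2\<close>, which is below
  \<open>exp 1\<close> and too slow for the claimed complexity.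
\<close>

lemma model_le:
  assumes xy: "x \<in> D" "y \<in> D"
  shows "model x y \<le> g y + (if p = 1 then L / 2 else L / fact p) * N (y - x) ^ (p + 1)"
proof (cases "p = 1")
  case True
  have "taylor p g x y \<le> g y"
    using g_ge_tangent[OF xy] by (simp add: True taylor_def grad_g)
  then show ?thesis unfolding model_def by (simp add: True)
next
  case False
  have "model x y \<le> g y + (L / fact (p + 1) + M / fact (p + 1)) * N (y - x) ^ (p + 1)"
    using taylor_error[OF xy] unfolding model_def by (simp add: algebra_simps del: fact_Suc)
  also have "L / fact (p + 1) + M / fact (p + 1) = L / fact p"
    by (simp add: divide_simps add_eq_0_iff_both_eq_0) (simp add: algebra_simps)
  finally show ?thesis using False by simp
qed

text \<open>The gradient error of the Taylor polynomial contributes \<open>L\<close>, the regularizer \<open>M = p L\<close>.\<close>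

lemma dual_nrm_step_subgrad_le:
  assumes xT: "x \<in> D" "T \<in> D"
  shows "dual_nrm B (step_subgrad B p M g x T) \<le> (real p + 1) * (L / fact p) * N (T - x) ^ p"
proof (rule dual_nrm_leI)
  fix u assume u: "N u \<le> 1"
  have "grad g T u - grad (taylor p g x) T u \<le> L / fact p * N (T - x) ^ p * N u"
    using taylor_remainder[OF xT, of "[u]"] p_pos by (simp add: grad_g deriv_taylor_grad(2)[OF xT(1)])
  moreover have "- (M / fact p * N (T - x) ^ (p - 1) * B (T - x) u) \<le> M / fact p * N (T - x) ^ p * N u"
  proof -
    have "- B (T - x) u \<le> N (T - x) * N u" using Cauchy_Schwarz_N[of "T - x" u] by simp
    then have "M / fact p * N (T - x) ^ (p - 1) * - B (T - x) u
        \<le> M / fact p * N (T - x) ^ (p - 1) * (N (T - x) * N u)"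
      using L_pos by (intro mult_left_mono) auto
    also have "\<dots> = M / fact p * N (T - x) ^ p * N u"
      using p_pos by (cases p) auto
    finally show ?thesis by simp
  qed
  ultimately have "step_subgrad B p M g x T u \<le> (real p + 1) * (L / fact p) * N (T - x) ^ p * N u"
    by (simp add: step_subgrad_def algebra_simps add_divide_distrib)
  also have "\<dots> \<le> (real p + 1) * (L / fact p) * N (T - x) ^ p"
    using mult_left_mono[OF u, of "(real p + 1) * (L / fact p) * N (T - x) ^ p"] L_pos by simp
  finally show "step_subgrad B p M g x T u \<le> (real p + 1) * (L / fact p) * N (T - x) ^ p" .
qed

end

section \<open>One tensor step\<close>

text \<open>
  A step divides \<open>N (x - w) ^ (p + 1)\<close> by at least this number, where \<open>w\<close> is the minimizer. The value for
  \<open>p = 1\<close> reflects the better constant in \<open>model_le\<close>; like \<open>p + 1\<close> for \<open>p \<ge> 2\<close>, it exceeds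
  \<open>exp 1\<close>, so that the part \<open>ln (K ^ p)\<close> of the number of steps has a coefficient of at most \<open>(p + 1) / p\<close>.
\<close>

definition step_rate :: "nat \<Rightarrow> real" where
  "step_rate p = (if p = 1 then 4 else real p + 1)"

locale composite_model = tensor_model B p g D L
  for B :: "'a::euclidean_space \<Rightarrow> 'a \<Rightarrow> real" and p and g :: "'a \<Rightarrow> real" and D L +
  fixes E :: "'a set" and \<psi> :: "'a \<Rightarrow> real" and a \<gamma> :: real and x0 v :: 'a
  assumes convex_psi: "convex_on E \<psi>" and E_subset: "E \<subseteq> D"
    and a_pos: "0 < a" and gamma_pos: "0 < \<gamma>"
begin

lemma in_D: "y \<in> E \<Longrightarrow> y \<in> D"
  using E_subset by blast

abbreviation d where "d \<equiv> prox_fn B p x0"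

definition \<Phi> :: "'a \<Rightarrow> real" where "\<Phi> y = a * \<psi> y + \<gamma> * bregman d v y"

definition h :: "'a \<Rightarrow> real" where "h y = g y + \<Phi> y"

text \<open>
  The first-order condition for \<open>Q + \<gamma> \<beta>(v; \<cdot>) + a \<psi>\<close> at \<open>T\<close>, in which the three-point identity turns the
  gradient of \<open>\<beta>(v; \<cdot>)\<close> into the surplus \<open>\<gamma> \<beta>(T; y)\<close>.
\<close>

lemma optimality:
  assumes T: "T \<in> E" "y \<in> E" and der: "(Q has_derivative Q') (at T)"
    and min: "\<And>y. y \<in> E \<Longrightarrow> Q T + \<Phi> T \<le> Q y + \<Phi> y"
  shows "\<Phi> T + \<gamma> * bregman d T y \<le> \<Phi> y + Q' (y - T)"
proof -
  have "((\<lambda>y. Q y + \<gamma> * bregman d v y) has_derivative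
      (\<lambda>u. Q' u + \<gamma> * (grad d T u - grad d v u))) (at T)"
    by (intro has_derivative_add der has_derivative_mult_right bregman_prox_fn_has_derivative p_pos)
  from composite_first_order_optimality[OF convex_psi T less_imp_le[OF a_pos] _ this] min
  have "0 \<le> Q' (y - T) + \<gamma> * (grad d T (y - T) - grad d v (y - T)) + a * \<psi> y - a * \<psi> T"
    by (simp add: \<Phi>_def algebra_simps)
  moreover have "\<gamma> * bregman d v y = \<gamma> * bregman d v T + \<gamma> * bregman d T y
      + \<gamma> * (grad d T (y - T) - grad d v (y - T))"
    by (simp add: bregman_three_point[OF p_pos, of x0 v y T] distrib_left)
  ultimately show ?thesis unfolding \<Phi>_def by linarith
qed

lemma h_strong_minimum:
  assumes w: "w \<in> E" "\<And>y. y \<in> E \<Longrightarrow> h w \<le> h y" and y: "y \<in> E"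
  shows "h w + \<gamma> * bregman d w y \<le> h y"
proof -
  have "\<Phi> w + \<gamma> * bregman d w y \<le> \<Phi> y + grad g w (y - w)"
    by (rule optimality[OF w(1) y grad_g_has_derivative[OF in_D[OF w(1)]]])
      (use w(2) in \<open>simp add: h_def\<close>)
  then show ?thesis
    using g_ge_tangent[OF in_D[OF w(1)] in_D[OF y]] by (simp add: h_def)
qed

lemma model_optimality:
  assumes x: "x \<in> D" and T: "T \<in> E" "\<And>y. y \<in> E \<Longrightarrow> model x T + \<Phi> T \<le> model x y + \<Phi> y"
    and y: "y \<in> E"
  shows "\<Phi> T + \<gamma> * bregman d T y \<le> \<Phi> y + model_grad x T (y - T)"
  by (rule optimality[OF T(1) y model_has_derivative[OF x] T(2)])

lemma model_strong_minimum:
  assumes x: "x \<in> D" and T: "T \<in> E" "\<And>y. y \<in> E \<Longrightarrow> model x T + \<Phi> T \<le> model x y + \<Phi> y"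
    and y: "y \<in> E"
  shows "model x T + \<Phi> T + \<gamma> * bregman d T y \<le> model x y + \<Phi> y"
  using model_optimality[OF assms] model_ge_tangent[OF x in_D[OF T(1)] in_D[OF y]] by linarith

lemma step_subgradient:
  assumes x: "x \<in> D" and T: "T \<in> E" "\<And>y. y \<in> E \<Longrightarrow> model x T + \<Phi> T \<le> model x y + \<Phi> y"
    and y: "y \<in> E"
  shows "h T + step_subgrad B p M g x T (y - T) + \<gamma> * bregman d T y \<le> h y"
  using model_optimality[OF assms] g_ge_tangent[OF in_D[OF T(1)] in_D[OF y]]
  by (simp add: h_def step_subgrad_eq)

lemma linear_step_subgrad:
  assumes "x \<in> D" "T \<in> E"
  shows "linear (step_subgrad B p M g x T)"
proof -
  have "(\<lambda>u. grad g T u - model_grad x T u) = step_subgrad B p M g x T"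
    by (simp add: step_subgrad_eq fun_eq_iff)
  moreover have "linear (\<lambda>u. grad g T u - model_grad x T u)"
    using assms E_subset
    by (intro linear_compose_sub has_derivative_linear[OF grad_g_has_derivative]
        has_derivative_linear[OF model_has_derivative]) auto
  ultimately show ?thesis by simp
qed

text \<open>
  As \<open>T\<close> is a strong minimizer of the model and \<open>w\<close> one of \<open>h\<close>, comparison of the model with \<open>g\<close> at both
  points gives \<open>(M - L) / (p + 1)! |T - x|^(p+1) + \<gamma> (\<beta>(T; w) + \<beta>(w; T)) \<le> C |x - w|^(p+1)\<close>. Both Bregman
  distances are kept because the symmetric bound for their sum has \<open>p + 1\<close> times the constant for one of
  them. The first summand bounds the length of the step; it vanishes for \<open>p = 1\<close>, where the
  triangle inequality serves instead.
\<close>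

lemma step_contraction:
  assumes x: "x \<in> D" and T: "T \<in> E" "\<And>y. y \<in> E \<Longrightarrow> model x T + \<Phi> T \<le> model x y + \<Phi> y"
    and w: "w \<in> E" "\<And>y. y \<in> E \<Longrightarrow> h w \<le> h y"
    and cond: "(real p + 1) * (L / fact p) \<le> \<gamma> * (1 / 2) ^ (p - 1)"
  shows "step_rate p * N (T - w) ^ (p + 1) \<le> N (x - w) ^ (p + 1)"
    and "N (T - x) ^ (p + 1) \<le> step_rate p * N (x - w) ^ (p + 1)"
proof -
  define \<sigma> where "\<sigma> = \<gamma> * (1 / 2) ^ (p - 1)"
  define \<rho> where "\<rho> = N (x - w) ^ (p + 1)"
  define C where "C = (if p = 1 then L / 2 else L / fact p)"
  have TD: "T \<in> D" and wD: "w \<in> D" using T(1) w(1) E_subset by auto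
  have \<sigma>: "(real p + 1) * (L / fact p) \<le> \<sigma>" "0 < \<sigma>" using cond gamma_pos by (auto simp: \<sigma>_def)
  have "g T + (M - L) / fact (p + 1) * N (T - x) ^ (p + 1) + \<Phi> T + \<gamma> * bregman d T w
      \<le> model x T + \<Phi> T + \<gamma> * bregman d T w"
    using model_ge[OF x TD] by simp
  also have "\<dots> \<le> model x w + \<Phi> w" by (rule model_strong_minimum[OF x T w(1)])
  also have "\<dots> \<le> g w + C * \<rho> + \<Phi> w"
    using model_le[OF x wD] by (simp add: C_def \<rho>_def N_minus_commute)
  finally have *: "(M - L) / fact (p + 1) * N (T - x) ^ (p + 1)
      + \<gamma> * (bregman d T w + bregman d w T) \<le> C * \<rho>"
    using h_strong_minimum[OF w T(1)] by (simp add: h_def distrib_left)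
  have "bregman d T w + bregman d w T = grad d T (T - w) - grad d w (T - w)"
    using linear_neg[OF linear_grad_prox_fn[OF p_pos], of x0 T "T - w"] by (simp add: bregman_def)
  then have "\<sigma> * N (T - w) ^ (p + 1) \<le> \<gamma> * (bregman d T w + bregman d w T)"
    using mult_left_mono[OF prox_fn_monotone[OF p_pos, of T w x0], of \<gamma>] gamma_pos
    by (simp add: \<sigma>_def mult.assoc)
  with * have **: "(M - L) / fact (p + 1) * N (T - x) ^ (p + 1) + \<sigma> * N (T - w) ^ (p + 1) \<le> C * \<rho>"
    by linarith
  have \<rho>0: "0 \<le> \<rho>" by (simp add: \<rho>_def)
  have "step_rate p * N (T - w) ^ (p + 1) \<le> \<rho> \<and> N (T - x) ^ (p + 1) \<le> step_rate p * \<rho>"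
  proof (cases "p = 1")
    case True
    have "\<sigma> * N (T - w) ^ 2 \<le> L / 2 * \<rho>" using ** True by (simp add: C_def numeral_2_eq_2)
    also have "\<dots> \<le> \<sigma> / 4 * \<rho>" using \<sigma>(1) True \<rho>0 by (intro mult_right_mono) auto
    finally have "\<sigma> * (4 * (N (T - w))\<^sup>2) \<le> \<sigma> * \<rho>" by simp
    then have A: "4 * (N (T - w))\<^sup>2 \<le> \<rho>" using \<sigma>(2) by simp
    then have "(2 * N (T - w))\<^sup>2 \<le> (N (x - w))\<^sup>2" by (simp add: \<rho>_def True power2_eq_square)
    then have "2 * N (T - w) \<le> N (x - w)" by (rule power2_le_imp_le) simp
    then have "N (T - w) \<le> N (x - w)" using N_nonneg[of "T - w"] by linarith
    then have "N (T - x) \<le> 2 * N (x - w)"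
      using N_triangle_diff[of T x w] N_minus_commute[of w x] by simp
    from power_mono[OF this, of 2] have "(N (T - x))\<^sup>2 \<le> 4 * \<rho>"
      by (simp add: \<rho>_def True power2_eq_square)
    with A show ?thesis by (simp add: step_rate_def True power2_eq_square)
  next
    case False
    then have p: "2 \<le> p" using p_pos by simp
    have coef: "(M - L) / fact (p + 1) = (real p - 1) / (real p + 1) * (L / fact p)"
      by (simp add: divide_simps add_eq_0_iff_both_eq_0) (simp add: algebra_simps)
    have Lf: "0 < L / fact p" using L_pos by simp
    have "0 \<le> (real p - 1) / (real p + 1) * (L / fact p) * N (T - x) ^ (p + 1)"
      using p L_pos by (intro mult_nonneg_nonneg divide_nonneg_nonneg) auto
    then have "\<sigma> * N (T - w) ^ (p + 1) \<le> L / fact p * \<rho>"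
      using ** False unfolding coef by (simp add: C_def)
    moreover have "(real p + 1) * (L / fact p * N (T - w) ^ (p + 1)) \<le> \<sigma> * N (T - w) ^ (p + 1)"
      using mult_right_mono[OF \<sigma>(1), of "N (T - w) ^ (p + 1)"] by (simp add: mult.assoc)
    ultimately have "L / fact p * ((real p + 1) * N (T - w) ^ (p + 1)) \<le> L / fact p * \<rho>"
      by (simp add: mult.left_commute)
    then have A: "(real p + 1) * N (T - w) ^ (p + 1) \<le> \<rho>"
      using mult_le_cancel_left_pos[OF Lf] by blast
    have "0 \<le> \<sigma> * N (T - w) ^ (p + 1)" using \<sigma>(2) by simp
    then have "L / fact p * ((real p - 1) / (real p + 1) * N (T - x) ^ (p + 1)) \<le> L / fact p * \<rho>"
      using ** False unfolding coef by (simp add: C_def mult_ac)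
    then have "(real p - 1) / (real p + 1) * N (T - x) ^ (p + 1) \<le> \<rho>"
      using mult_le_cancel_left_pos[OF Lf] by blast
    then have "(real p - 1) * N (T - x) ^ (p + 1) \<le> (real p + 1) * \<rho>"
      using p by (simp add: field_simps)
    moreover have "1 * N (T - x) ^ (p + 1) \<le> (real p - 1) * N (T - x) ^ (p + 1)"
      using p by (intro mult_right_mono) auto
    ultimately have "N (T - x) ^ (p + 1) \<le> (real p + 1) * \<rho>" by linarith
    with A show ?thesis using False by (simp add: step_rate_def)
  qed
  then show "step_rate p * N (T - w) ^ (p + 1) \<le> N (x - w) ^ (p + 1)"
    and "N (T - x) ^ (p + 1) \<le> step_rate p * N (x - w) ^ (p + 1)"
    by (auto simp: \<rho>_def)
qed

end

section \<open>Existence of minimizers\<close>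

lemma arg_min_ereal:
  fixes H :: "'a \<Rightarrow> ereal" and h :: "'a \<Rightarrow> real"
  assumes "\<And>y. y \<in> E \<Longrightarrow> H y = ereal (h y)" "\<And>y. y \<notin> E \<Longrightarrow> H y = \<infinity>"
    and "w \<in> E" "\<And>y. y \<in> E \<Longrightarrow> h w \<le> h y"
  shows "arg_min H (\<lambda>_. True) \<in> E" "\<And>y. y \<in> E \<Longrightarrow> h (arg_min H (\<lambda>_. True)) \<le> h y"
proof -
  define T where "T = arg_min H (\<lambda>_. True)"
  have "H w \<le> H y" for y using assms by (cases "y \<in> E") auto
  then have "is_arg_min H (\<lambda>_. True) w" by (simp add: is_arg_min_def not_less)
  then have "is_arg_min H (\<lambda>_. True) T" unfolding T_def arg_min_def by (rule someI)
  then have T: "H T \<le> H y" for y by (simp add: is_arg_min_def not_less)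
  have "T \<in> E" using T[of w] assms by (cases "T \<in> E") auto
  moreover have "h T \<le> h y" if "y \<in> E" for y using T[of y] assms that \<open>T \<in> E\<close> by simp
  ultimately show "arg_min H (\<lambda>_. True) \<in> E" "\<And>y. y \<in> E \<Longrightarrow> h (arg_min H (\<lambda>_. True)) \<le> h y"
    by (simp_all add: T_def)
qed

lemma quadratic_growth_bounded:
  fixes b C k c s :: real
  assumes k: "0 < k" and s: "0 \<le> s" and le: "b - C * s + k * s\<^sup>2 \<le> c"
  shows "s \<le> (\<bar>C\<bar> + \<bar>c - b\<bar>) / k + 1"
proof (rule ccontr)
  assume "\<not> ?thesis"
  then have s1: "(\<bar>C\<bar> + \<bar>c - b\<bar>) / k + 1 < s" by simp
  have "0 \<le> (\<bar>C\<bar> + \<bar>c - b\<bar>) / k" using k by simp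
  then have "1 < s" using s1 by linarith
  have "(\<bar>C\<bar> + \<bar>c - b\<bar>) + k < k * s" using s1 k by (simp add: field_simps)
  then have "((\<bar>C\<bar> + \<bar>c - b\<bar>) + k) * s < k * s * s" using \<open>1 < s\<close> by (intro mult_strict_right_mono) auto
  moreover have "C * s \<le> \<bar>C\<bar> * s" using s by (intro mult_right_mono) auto
  moreover have "\<bar>c - b\<bar> * 1 \<le> \<bar>c - b\<bar> * s" using \<open>1 < s\<close> by (intro mult_left_mono) auto
  moreover have "0 < k * s" using k \<open>1 < s\<close> by simp
  ultimately show False using le by (simp add: power2_eq_square algebra_simps)
qed

text \<open>Moving the base point of an affine minorant from \<open>x\<close> to \<open>v\<close> changes only its constant.\<close>

lemma (in pos_def_norm) tangent_minorant:
  assumes l: "linear l" and ge: "\<And>y. y \<in> E \<Longrightarrow> c + l (y - x) \<le> Q y"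
  shows "\<exists>b C. \<forall>y\<in>E. b - C * N (y - v) \<le> Q y"
proof -
  obtain C where C: "0 \<le> C" "\<And>h. \<bar>l h\<bar> \<le> C * N h" using bounded_linear_le_N[OF l] by blast
  have "c - C * N (v - x) - C * N (y - v) \<le> Q y" if y: "y \<in> E" for y
  proof -
    have "\<bar>l (y - x)\<bar> \<le> C * (N (y - v) + N (v - x))"
      using C(2)[of "y - x"] mult_left_mono[OF N_triangle_diff[of y x v] C(1)] by linarith
    then show ?thesis using ge[OF y] by (simp add: distrib_left)
  qed
  then show ?thesis by blast
qed

locale closed_composite_model = composite_model B p g D L E \<psi> a \<gamma> x0 v
  for B :: "'a::euclidean_space \<Rightarrow> 'a \<Rightarrow> real" and p and g :: "'a \<Rightarrow> real" and D L E \<psi> a \<gamma> x0 v +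
  assumes v_in: "v \<in> E"
    and psi_closed: "\<And>y y0 c c0. (\<And>n. y n \<in> E) \<Longrightarrow> (\<And>n. \<psi> (y n) \<le> c n) \<Longrightarrow>
      y \<longlonglongrightarrow> y0 \<Longrightarrow> c \<longlonglongrightarrow> c0 \<Longrightarrow> y0 \<in> E \<and> \<psi> y0 \<le> c0"
    and psi_minorant: "\<exists>b C. \<forall>y\<in>E. b - C * N (y - v) \<le> \<psi> y"
begin

text \<open>
  The domain \<open>E\<close> of \<open>\<psi>\<close> need not be closed, so a limit of a minimizing sequence is placed in \<open>E\<close> by
  the closedness of the epigraph. The Bregman term grows at least quadratically and dominates
  the minorants of the other two summands.
\<close>

lemma attains_minimum:
  assumes cont: "\<And>y. y \<in> E \<Longrightarrow> isCont Q y"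
    and minorant: "\<exists>b C. \<forall>y\<in>E. b - C * N (y - v) \<le> Q y"
  obtains w where "w \<in> E" "\<And>y. y \<in> E \<Longrightarrow> Q w + \<Phi> w \<le> Q y + \<Phi> y"
proof -
  define k where "k = \<gamma> * ((1 / 2) ^ (p - 1) / (real p + 1))"
  define P where "P y = Q y + \<gamma> * bregman d v y" for y
  define H where "H y = Q y + \<Phi> y" for y
  have H: "H y = P y + a * \<psi> y" for y by (simp add: H_def P_def \<Phi>_def)
  have k: "0 < k" using gamma_pos by (simp add: k_def)
  have contP: "isCont P y" if "y \<in> E" for y
    unfolding P_def[abs_def]
    by (intro continuous_intros cont that
        has_derivative_continuous[OF bregman_prox_fn_has_derivative[OF p_pos]])
  obtain b1 C1 where Q: "\<And>y. y \<in> E \<Longrightarrow> b1 - C1 * N (y - v) \<le> Q y" using minorant by blast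
  obtain b2 C2 where \<psi>: "\<And>y. y \<in> E \<Longrightarrow> b2 - C2 * N (y - v) \<le> \<psi> y" using psi_minorant by blast
  have P_ge: "b1 - C1 * N (y - v) \<le> P y" if "y \<in> E" for y
    using Q[OF that] bregman_prox_fn_nonneg[OF p_pos, of x0 v y] gamma_pos
    by (simp add: P_def add_increasing2)
  define b where "b = b1 + a * b2 - k"
  define C where "C = C1 + a * C2"
  have H_ge: "b - C * N (y - v) + k * (N (y - v))\<^sup>2 \<le> H y" if y: "y \<in> E" for y
  proof -
    have "(N (y - v))\<^sup>2 \<le> N (y - v) ^ (p + 1) + 1"
    proof (cases "1 \<le> N (y - v)")
      case True
      then show ?thesis using power_increasing[of 2 "p + 1" "N (y - v)"] p_pos by simp
    next
      case False
      then have "(N (y - v))\<^sup>2 \<le> 1" by (simp add: power_le_one)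
      then show ?thesis using zero_le_power[OF N_nonneg[of "y - v"], of "p + 1"] by linarith
    qed
    then have "k * (N (y - v))\<^sup>2 \<le> k * (N (y - v) ^ (p + 1) + 1)"
      using k by (intro mult_left_mono) auto
    also have "\<dots> \<le> \<gamma> * bregman d v y + k"
      using mult_left_mono[OF bregman_prox_fn_ge[OF p_pos, of v y x0], of \<gamma>] gamma_pos
      by (simp add: k_def N_minus_commute distrib_left mult.assoc)
    finally show ?thesis
      using Q[OF y] mult_left_mono[OF \<psi>[OF y], of a] a_pos
      by (simp add: H_def \<Phi>_def b_def C_def algebra_simps)
  qed
  define R where "R c = (\<bar>C\<bar> + \<bar>c - b\<bar>) / k + 1" for c
  have R: "N (y - v) \<le> R c" if "y \<in> E" "H y \<le> c" for y c
    unfolding R_def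
    by (rule quadratic_growth_bounded[OF k N_nonneg, of b C]) (use H_ge[OF that(1)] that(2) in linarith)
  have "bdd_below (H ` E)"
  proof (rule bdd_belowI2)
    fix y assume y: "y \<in> E"
    show "min (H v) (b - \<bar>C\<bar> * R (H v)) \<le> H y"
    proof (cases "H y \<le> H v")
      case True
      have "C * N (y - v) \<le> \<bar>C\<bar> * R (H v)"
        using R[OF y True] by (intro mult_mono) auto
      moreover have "0 \<le> k * (N (y - v))\<^sup>2" using k by simp
      ultimately show ?thesis using H_ge[OF y] by linarith
    qed auto
  qed
  define m where "m = (INF y\<in>E. H y)"
  have m_le: "m \<le> H y" if "y \<in> E" for y
    unfolding m_def by (rule cINF_lower[OF \<open>bdd_below (H ` E)\<close> that])
  have "\<exists>y\<in>E. H y < m + 1 / (real n + 1)" for n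
  proof (rule ccontr)
    assume "\<not> ?thesis"
    then have "m + 1 / (real n + 1) \<le> m"
      unfolding m_def using v_in by (intro cINF_greatest) (auto simp: m_def[symmetric] not_less)
    moreover have "0 < 1 / (real n + 1)" by (simp add: add_nonneg_pos)
    ultimately show False by linarith
  qed
  then obtain y where y: "\<And>n. y n \<in> E" "\<And>n. H (y n) < m + 1 / (real n + 1)" by metis
  have y1: "H (y n) \<le> m + 1" for n
  proof -
    have "1 / (real n + 1) \<le> 1" by simp
    then show ?thesis using y(2)[of n] by linarith
  qed
  obtain C0 where C0: "0 < C0" "\<And>x. norm x \<le> C0 * N x" using norm_le_N by blast
  have "y n \<in> cball v (C0 * R (m + 1))" for n
  proof -
    have "norm (y n - v) \<le> C0 * N (y n - v)" by (rule C0)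
    also have "\<dots> \<le> C0 * R (m + 1)" using R[OF y(1) y1] C0(1) by (intro mult_left_mono) auto
    finally show ?thesis by (simp add: dist_norm norm_minus_commute)
  qed
  then obtain w s where ws: "strict_mono (s :: nat \<Rightarrow> nat)" "(y \<circ> s) \<longlonglongrightarrow> w"
    using compact_imp_seq_compact[OF compact_cball, of v "C0 * R (m + 1)"]
    unfolding seq_compact_def by blast
  have "\<psi> ((y \<circ> s) n) \<le> (m + 1 - (b1 - \<bar>C1\<bar> * R (m + 1))) / a" for n
  proof -
    have "C1 * N (y (s n) - v) \<le> \<bar>C1\<bar> * R (m + 1)"
      using R[OF y(1) y1] by (intro mult_mono) auto
    then have "a * \<psi> (y (s n)) \<le> m + 1 - (b1 - \<bar>C1\<bar> * R (m + 1))"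
      using P_ge[OF y(1), of "s n"] y1[of "s n"] by (simp add: H)
    then show ?thesis using a_pos by (simp add: field_simps)
  qed
  then have w: "w \<in> E"
    using psi_closed[of "y \<circ> s" "\<lambda>_. (m + 1 - (b1 - \<bar>C1\<bar> * R (m + 1))) / a" w] y(1) ws(2) by auto
  have "(\<lambda>n. H (y n)) \<longlonglongrightarrow> m"
  proof (rule tendsto_sandwich[of "\<lambda>_. m" _ _ "\<lambda>n. m + 1 / (real n + 1)"])
    show "(\<lambda>n. m + 1 / (real n + 1)) \<longlonglongrightarrow> m"
      using tendsto_add[OF tendsto_const[of m] LIMSEQ_inverse_real_of_nat]
      by (simp add: inverse_eq_divide add.commute)
  qed (use y m_le in \<open>auto intro!: always_eventually less_imp_le\<close>)
  then have limH: "(\<lambda>n. H (y (s n))) \<longlonglongrightarrow> m"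
    using LIMSEQ_subseq_LIMSEQ[OF _ ws(1)] by (auto simp: o_def)
  moreover have limP: "(\<lambda>n. P (y (s n))) \<longlonglongrightarrow> P w"
    using isCont_tendsto_compose[OF contP[OF w]] ws(2) by (auto simp: o_def)
  ultimately have "(\<lambda>n. (H (y (s n)) - P (y (s n))) / a) \<longlonglongrightarrow> (m - P w) / a"
    using a_pos by (intro tendsto_intros) auto
  then have "\<psi> w \<le> (m - P w) / a"
    using psi_closed[of "y \<circ> s" "\<lambda>n. (H (y (s n)) - P (y (s n))) / a" w "(m - P w) / a"] y(1) ws(2) a_pos
    by (auto simp: H)
  then have "H w \<le> m" using a_pos by (simp add: H field_simps)
  then have "Q w + \<Phi> w \<le> Q y + \<Phi> y" if "y \<in> E" for y
    using m_le[OF that] by (simp add: H_def)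
  then show ?thesis using w that by blast
qed

lemma h_attains_minimum:
  obtains w where "w \<in> E" "\<And>y. y \<in> E \<Longrightarrow> h w \<le> h y"
proof -
  obtain w where "w \<in> E" "\<And>y. y \<in> E \<Longrightarrow> g w + \<Phi> w \<le> g y + \<Phi> y"
  proof (rule attains_minimum[of g])
    show "isCont g y" if "y \<in> E" for y
      by (rule has_derivative_continuous[OF grad_g_has_derivative[OF in_D[OF that]]])
    show "\<exists>b C. \<forall>y\<in>E. b - C * N (y - v) \<le> g y"
      by (rule tangent_minorant[OF has_derivative_linear[OF grad_g_has_derivative[OF in_D[OF v_in]]]])
        (rule g_ge_tangent[OF in_D[OF v_in] in_D])
  qed blast
  then show ?thesis using that by (simp add: h_def)
qed

lemma model_attains_minimum:
  assumes x: "x \<in> E"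
  obtains T where "T \<in> E" "\<And>y. y \<in> E \<Longrightarrow> model x T + \<Phi> T \<le> model x y + \<Phi> y"
proof (rule attains_minimum[of "model x"])
  note xD = in_D[OF x]
  show "isCont (model x) y" for y
    by (rule has_derivative_continuous[OF model_has_derivative[OF xD]])
  show "\<exists>b C. \<forall>y\<in>E. b - C * N (y - v) \<le> model x y"
    by (rule tangent_minorant[OF has_derivative_linear[OF model_has_derivative[OF xD]]])
      (rule model_ge_tangent[OF xD xD in_D])
qed (rule that)

lemma tensor_step_minimizes:
  assumes x: "x \<in> E"
    and \<phi>: "\<And>y. y \<in> E \<Longrightarrow> \<phi> y = ereal (\<Phi> y)" "\<And>y. y \<notin> E \<Longrightarrow> \<phi> y = \<infinity>"
  shows "tensor_step B p M g \<phi> x \<in> E"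
    and "\<And>y. y \<in> E \<Longrightarrow> model x (tensor_step B p M g \<phi> x) + \<Phi> (tensor_step B p M g \<phi> x)
      \<le> model x y + \<Phi> y"
proof -
  obtain T where T: "T \<in> E" "\<And>y. y \<in> E \<Longrightarrow> model x T + \<Phi> T \<le> model x y + \<Phi> y"
    using model_attains_minimum[OF x] by blast
  have step: "tensor_step B p M g \<phi> x = arg_min (\<lambda>y. ereal (model x y) + \<phi> y) (\<lambda>_. True)"
    by (simp only: tensor_step_def model_def)
  show "tensor_step B p M g \<phi> x \<in> E"
    unfolding step by (rule arg_min_ereal(1)[where h = "\<lambda>y. model x y + \<Phi> y" and w = T]) (simp_all add: \<phi> T)
  show "model x (tensor_step B p M g \<phi> x) + \<Phi> (tensor_step B p M g \<phi> x) \<le> model x y + \<Phi> y"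
    if "y \<in> E" for y
    unfolding step
    by (rule arg_min_ereal(2)[where h = "\<lambda>y. model x y + \<Phi> y" and w = T and E = E]) (simp_all add: \<phi> T that)
qed

text \<open>
  The distance to \<open>w\<close> contracts, and the residual of the stopping test is bounded by the length of
  the step, which the second estimate of one step bounds by the distance of its starting point to \<open>w\<close>.
\<close>

lemma tensor_steps_residual:
  assumes z0: "z 0 = v"
    and z: "\<And>i. z (Suc i) \<in> E"
      "\<And>i y. y \<in> E \<Longrightarrow> model (z i) (z (Suc i)) + \<Phi> (z (Suc i)) \<le> model (z i) y + \<Phi> y"
    and w: "w \<in> E" "\<And>y. y \<in> E \<Longrightarrow> h w \<le> h y"
    and cond: "(real p + 1) * (L / fact p) \<le> \<gamma> * (1 / 2) ^ (p - 1)"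
  shows "dual_nrm B (step_subgrad B p M g (z i) (z (Suc i))) \<le> \<gamma> * (1 / 2) ^ (p - 1) * N (z (Suc i) - z i) ^ p"
    and "step_rate p ^ i * N (z (Suc i) - z i) ^ (p + 1) \<le> step_rate p * N (v - w) ^ (p + 1)"
proof -
  have zE: "z i \<in> E" for i using z0 z(1) v_in by (cases i) auto
  have q: "0 < step_rate p" by (simp add: step_rate_def)
  have contract: "step_rate p ^ i * N (z i - w) ^ (p + 1) \<le> N (v - w) ^ (p + 1)" for i
  proof (induction i)
    case (Suc i)
    have "step_rate p ^ Suc i * N (z (Suc i) - w) ^ (p + 1)
        = step_rate p ^ i * (step_rate p * N (z (Suc i) - w) ^ (p + 1))" by simp
    also have "\<dots> \<le> step_rate p ^ i * N (z i - w) ^ (p + 1)"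
      using q by (intro mult_left_mono step_contraction(1)[OF in_D[OF zE] z w cond]) auto
    finally show ?case using Suc.IH by linarith
  qed (simp add: z0)
  have "dual_nrm B (step_subgrad B p M g (z i) (z (Suc i))) \<le> (real p + 1) * (L / fact p) * N (z (Suc i) - z i) ^ p"
    by (rule dual_nrm_step_subgrad_le[OF in_D[OF zE] in_D[OF z(1)]])
  also have "\<dots> \<le> \<gamma> * (1 / 2) ^ (p - 1) * N (z (Suc i) - z i) ^ p"
    using cond by (intro mult_right_mono) auto
  finally show "dual_nrm B (step_subgrad B p M g (z i) (z (Suc i))) \<le> \<gamma> * (1 / 2) ^ (p - 1) * N (z (Suc i) - z i) ^ p" .
  have "step_rate p ^ i * N (z (Suc i) - z i) ^ (p + 1) \<le> step_rate p ^ i * (step_rate p * N (z i - w) ^ (p + 1))"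
    using q by (intro mult_left_mono step_contraction(2)[OF in_D[OF zE] z w cond]) auto
  also have "\<dots> = step_rate p * (step_rate p ^ i * N (z i - w) ^ (p + 1))" by simp
  also have "\<dots> \<le> step_rate p * N (v - w) ^ (p + 1)"
    using q by (intro mult_left_mono contract) auto
  finally show "step_rate p ^ i * N (z (Suc i) - z i) ^ (p + 1) \<le> step_rate p * N (v - w) ^ (p + 1)" .
qed

end

section \<open>Closed convex functions with extended values\<close>

context
  fixes \<psi> :: "'a::euclidean_space \<Rightarrow> ereal"
  assumes pcc: "proper_closed_convex \<psi>"
begin

lemma edom_real: "y \<in> edom \<psi> \<Longrightarrow> \<psi> y = ereal (real_of_ereal (\<psi> y))"
  using pcc by (cases "\<psi> y") (auto simp: proper_closed_convex_def edom_def)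

lemma not_edom: "y \<notin> edom \<psi> \<Longrightarrow> \<psi> y = \<infinity>"
  by (simp add: edom_def)

lemma convex_on_edom: "convex_on (edom \<psi>) (\<lambda>y. real_of_ereal (\<psi> y))"
proof -
  have epi: "convex {(x, r::real). \<psi> x \<le> ereal r}"
    using pcc by (simp add: proper_closed_convex_def)
  have le: "\<psi> (u *\<^sub>R x + v *\<^sub>R y) \<le> ereal (u * real_of_ereal (\<psi> x) + v * real_of_ereal (\<psi> y))"
    if "x \<in> edom \<psi>" "y \<in> edom \<psi>" "0 \<le> u" "0 \<le> v" "u + v = 1" for x y u v
  proof -
    have "(x, real_of_ereal (\<psi> x)) \<in> {(x, r::real). \<psi> x \<le> ereal r}"
      "(y, real_of_ereal (\<psi> y)) \<in> {(x, r::real). \<psi> x \<le> ereal r}"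
      using edom_real that(1,2) by auto
    from convexD[OF epi this that(3-5)] show ?thesis by simp
  qed
  have "convex (edom \<psi>)"
    using le unfolding convex_def edom_def by (fastforce intro: le_less_trans)
  moreover have "real_of_ereal (\<psi> (u *\<^sub>R x + v *\<^sub>R y)) \<le> u * real_of_ereal (\<psi> x) + v * real_of_ereal (\<psi> y)"
    if "x \<in> edom \<psi>" "y \<in> edom \<psi>" "0 \<le> u" "0 \<le> v" "u + v = 1" for x y u v
    using le[OF that] edom_real[OF convexD[OF \<open>convex (edom \<psi>)\<close> that]] by (metis ereal_less_eq(3))
  ultimately show ?thesis by (simp add: convex_on_def)
qed

text \<open>Closedness of the epigraph, in a form that also places the limit in the effective domain.\<close>

lemma edom_closed:
  assumes "\<And>n. y n \<in> edom \<psi>" "\<And>n. real_of_ereal (\<psi> (y n)) \<le> c n" "y \<longlonglongrightarrow> y0" "c \<longlonglongrightarrow> c0"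
  shows "y0 \<in> edom \<psi> \<and> real_of_ereal (\<psi> y0) \<le> c0"
proof -
  have "closed {(x, r::real). \<psi> x \<le> ereal r}"
    using pcc by (simp add: proper_closed_convex_def)
  moreover have "(y n, c n) \<in> {(x, r::real). \<psi> x \<le> ereal r}" for n
    using assms(1,2) edom_real by (metis case_prodI ereal_less_eq(3) mem_Collect_eq)
  moreover have "(\<lambda>n. (y n, c n)) \<longlonglongrightarrow> (y0, c0)" by (intro tendsto_Pair assms)
  ultimately have "(y0, c0) \<in> {(x, r::real). \<psi> x \<le> ereal r}"
    by (rule closed_sequentially)
  then have le: "\<psi> y0 \<le> ereal c0" by simp
  then have "y0 \<in> edom \<psi>" by (auto simp: edom_def intro: le_less_trans)
  then show ?thesis using le edom_real by (metis ereal_less_eq(3))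
qed

end

section \<open>Composition with a homothety\<close>

text \<open>
  Differentiability is proved along with the formula, since the next derivative is taken of the function
  that the formula describes near \<open>y\<close>.
\<close>

lemma (in smooth_function) affine_composition:
  fixes c \<alpha> :: real and b :: 'a
  defines "D' \<equiv> {y. \<alpha> *\<^sub>R y + b \<in> D}"
  shows "smooth_function p (\<lambda>y. c * g (\<alpha> *\<^sub>R y + b)) D'"
    and "\<And>y hs. y \<in> D' \<Longrightarrow> length hs \<le> p \<Longrightarrow>
      nderiv (\<lambda>y. c * g (\<alpha> *\<^sub>R y + b)) hs y = c * \<alpha> ^ length hs * nderiv g hs (\<alpha> *\<^sub>R y + b)"
proof -
  let ?g = "\<lambda>y. c * g (\<alpha> *\<^sub>R y + b)"
  have open_D': "open D'"
  proof -
    have "open ((\<lambda>y. \<alpha> *\<^sub>R y + b) -` D)"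
      by (intro open_vimage open_D continuous_intros)
    then show ?thesis by (simp add: D'_def vimage_def)
  qed
  have der: "((\<lambda>y. c * \<alpha> ^ length hs * nderiv g hs (\<alpha> *\<^sub>R y + b)) has_derivative
      (\<lambda>h. c * \<alpha> ^ length (h # hs) * nderiv g (h # hs) (\<alpha> *\<^sub>R y + b))) (at y)"
    if y: "y \<in> D'" and l: "length hs < p" for y hs
  proof -
    have yD: "\<alpha> *\<^sub>R y + b \<in> D" using y by (simp add: D'_def)
    have "((\<lambda>y. \<alpha> *\<^sub>R y + b) has_derivative (\<lambda>h. \<alpha> *\<^sub>R h)) (at y)"
      by (auto intro!: derivative_eq_intros)
    from has_derivative_compose[OF this nderiv_has_derivative[OF yD l]]
    have "((\<lambda>y. nderiv g hs (\<alpha> *\<^sub>R y + b)) has_derivative (\<lambda>h. nderiv g ((\<alpha> *\<^sub>R h) # hs) (\<alpha> *\<^sub>R y + b))) (at y)" .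
    moreover have "nderiv g ((\<alpha> *\<^sub>R h) # hs) (\<alpha> *\<^sub>R y + b) = \<alpha> * nderiv g (h # hs) (\<alpha> *\<^sub>R y + b)" for h
      using linear_scale[OF linear_nderiv[OF yD, of "[]" hs], of \<alpha> h] l by simp
    ultimately have "((\<lambda>y. nderiv g hs (\<alpha> *\<^sub>R y + b)) has_derivative (\<lambda>h. \<alpha> * nderiv g (h # hs) (\<alpha> *\<^sub>R y + b))) (at y)"
      by simp
    from has_derivative_mult_right[OF this, of "c * \<alpha> ^ length hs"] show ?thesis
      by (simp add: mult_ac)
  qed
  have formula: "nderiv ?g hs y = c * \<alpha> ^ length hs * nderiv g hs (\<alpha> *\<^sub>R y + b)
      \<and> (length hs < p \<longrightarrow> nderiv ?g hs differentiable (at y))" if "y \<in> D'" "length hs \<le> p" for y hs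
    using that
  proof (induction hs arbitrary: y)
    case Nil
    have "?g differentiable (at y)" if "0 < p"
      using der[OF Nil(1), of "[]"] that unfolding differentiable_def by auto
    then show ?case by simp
  next
    case (Cons h hs)
    have *: "(nderiv ?g hs has_derivative
      (\<lambda>h. c * \<alpha> ^ length (h # hs) * nderiv g (h # hs) (\<alpha> *\<^sub>R y + b))) (at y)" if "y \<in> D'" for y
      using Cons.IH Cons.prems(2)
      by (intro has_derivative_transform_within_open[OF der open_D' that]) (auto simp: that)
    have eq: "nderiv ?g (h # hs) y = c * \<alpha> ^ length (h # hs) * nderiv g (h # hs) (\<alpha> *\<^sub>R y + b)" if "y \<in> D'" for y
      unfolding nderiv.simps(2) frechet_derivative_at[OF *[OF that], symmetric] ..
    have "nderiv ?g (h # hs) differentiable (at y)" if l: "length (h # hs) < p"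
      by (rule differentiableI,
          rule has_derivative_transform_within_open[OF der[OF Cons.prems(1) l] open_D' Cons.prems(1)])
        (rule eq[symmetric])
    then show ?case using eq[OF Cons.prems(1)] by blast
  qed
  then show "\<And>y hs. y \<in> D' \<Longrightarrow> length hs \<le> p \<Longrightarrow>
      nderiv ?g hs y = c * \<alpha> ^ length hs * nderiv g hs (\<alpha> *\<^sub>R y + b)"
    by blast
  show "smooth_function p ?g D'"
    using formula by (unfold_locales) (auto simp: open_D' times_differentiable_on_def)
qed

lemma (in tensor_model) affine_composition_model:
  fixes c \<alpha> :: real and b :: 'a
  defines "D' \<equiv> {y. \<alpha> *\<^sub>R y + b \<in> D}"
  assumes c: "0 < c" and \<alpha>: "0 < \<alpha>"
  shows "tensor_model B p (\<lambda>y. c * g (\<alpha> *\<^sub>R y + b)) D' (c * \<alpha> ^ (p + 1) * L)"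
proof -
  interpret s: smooth_function p "\<lambda>y. c * g (\<alpha> *\<^sub>R y + b)" D'
    unfolding D'_def by (rule affine_composition(1))
  note formula = affine_composition(2)[where c = c and \<alpha> = \<alpha> and b = b, folded D'_def]
  have comb: "\<alpha> *\<^sub>R (u *\<^sub>R x + v *\<^sub>R y) + b = u *\<^sub>R (\<alpha> *\<^sub>R x + b) + v *\<^sub>R (\<alpha> *\<^sub>R y + b)"
    if "u + v = 1" for u v x y
  proof -
    have "b = u *\<^sub>R b + v *\<^sub>R b" using that by (metis scaleR_left_distrib scaleR_one)
    then show ?thesis by (simp add: algebra_simps)
  qed
  show ?thesis
  proof
    show "convex_on D' (\<lambda>y. c * g (\<alpha> *\<^sub>R y + b))"
      unfolding convex_on_def
    proof (intro conjI ballI allI impI)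
      show "convex D'"
        unfolding convex_def
        by (auto simp: D'_def comb intro!: convexD[OF convex_D])
      fix x y u v assume xy: "x \<in> D'" "y \<in> D'" and uv: "0 \<le> (u::real)" "0 \<le> v" "u + v = 1"
      have "g (\<alpha> *\<^sub>R (u *\<^sub>R x + v *\<^sub>R y) + b) \<le> u * g (\<alpha> *\<^sub>R x + b) + v * g (\<alpha> *\<^sub>R y + b)"
        unfolding comb[OF uv(3)] using convex_g xy uv unfolding convex_on_def D'_def by blast
      from mult_left_mono[OF this less_imp_le[OF c]]
      show "c * g (\<alpha> *\<^sub>R (u *\<^sub>R x + v *\<^sub>R y) + b) \<le> u * (c * g (\<alpha> *\<^sub>R x + b)) + v * (c * g (\<alpha> *\<^sub>R y + b))"
        by (simp add: algebra_simps)
    qed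
    fix x y hs assume xy: "x \<in> D'" "y \<in> D'" and l: "length (hs :: 'a list) = p"
    have xyD: "\<alpha> *\<^sub>R x + b \<in> D" "\<alpha> *\<^sub>R y + b \<in> D" using xy by (auto simp: D'_def)
    have dist: "\<alpha> *\<^sub>R x + b - (\<alpha> *\<^sub>R y + b) = \<alpha> *\<^sub>R (x - y)" by (simp add: algebra_simps)
    have "\<bar>nderiv (\<lambda>y. c * g (\<alpha> *\<^sub>R y + b)) hs x - nderiv (\<lambda>y. c * g (\<alpha> *\<^sub>R y + b)) hs y\<bar>
        = \<bar>c * \<alpha> ^ p * (nderiv g hs (\<alpha> *\<^sub>R x + b) - nderiv g hs (\<alpha> *\<^sub>R y + b))\<bar>"
      using formula xy l by (simp add: right_diff_distrib)
    also have "\<dots> = c * \<alpha> ^ p * \<bar>nderiv g hs (\<alpha> *\<^sub>R x + b) - nderiv g hs (\<alpha> *\<^sub>R y + b)\<bar>"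
      using c \<alpha> by (simp add: abs_mult)
    also have "\<dots> \<le> c * \<alpha> ^ p * (L * N (\<alpha> *\<^sub>R (x - y)) * prod_list (map N hs))"
      using lipschitz[OF xyD l] c \<alpha> unfolding dist by (intro mult_left_mono) auto
    also have "\<dots> = c * \<alpha> ^ (p + 1) * L * N (x - y) * prod_list (map N hs)"
      using \<alpha> by (simp add: N_scaleR)
    finally show "\<bar>nderiv (\<lambda>y. c * g (\<alpha> *\<^sub>R y + b)) hs x - nderiv (\<lambda>y. c * g (\<alpha> *\<^sub>R y + b)) hs y\<bar>
        \<le> c * \<alpha> ^ (p + 1) * L * N (x - y) * prod_list (map N hs)" .
  qed (use p_pos L_pos c \<alpha> in auto)
qed

text \<open>
  The hypothesis bounds a supremum; multilinearity makes it finite, so that it dominates each value of the form.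
\<close>

lemma (in smooth_function) tensor_modelI:
  assumes B: "pos_def_norm B" and p: "1 \<le> p" and L: "0 < L" and cvx: "convex_on D g"
    and lip: "\<And>y y'. y \<in> D \<Longrightarrow> y' \<in> D \<Longrightarrow>
      form_nrm B p (\<lambda>hs. nderiv g hs y - nderiv g hs y') \<le> L * nrm B (y - y')"
  shows "tensor_model B p g D L"
proof -
  interpret pos_def_norm B by (rule B)
  obtain m where m: "p = Suc m" using p by (cases p) auto
  show ?thesis
  proof
    fix x y hs assume xy: "x \<in> D" "y \<in> D" and l: "length (hs :: 'a list) = p"
    have "\<bar>nderiv g hs x - nderiv g hs y\<bar>
        \<le> form_nrm B p (\<lambda>hs. nderiv g hs x - nderiv g hs y) * prod_list (map N hs)"
      using abs_le_form_nrm[of m, folded m, OF multilinear_nderiv_diff[OF xy] l] .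
    also have "\<dots> \<le> L * N (x - y) * prod_list (map N hs)"
      by (intro mult_right_mono lip xy prod_list_nonneg_map) auto
    finally show "\<bar>nderiv g hs x - nderiv g hs y\<bar> \<le> L * N (x - y) * prod_list (map N hs)" .
  qed (fact p L cvx)+
qed

section \<open>Scalar estimates\<close>

lemma power_swap: "(x ^ m) ^ n = (x ^ n) ^ m" for x :: real
  by (simp only: power_mult[symmetric] mult.commute)

lemma powr_root_power:
  assumes "0 \<le> (y::real)"
  shows "(y powr (1 / (real p + 1))) ^ (p + 1) = y"
proof (cases "y = 0")
  case False
  then have "(y powr (1 / (real p + 1))) ^ (p + 1) = (y powr (1 / (real p + 1))) powr real (p + 1)"
    using assms by (subst powr_realpow) auto
  also have "\<dots> = y powr (1 / (real p + 1) * (real p + 1))" by (simp add: powr_powr add.commute)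
  also have "1 / (real p + 1) * (real p + 1) = 1" by (simp add: add_eq_0_iff_both_eq_0)
  finally show ?thesis using assms False by simp
qed simp

lemma power_increment_le:
  fixes x :: real
  assumes "0 \<le> x"
  shows "(x + 1) ^ (n + 1) \<le> x ^ (n + 1) + (real n + 1) * (x + 1) ^ n"
proof (induction n)
  case (Suc n)
  have "(x + 1) ^ (Suc n + 1) \<le> (x + 1) * (x ^ (n + 1) + (real n + 1) * (x + 1) ^ n)"
    using mult_left_mono[OF Suc.IH, of "x + 1"] assms by simp
  also have "\<dots> = x ^ (Suc n + 1) + x ^ (n + 1) + (real n + 1) * (x + 1) ^ (n + 1)"
    by (simp add: algebra_simps)
  also have "x ^ (n + 1) \<le> (x + 1) ^ (n + 1)" using assms by (intro power_mono) auto
  finally show ?case by (simp add: algebra_simps)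
qed simp

text \<open>The discrete counterpart of \<open>(s ^ (p + 1))' \<le> m s \<Longrightarrow> (s ^ p)' \<le> m\<close>.\<close>

lemma power_increment_transfer:
  fixes s s' m :: real
  assumes "0 \<le> s" "0 \<le> s'" "0 \<le> m" and le: "s' ^ (p + 1) \<le> s ^ (p + 1) + m * s'"
  shows "s' ^ p \<le> s ^ p + m"
proof (cases "s' \<le> s")
  case True
  then show ?thesis using power_mono[OF True assms(2), of p] assms(3) by linarith
next
  case False
  then have "s * s ^ p \<le> s' * s ^ p" using assms(1) by (intro mult_right_mono) auto
  then have "s' * s' ^ p \<le> s' * (s ^ p + m)" using le by (simp add: algebra_simps)
  then show ?thesis using False assms(1) by simp
qed

lemma ln_ge_1: "3 \<le> x \<Longrightarrow> 1 \<le> ln (x :: real)"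
  using exp_le by (subst ln_ge_iff) auto

text \<open>
  With \<open>y = ln (p + 1)\<close> and \<open>l = ln 2\<close> this is \<open>l \<le> y (2 l - 1) + y\<^sup>2 / p\<close>, which follows from
  \<open>l \<ge> 2 / 3\<close> and the lower bounds \<open>1\<close>, \<open>2 l\<close> and \<open>3 l\<close> of \<open>y\<close> for \<open>p = 2\<close>, \<open>3 \<le> p \<le> 6\<close> and \<open>p \<ge> 7\<close>.
\<close>

lemma ln_step_rate_bound:
  fixes p :: nat
  assumes p: "2 \<le> p"
  shows "ln 2 + ln (real p + 1) \<le> ln (real p + 1) * (ln 4 + ln (real p + 1) / real p)"
proof -
  define y where "y = ln (real p + 1)"
  define l where "l = ln (2 :: real)"
  have l: "2 / 3 \<le> l" using ln2_ge_two_thirds by (simp add: l_def)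
  have ln4: "ln (4 :: real) = 2 * l" using ln_realpow[of 2 2] by (simp add: l_def)
  have ln8: "ln (8 :: real) = 3 * l" using ln_realpow[of 2 3] by (simp add: l_def)
  have y1: "1 \<le> y" unfolding y_def using p by (intro ln_ge_1) auto
  have "l + y \<le> y * (2 * l) + y\<^sup>2 / real p"
  proof -
    consider "p = 2" | "3 \<le> p" "p \<le> 6" | "7 \<le> p" using p by linarith
    then show ?thesis
    proof cases
      case 1
      have "1 * (2 * l - 1) \<le> y * (2 * l - 1)" using y1 l by (intro mult_right_mono) auto
      moreover have "1 \<le> y\<^sup>2" using y1 by simp
      ultimately show ?thesis using 1 l by (simp add: algebra_simps)
    next
      case 2
      have "ln 4 \<le> y" unfolding y_def using 2 by (intro ln_mono) auto
      then have y2: "2 * l \<le> y" using ln4 by simp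
      then have "2 * l * (2 * l - 1) \<le> y * (2 * l - 1)" using l by (intro mult_right_mono) auto
      moreover have "(2 * l)\<^sup>2 / 6 \<le> y\<^sup>2 / real p"
        using y2 l 2 by (intro frac_le power_mono) auto
      moreover have "l \<le> 2 * l * (2 * l - 1) + (2 * l)\<^sup>2 / 6"
      proof -
        have "3 * l \<le> 14 / 3 * l * l" using l by (intro mult_right_mono) auto
        then show ?thesis by (simp add: power2_eq_square algebra_simps)
      qed
      ultimately show ?thesis by (simp add: algebra_simps)
    next
      case 3
      have "ln 8 \<le> y" unfolding y_def using 3 by (intro ln_mono) auto
      then have "3 * l * (2 * l - 1) \<le> y * (2 * l - 1)" using l ln8 by (intro mult_right_mono) auto
      moreover have "l * 1 \<le> l * (3 * (2 * l - 1))" using l by (intro mult_left_mono) auto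
      ultimately have "l + y \<le> y * (2 * l)" by (simp add: algebra_simps)
      then show ?thesis by (rule order_trans) simp
    qed
  qed
  then show ?thesis
    by (simp add: y_def[symmetric] ln4 l_def[symmetric] distrib_left power2_eq_square)
qed

lemma step_rate_gt_1: "1 \<le> p \<Longrightarrow> 1 < step_rate p"
  by (simp add: step_rate_def)

text \<open>
  The number of steps for a residual reduction by \<open>2 (p + 1) K ^ p\<close> at the rate
  \<open>step_rate p ^ (p / (p + 1))\<close>, compared with the logarithm in the complexity bound.
\<close>

lemma step_count_bound:
  fixes p K :: nat and \<gamma> :: real
  assumes p: "1 \<le> p" and K: "1 \<le> K" and \<gamma>: "0 < \<gamma>"
  shows "(real p + 1) * ln (2 * (real p + 1) * real K ^ p) / (real p * ln (step_rate p))
    \<le> (real p + 1) / real p * ln (4 * (1 + 1 / \<gamma>) * (real p + 1) powr (1 / real p) * real K ^ p)"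
proof -
  define q where "q = ln (step_rate p)"
  define k where "k = ln (real K ^ p)"
  have q: "0 < q" using step_rate_gt_1[OF p] by (simp add: q_def)
  have k: "0 \<le> k" unfolding k_def using K by (intro ln_ge_zero) simp
  have "ln (2 * (real p + 1) * real K ^ p) = ln 2 + ln (real p + 1) + k"
    using K ln_mult[of "2 * (real p + 1)" "real K ^ p"] ln_mult[of 2 "real p + 1"]
    by (simp add: k_def del: distrib_left_numeral)
  also have "\<dots> \<le> q * (ln 4 + ln (real p + 1) / real p + k)"
  proof (cases "p = 1")
    case True
    have "2 / 3 \<le> ln (2 :: real)" by (rule ln2_ge_two_thirds)
    moreover have "ln (4 :: real) = 2 * ln 2" using ln_realpow[of 2 2] by simp
    ultimately have l: "q = 2 * ln 2" "1 \<le> q" by (auto simp: q_def step_rate_def True)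
    have "q * 1 \<le> q * (ln 4 + ln 2)" using l q by (intro mult_left_mono) (auto simp: q_def step_rate_def True)
    moreover have "1 * k \<le> q * k" using l k by (intro mult_right_mono) auto
    ultimately show ?thesis using l(1) True by (simp add: distrib_left)
  next
    case False
    then have p2: "2 \<le> p" using p by simp
    have qp: "q = ln (real p + 1)" using False by (simp add: q_def step_rate_def)
    have "1 \<le> q" unfolding qp using p2 by (intro ln_ge_1) auto
    then have "1 * k \<le> q * k" using k by (intro mult_right_mono) auto
    then show ?thesis using ln_step_rate_bound[OF p2] unfolding qp by (simp add: distrib_left)
  qed
  also have "ln 4 + ln (real p + 1) / real p + k = ln (4 * (real p + 1) powr (1 / real p) * real K ^ p)"
    using K by (simp add: k_def ln_mult ln_powr)
  also have "q * \<dots> \<le> q * ln (4 * (1 + 1 / \<gamma>) * (real p + 1) powr (1 / real p) * real K ^ p)"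
  proof -
    have "4 * 1 * ((real p + 1) powr (1 / real p) * real K ^ p)
        \<le> 4 * (1 + 1 / \<gamma>) * ((real p + 1) powr (1 / real p) * real K ^ p)"
      using \<gamma> by (intro mult_right_mono) auto
    then show ?thesis using q K \<gamma> by (intro mult_left_mono ln_mono) (auto simp: mult.assoc add_pos_pos)
  qed
  finally have "ln (2 * (real p + 1) * real K ^ p) / q
      \<le> ln (4 * (1 + 1 / \<gamma>) * (real p + 1) powr (1 / real p) * real K ^ p)"
    using q by (simp add: divide_le_eq mult.commute)
  from mult_left_mono[OF this, of "(real p + 1) / real p"] show ?thesis
    by (simp add: q_def)
qed

lemma power_ge_of_ln:
  fixes x y :: real
  assumes "1 < x" "0 < y" "ln y / ln x \<le> real n"
  shows "y \<le> x ^ n"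
proof -
  have "ln y \<le> real n * ln x" using assms by (simp add: divide_le_eq)
  also have "\<dots> = ln (x ^ n)" using assms(1) by (simp add: ln_realpow)
  finally show ?thesis using assms by (subst (asm) ln_le_cancel_iff) auto
qed

section \<open>The contracting proximal scheme\<close>

locale contracting_run = tensor_model B p f D L
  for B :: "'a::euclidean_space \<Rightarrow> 'a \<Rightarrow> real" and p and f :: "'a \<Rightarrow> real" and D L +
  fixes \<psi> :: "'a \<Rightarrow> ereal" and \<gamma>0 \<delta> \<epsilon> :: real and x0 xstar :: 'a and K :: nat
    and a A \<gamma> :: "nat \<Rightarrow> real" and x v :: "nat \<Rightarrow> 'a"
    and z :: "nat \<Rightarrow> nat \<Rightarrow> 'a" and t :: "nat \<Rightarrow> nat"
  assumes psi: "proper_closed_convex \<psi>" and dom: "edom \<psi> \<subseteq> D"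
    and xstar: "xstar \<in> edom \<psi>"
      "\<And>y. y \<in> edom \<psi> \<Longrightarrow> f xstar + real_of_ereal (\<psi> xstar) \<le> f y + real_of_ereal (\<psi> y)"
    and x0: "x0 \<in> edom \<psi>"
    and gamma0: "0 < \<gamma>0" and eps: "0 < \<epsilon>"
    and delta: "\<delta> = (fact p * \<epsilon> / L) powr (real p / (real p + 1))
                  * (\<gamma>0 / (2 ^ p * (real p + 1) ^ (p + 1)))"
    and run: "cpt_run B p f \<psi> L 0 \<gamma>0 \<delta> x0 a A \<gamma> x v z t"
    and K: "K = nat \<lfloor>1 + 2 powr (1 / real p) *
                  (2 ^ (p - 1) * (real p + 1) ^ (p + 2) * L * bregman (prox_fn B p x0) x0 xstar
                     / (\<epsilon> * fact p)) powr (1 / (real p + 1))\<rfloor>"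
begin

abbreviation d where "d \<equiv> prox_fn B p x0"
abbreviation E where "E \<equiv> edom \<psi>"
abbreviation r where "r y \<equiv> real_of_ereal (\<psi> y)"
abbreviation Fr where "Fr y \<equiv> f y + r y"
abbreviation c where "c \<equiv> contracting_scale p L \<gamma>0"

definition contracted_domain :: "nat \<Rightarrow> 'a set" where
  "contracted_domain k = {y. (a (Suc k) / A (Suc k)) *\<^sub>R y + (A k / A (Suc k)) *\<^sub>R x k \<in> D}"

definition contracted_lipschitz :: "nat \<Rightarrow> real" where
  "contracted_lipschitz k = A (Suc k) * (a (Suc k) / A (Suc k)) ^ (p + 1) * L"

lemma c_pos: "0 < c"
  using gamma0 L_pos by (simp add: contracting_scale_def add_nonneg_pos)

lemma init: "x 0 = x0" "v 0 = x0" "A 0 = 0" "\<gamma> 0 = \<gamma>0"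
  and a_Suc: "a (Suc k) = c * (real p + 1) * (real k + 1) ^ p"
  and A_Suc: "A (Suc k) = A k + a (Suc k)"
  and z_0: "z k 0 = v k"
  and z_Suc: "z k (Suc i) = tensor_step B p (inner_const p L a A k)
               (contracted f a A x k) (prox_term d \<psi> a \<gamma> v k) (z k i)"
  and t_eq: "t k = (LEAST i. inner_stop B p f L \<delta> a A x z k i)"
  and v_Suc: "v (Suc k) = z k (t k)"
  and x_Suc: "x (Suc k) = (a (Suc k) *\<^sub>R v (Suc k) + A k *\<^sub>R x k) /\<^sub>R A (Suc k)"
  using run unfolding cpt_run_def by auto

lemma gamma_eq: "\<gamma> k = \<gamma>0"
  using run unfolding cpt_run_def by (induction k) auto

lemma a_pos: "0 < a (Suc k)"
  using c_pos by (simp add: a_Suc add_nonneg_pos)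

lemma A_ge: "c * real k ^ (p + 1) \<le> A k"
proof (induction k)
  case (Suc k)
  have "c * real (Suc k) ^ (p + 1) \<le> c * (real k ^ (p + 1) + (real p + 1) * (real k + 1) ^ p)"
    using power_increment_le[of "real k" p] c_pos by (intro mult_left_mono) (auto simp: add.commute)
  also have "\<dots> \<le> A (Suc k)" using Suc by (simp add: A_Suc a_Suc algebra_simps)
  finally show ?case .
qed (simp add: init)

lemma A_nonneg: "0 \<le> A k"
  using A_ge[of k] c_pos by (meson order_trans mult_nonneg_nonneg less_imp_le of_nat_0_le_iff zero_le_power)

lemma A_Suc_pos: "0 < A (Suc k)"
  using A_nonneg[of k] a_pos[of k] by (simp add: A_Suc)

lemma convex_E: "convex E" and convex_r: "convex_on E r"
  using convex_on_edom[OF psi] by (auto simp: convex_on_def)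

lemma contraction_eq:
  "(a (Suc k) *\<^sub>R y + A k *\<^sub>R x k) /\<^sub>R A (Suc k) = (a (Suc k) / A (Suc k)) *\<^sub>R y + (A k / A (Suc k)) *\<^sub>R x k"
  by (simp add: scaleR_add_right divide_inverse mult.commute)

lemma weights: "0 \<le> a (Suc k) / A (Suc k)" "0 \<le> A k / A (Suc k)" "a (Suc k) / A (Suc k) + A k / A (Suc k) = 1"
  using A_Suc_pos[of k] A_nonneg[of k] a_pos[of k]
  by (auto simp: add_divide_distrib[symmetric]) (simp add: A_Suc add.commute)

lemma contraction_in:
  "y \<in> E \<Longrightarrow> x k \<in> E \<Longrightarrow> (a (Suc k) *\<^sub>R y + A k *\<^sub>R x k) /\<^sub>R A (Suc k) \<in> E"
  unfolding contraction_eq using weights by (intro convexD[OF convex_E]) auto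

lemma inner_const_eq: "inner_const p L a A k = real p * contracted_lipschitz k"
  using A_Suc_pos[of k] by (simp add: inner_const_def contracted_lipschitz_def power_divide)

lemma contracted_eq:
  "contracted f a A x k = (\<lambda>y. A (Suc k) * f ((a (Suc k) / A (Suc k)) *\<^sub>R y + (A k / A (Suc k)) *\<^sub>R x k))"
  by (simp add: contracted_def contraction_eq)

text \<open>The solution supplies an affine minorant of \<open>\<psi>\<close>: by optimality of \<open>xstar\<close>, minus the gradient of \<open>f\<close> is a subgradient of \<open>\<psi>\<close>.\<close>

lemma psi_minorant: "\<exists>b C. \<forall>y\<in>E. b - C * N (y - u) \<le> r y"
proof (rule tangent_minorant)
  have xD: "xstar \<in> D" using xstar dom by blast
  show "linear (\<lambda>u. - grad f xstar u)"
    using has_derivative_linear[OF grad_g_has_derivative[OF xD]] by (rule linear_compose_neg)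
  fix y assume y: "y \<in> E"
  show "r xstar + - grad f xstar (y - xstar) \<le> r y"
    using composite_first_order_optimality[OF convex_r xstar(1) y, of 1 f "grad f xstar"]
      xstar(2) grad_g_has_derivative[OF xD] by simp
qed

lemma subproblem:
  assumes "x k \<in> E" "v k \<in> E"
  shows "closed_composite_model B p (contracted f a A x k) (contracted_domain k) (contracted_lipschitz k)
    E r (a (Suc k)) \<gamma>0 (v k)"
proof -
  have "tensor_model B p (contracted f a A x k) (contracted_domain k) (contracted_lipschitz k)"
    unfolding contracted_eq contracted_domain_def contracted_lipschitz_def
    using A_Suc_pos[of k] a_pos[of k] by (intro affine_composition_model) auto
  then interpret c: tensor_model B p "contracted f a A x k" "contracted_domain k" "contracted_lipschitz k" .
  show ?thesis
  proof
    show "E \<subseteq> contracted_domain k"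
      using contraction_in[OF _ assms(1)] dom by (auto simp: contracted_domain_def contraction_eq)
  qed (use edom_closed[OF psi] psi_minorant convex_r a_pos gamma0 assms in blast)+
qed

text \<open>
  By \<open>A_ge\<close> the ratio \<open>a ^ (p + 1) / A ^ p\<close> is at most \<open>c (p + 1) ^ (p + 1)\<close>, and \<open>c\<close> is the largest constant
  for which this gives the condition required by \<open>step_contraction\<close>.
\<close>

lemma condition_number: "(real p + 1) * (contracted_lipschitz k / fact p) \<le> \<gamma>0 * (1 / 2) ^ (p - 1)"
proof -
  define n where "n = real k + 1"
  have n: "0 < n" by (simp add: n_def add_nonneg_pos)
  have A: "c * n ^ (p + 1) \<le> A (Suc k)" using A_ge[of "Suc k"] by (simp add: n_def add.commute)
  have "contracted_lipschitz k = a (Suc k) ^ (p + 1) / A (Suc k) ^ p * L"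
    using A_Suc_pos[of k] by (simp add: contracted_lipschitz_def power_divide)
  also have "\<dots> \<le> a (Suc k) ^ (p + 1) / (c * n ^ (p + 1)) ^ p * L"
    using A c_pos n L_pos a_pos[of k]
    by (intro mult_right_mono divide_left_mono power_mono mult_pos_pos zero_less_power A_Suc_pos) auto
  also have "\<dots> = c * (real p + 1) ^ (p + 1) * L"
  proof -
    have "a (Suc k) ^ (p + 1) = c ^ (p + 1) * (real p + 1) ^ (p + 1) * n ^ (p * (p + 1))"
      by (simp only: a_Suc n_def power_mult_distrib power_mult)
    moreover have "(c * n ^ (p + 1)) ^ p = c ^ p * n ^ (p * (p + 1))"
      by (simp only: power_mult_distrib power_mult[symmetric] mult.commute)
    ultimately show ?thesis using c_pos n by simp
  qed
  finally have "(real p + 1) * (contracted_lipschitz k / fact p)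
      \<le> (real p + 1) * (c * (real p + 1) ^ (p + 1) * L / fact p)"
    by (intro mult_left_mono divide_right_mono) auto
  also have "\<dots> = \<gamma>0 * (1 / 2) ^ (p - 1)"
  proof -
    define X where "X = (real p + 1) ^ (p + 2)"
    have "X \<noteq> 0" by (simp add: X_def add_eq_0_iff_both_eq_0)
    moreover have "(real p + 1) * (c * (real p + 1) ^ (p + 1) * L / fact p) = c * X * L / fact p"
      by (simp add: X_def)
    moreover have "c = fact p * \<gamma>0 / (2 ^ (p - 1) * X * L)"
      by (simp add: contracting_scale_def X_def)
    ultimately show ?thesis using L_pos by (simp add: power_one_over)
  qed
  finally show ?thesis .
qed

lemma prox_term_eq:
  "y \<in> E \<Longrightarrow> prox_term d \<psi> a \<gamma> v k y = ereal (a (Suc k) * r y + \<gamma>0 * bregman d (v k) y)"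
  "y \<notin> E \<Longrightarrow> prox_term d \<psi> a \<gamma> v k y = \<infinity>"
proof -
  assume y: "y \<in> E"
  obtain s where s: "\<psi> y = ereal s" using edom_real[OF psi y] by blast
  show "prox_term d \<psi> a \<gamma> v k y = ereal (a (Suc k) * r y + \<gamma>0 * bregman d (v k) y)"
    by (simp add: prox_term_def gamma_eq s)
next
  assume "y \<notin> E"
  then show "prox_term d \<psi> a \<gamma> v k y = \<infinity>"
    using not_edom[OF psi] a_pos[of k] by (simp add: prox_term_def)
qed

lemma iterates_in: "x k \<in> E \<and> v k \<in> E"
  and inner_in: "z k i \<in> E"
proof -
  have inner: "z k i \<in> E" if "x k \<in> E" "v k \<in> E" for k i
  proof (induction i)
    case (Suc i)
    interpret c: closed_composite_model B p "contracted f a A x k" "contracted_domain k"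
      "contracted_lipschitz k" E r "a (Suc k)" \<gamma>0 x0 "v k"
      by (rule subproblem[OF that])
    show ?case
      unfolding z_Suc inner_const_eq
      by (rule c.tensor_step_minimizes(1)[OF Suc]) (simp_all add: prox_term_eq c.\<Phi>_def)
  qed (simp add: z_0 that)
  show *: "x k \<in> E \<and> v k \<in> E" for k
  proof (induction k)
    case (Suc k)
    have "v (Suc k) \<in> E" unfolding v_Suc by (rule inner) (use Suc in auto)
    then show ?case unfolding x_Suc using Suc contraction_in by blast
  qed (simp add: init x0)
  show "z k i \<in> E" using inner * by blast
qed

lemma inner_minimizes:
  assumes "y \<in> E"
  shows "tensor_model.model B p (contracted f a A x k) (contracted_lipschitz k) (z k i) (z k (Suc i))
      + composite_model.\<Phi> B p r (a (Suc k)) \<gamma>0 x0 (v k) (z k (Suc i))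
    \<le> tensor_model.model B p (contracted f a A x k) (contracted_lipschitz k) (z k i) y
      + composite_model.\<Phi> B p r (a (Suc k)) \<gamma>0 x0 (v k) y"
proof -
  interpret c: closed_composite_model B p "contracted f a A x k" "contracted_domain k"
    "contracted_lipschitz k" E r "a (Suc k)" \<gamma>0 x0 "v k"
    using iterates_in by (intro subproblem) auto
  show ?thesis
    unfolding z_Suc inner_const_eq
    by (rule c.tensor_step_minimizes(2)[OF inner_in _ _ assms]) (simp_all add: prox_term_eq c.\<Phi>_def)
qed

definition potential :: "nat \<Rightarrow> real" where
  "potential k = A k * (Fr (x k) - Fr xstar) + \<gamma>0 * bregman d (v k) xstar"

text \<open>
  The two sides of the subproblem at a point and at \<open>xstar\<close>: convexity of \<open>\<psi>\<close> turns the former into a value of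
  the objective at the contracted point, and convexity of \<open>f\<close> bounds the latter by values at \<open>x k\<close> and \<open>xstar\<close>.
\<close>

lemma contracted_composite_ge:
  assumes y: "y \<in> E"
  shows "A (Suc k) * Fr ((a (Suc k) *\<^sub>R y + A k *\<^sub>R x k) /\<^sub>R A (Suc k)) - A k * r (x k)
    \<le> contracted f a A x k y + a (Suc k) * r y"
proof -
  have "r ((a (Suc k) *\<^sub>R y + A k *\<^sub>R x k) /\<^sub>R A (Suc k)) \<le> a (Suc k) / A (Suc k) * r y + A k / A (Suc k) * r (x k)"
    unfolding contraction_eq using convex_r weights y iterates_in unfolding convex_on_def by blast
  from mult_left_mono[OF this less_imp_le[OF A_Suc_pos[of k]]]
  have "A (Suc k) * r ((a (Suc k) *\<^sub>R y + A k *\<^sub>R x k) /\<^sub>R A (Suc k)) \<le> a (Suc k) * r y + A k * r (x k)"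
    using A_Suc_pos[of k] by (simp add: distrib_left)
  then show ?thesis by (simp add: contracted_def distrib_left)
qed

lemma contracted_xstar_le:
  "contracted f a A x k xstar + a (Suc k) * r xstar \<le> a (Suc k) * Fr xstar + A k * f (x k)"
proof -
  have "f ((a (Suc k) *\<^sub>R xstar + A k *\<^sub>R x k) /\<^sub>R A (Suc k)) \<le> a (Suc k) / A (Suc k) * f xstar + A k / A (Suc k) * f (x k)"
    unfolding contraction_eq using convex_g weights xstar(1) iterates_in dom unfolding convex_on_def by blast
  from mult_left_mono[OF this less_imp_le[OF A_Suc_pos[of k]]]
  have "contracted f a A x k xstar \<le> a (Suc k) * f xstar + A k * f (x k)"
    using A_Suc_pos[of k] by (simp add: contracted_def distrib_left)
  then show ?thesis by (simp add: distrib_left)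
qed

text \<open>
  The subgradient inequality of the subproblem at \<open>v (Suc k)\<close> towards \<open>xstar\<close>. The surplus
  \<open>\<gamma>0 * bregman d (v (Suc k)) xstar\<close> is the second part of the new potential.
\<close>

lemma potential_step:
  assumes stop: "inner_stop B p f L \<delta> a A x z k (t k)"
  shows "potential (Suc k) \<le> potential k + \<delta> * N (v (Suc k) - xstar)"
proof -
  interpret c: closed_composite_model B p "contracted f a A x k" "contracted_domain k"
    "contracted_lipschitz k" E r "a (Suc k)" \<gamma>0 x0 "v k"
    using iterates_in by (intro subproblem) auto
  obtain i where i: "t k = Suc i" using stop by (cases "t k") (auto simp: inner_stop_def)
  define T where "T = v (Suc k)"
  define s where "s = step_subgrad B p c.M (contracted f a A x k) (z k i) T"
  have T: "T = z k (Suc i)" "T \<in> E" using inner_in by (auto simp: T_def v_Suc i)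
  have zi: "z k i \<in> contracted_domain k" by (rule c.in_D[OF inner_in])
  have lin: "linear s" unfolding s_def by (rule c.linear_step_subgrad[OF zi T(2)])
  have "dual_nrm B s \<le> \<delta>"
    using stop by (simp add: inner_stop_def i inner_const_eq s_def T(1))
  then have "dual_nrm B s * N (T - xstar) \<le> \<delta> * N (T - xstar)" by (intro mult_right_mono) auto
  then have "- s (xstar - T) \<le> \<delta> * N (T - xstar)"
    using le_dual_nrm[OF lin, of "T - xstar"] linear_neg[OF lin, of "xstar - T"] by simp
  moreover have "c.h T + s (xstar - T) + \<gamma>0 * bregman d T xstar \<le> c.h xstar"
    unfolding s_def T(1)
    by (rule c.step_subgradient[OF zi inner_in inner_minimizes xstar(1)])
  moreover have "A (Suc k) * Fr (x (Suc k)) - A k * r (x k) \<le> contracted f a A x k T + a (Suc k) * r T"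
    using contracted_composite_ge[OF T(2), of k] by (simp add: x_Suc T_def)
  moreover have "0 \<le> \<gamma>0 * bregman d (v k) T"
    using gamma0 bregman_prox_fn_nonneg[OF p_pos] by simp
  ultimately have "A (Suc k) * Fr (x (Suc k)) - A k * r (x k) + \<gamma>0 * bregman d T xstar
      \<le> a (Suc k) * Fr xstar + A k * f (x k) + \<gamma>0 * bregman d (v k) xstar + \<delta> * N (T - xstar)"
    using contracted_xstar_le[of k] unfolding c.h_def c.\<Phi>_def by linarith
  then show ?thesis
    unfolding potential_def T_def by (simp add: A_Suc algebra_simps)
qed

text \<open>
  The exact minimizer satisfies the same inequality without error. Here the distance from \<open>v k\<close>, which
  \<open>potential_step\<close> drops, is kept: it is the initial distance of the inner loop.
\<close>

lemma subproblem_minimizer: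
  obtains w where "w \<in> E"
    "\<And>y. y \<in> E \<Longrightarrow> composite_model.h B p (contracted f a A x k) r (a (Suc k)) \<gamma>0 x0 (v k) w
      \<le> composite_model.h B p (contracted f a A x k) r (a (Suc k)) \<gamma>0 x0 (v k) y"
    "\<gamma>0 * bregman d (v k) w \<le> potential k"
proof -
  interpret c: closed_composite_model B p "contracted f a A x k" "contracted_domain k"
    "contracted_lipschitz k" E r "a (Suc k)" \<gamma>0 x0 "v k"
    using iterates_in by (intro subproblem) auto
  obtain w where w: "w \<in> E" "\<And>y. y \<in> E \<Longrightarrow> c.h w \<le> c.h y"
    using c.h_attains_minimum by blast
  define x' where "x' = (a (Suc k) *\<^sub>R w + A k *\<^sub>R x k) /\<^sub>R A (Suc k)"
  have "x' \<in> E" unfolding x'_def using w(1) iterates_in by (intro contraction_in) auto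
  then have "A (Suc k) * Fr xstar \<le> A (Suc k) * Fr x'"
    using xstar(2) A_Suc_pos[of k] by (intro mult_left_mono) auto
  moreover have "A (Suc k) * Fr x' - A k * r (x k) \<le> contracted f a A x k w + a (Suc k) * r w"
    unfolding x'_def by (rule contracted_composite_ge[OF w(1)])
  moreover have "c.h w \<le> c.h xstar" by (rule w(2)[OF xstar(1)])
  ultimately have "A (Suc k) * Fr xstar - A k * r (x k) + \<gamma>0 * bregman d (v k) w
      \<le> a (Suc k) * Fr xstar + A k * f (x k) + \<gamma>0 * bregman d (v k) xstar"
    using contracted_xstar_le[of k] unfolding c.h_def c.\<Phi>_def by linarith
  then have "\<gamma>0 * bregman d (v k) w \<le> potential k"
    unfolding potential_def by (simp add: A_Suc algebra_simps)
  then show ?thesis using w that by blast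
qed

end

section \<open>Accuracy and complexity\<close>

context contracting_run
begin

text \<open>
  Three \<open>(p + 1)\<close>-st roots that remove all fractional exponents: \<open>e\<close> is the scale of the accuracy, \<open>b\<close>
  converts the root of a Bregman distance into a norm (\<open>norm_power_le_bregman\<close>), and \<open>U\<close> is the root of
  \<open>c \<epsilon>\<close>, the target for the potential divided by \<open>K ^ (p + 1)\<close> (\<open>U_power\<close>).
\<close>

definition e where "e = (fact p * \<epsilon> / L) powr (1 / (real p + 1))"
definition b where "b = (2 ^ (p - 1) * (real p + 1) / \<gamma>0) powr (1 / (real p + 1))"
definition U where "U = e / (b * (real p + 1))"

lemma e_pos: "0 < e" and e_power: "e ^ (p + 1) = fact p * \<epsilon> / L"
  and b_pos: "0 < b" and b_power: "b ^ (p + 1) = 2 ^ (p - 1) * (real p + 1) / \<gamma>0"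
  using eps L_pos gamma0 by (auto simp: e_def b_def powr_root_power add_eq_0_iff_both_eq_0 simp del: power_Suc power_add One_nat_def)

lemma U_pos: "0 < U"
  using e_pos b_pos by (simp add: U_def add_nonneg_pos)

lemma U_power: "U ^ (p + 1) = c * \<epsilon>"
proof -
  have "U ^ (p + 1) = e ^ (p + 1) / (b ^ (p + 1) * (real p + 1) ^ (p + 1))"
    by (simp only: U_def power_divide power_mult_distrib)
  also have "\<dots> = c * \<epsilon>"
    unfolding e_power b_power using gamma0 L_pos by (simp add: contracting_scale_def mult_ac)
  finally show ?thesis .
qed

lemma delta_eq: "\<delta> = e ^ p * \<gamma>0 / (2 ^ p * (real p + 1) ^ (p + 1))"
proof -
  have E: "0 < fact p * \<epsilon> / L" using eps L_pos by simp
  have "e ^ p = e powr real p" using e_pos by (simp add: powr_realpow)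
  also have "\<dots> = (fact p * \<epsilon> / L) powr (real p / (real p + 1))"
    by (simp add: e_def powr_powr)
  finally show ?thesis by (simp add: delta)
qed

lemma delta_nonneg: "0 \<le> \<delta>"
  unfolding delta_eq using e_pos gamma0 by simp

text \<open>
  The inner accuracy is chosen so that the errors of \<open>K\<close> iterations, measured by the \<open>p\<close>-th power of the root
  of the potential, take at most the half of \<open>U ^ p * K ^ p\<close> that the initial potential leaves.
\<close>

lemma delta_b: "\<delta> * b = U ^ p / 2"
proof -
  obtain m where m: "p = Suc m" using p_pos by (cases p) auto
  define P where "P = real p + 1"
  have P: "0 < P" by (simp add: P_def add_nonneg_pos)
  have "\<delta> * b * (2 * b ^ p * P ^ p) = e ^ p * (\<gamma>0 * b ^ (p + 1)) / (2 ^ m * P)"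
    unfolding delta_eq P_def[symmetric] using P by (simp add: m field_simps)
  also have "\<dots> = e ^ p"
    unfolding b_power P_def[symmetric] using P gamma0 by (simp add: m)
  finally have "\<delta> * b = e ^ p / (2 * b ^ p * P ^ p)" using b_pos P by (simp add: field_simps)
  then show ?thesis by (simp add: U_def power_divide power_mult_distrib P_def mult.assoc)
qed

lemma norm_power_le_bregman: "N (y - u) ^ (p + 1) \<le> b ^ (p + 1) * (\<gamma>0 * bregman d y u)"
proof -
  have "b ^ (p + 1) * \<gamma>0 * ((1 / 2) ^ (p - 1) / (real p + 1)) = 1"
    unfolding b_power using gamma0 by (simp add: power_one_over add_eq_0_iff_both_eq_0)
  then have "N (y - u) ^ (p + 1) = b ^ (p + 1) * \<gamma>0 * ((1 / 2) ^ (p - 1) / (real p + 1) * N (y - u) ^ (p + 1))"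
    by (metis mult.assoc mult_1)
  also have "\<dots> \<le> b ^ (p + 1) * \<gamma>0 * bregman d y u"
    using bregman_prox_fn_ge[OF p_pos] b_pos gamma0 by (intro mult_left_mono) auto
  finally show ?thesis by (simp add: mult.assoc)
qed

lemma root_le:
  assumes "0 \<le> s" "0 \<le> (n::real)" "n ^ (p + 1) \<le> b ^ (p + 1) * s ^ (p + 1)"
  shows "n \<le> b * s"
proof (rule power_le_imp_le_base)
  show "n ^ Suc p \<le> (b * s) ^ Suc p"
    using assms(3) by (simp only: power_mult_distrib Suc_eq_plus1)
qed (use assms b_pos in simp)

text \<open>
  The initial distance to the minimizer is at most \<open>K e / (p + 1)\<close>. The bound of the step length by this
  distance costs one factor \<open>step_rate p\<close>, which is why the loop stops at \<open>j + 2\<close>: one step to start,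
  one for this factor, and \<open>j\<close> for the required reduction.
\<close>

lemma inner_stops:
  assumes s: "0 \<le> s" "potential k \<le> s ^ (p + 1)" "s \<le> U * real K"
    and K1: "1 \<le> K"
    and j: "(2 * (real p + 1) * real K ^ p) ^ (p + 1) \<le> (step_rate p ^ p) ^ j"
  shows "inner_stop B p f L \<delta> a A x z k (j + 2)"
proof -
  interpret c: closed_composite_model B p "contracted f a A x k" "contracted_domain k"
    "contracted_lipschitz k" E r "a (Suc k)" \<gamma>0 x0 "v k"
    using iterates_in by (intro subproblem) auto
  obtain w where w: "w \<in> E" "\<And>y. y \<in> E \<Longrightarrow> c.h w \<le> c.h y" "\<gamma>0 * bregman d (v k) w \<le> potential k"
    using subproblem_minimizer by blast
  define P where "P = real p + 1"
  define q where "q = step_rate p"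
  define Y where "Y = N (z k (j + 2) - z k (j + 1))"
  define X where "X = real K * e / P"
  have P: "0 < P" by (simp add: P_def add_nonneg_pos)
  have q: "0 < q" using step_rate_gt_1[OF p_pos] by (simp add: q_def)
  have X: "0 \<le> X" using e_pos P by (simp add: X_def)
  have Y: "0 \<le> Y" by (simp add: Y_def)
  have "N (v k - w) ^ (p + 1) \<le> b ^ (p + 1) * (\<gamma>0 * bregman d (v k) w)" by (rule norm_power_le_bregman)
  also have "\<dots> \<le> b ^ (p + 1) * s ^ (p + 1)" using w(3) s(2) b_pos by (intro mult_left_mono) auto
  finally have "N (v k - w) \<le> b * s" using s(1) by (intro root_le) auto
  also have "\<dots> \<le> b * (U * real K)" using s(3) b_pos by (intro mult_left_mono) auto
  also have "\<dots> = X" using b_pos P by (simp add: U_def X_def P_def)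
  finally have dist: "N (v k - w) \<le> X" .
  have min: "c.model (z k i) (z k (Suc i)) + c.\<Phi> (z k (Suc i)) \<le> c.model (z k i) y + c.\<Phi> y" if "y \<in> E" for i y
    by (rule inner_minimizes[OF that])
  note res = c.tensor_steps_residual[of "z k", OF z_0 inner_in min w(1,2) condition_number]
  have "q ^ (j + 1) * Y ^ (p + 1) \<le> q * N (v k - w) ^ (p + 1)"
    using res(2)[of "j + 1"] by (simp add: q_def Y_def)
  also have "\<dots> \<le> q * X ^ (p + 1)" using dist q by (intro mult_left_mono power_mono) auto
  finally have "q ^ j * Y ^ (p + 1) \<le> X ^ (p + 1)" using q by simp
  then have "(q ^ j * Y ^ (p + 1)) ^ p \<le> (X ^ (p + 1)) ^ p"
    using q Y by (intro power_mono) auto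
  then have YX: "(q ^ p) ^ j * (Y ^ p) ^ (p + 1) \<le> (X ^ p) ^ (p + 1)"
    unfolding power_mult_distrib power_swap[of X "p + 1" p] power_swap[of q j p] power_swap[of Y "p + 1" p] .
  have "(2 * P * real K ^ p * Y ^ p) ^ (p + 1) = (2 * P * real K ^ p) ^ (p + 1) * (Y ^ p) ^ (p + 1)"
    by (rule power_mult_distrib)
  also have "\<dots> \<le> (q ^ p) ^ j * (Y ^ p) ^ (p + 1)"
    using j Y by (intro mult_right_mono) (auto simp: P_def q_def)
  finally have "(2 * P * real K ^ p * Y ^ p) ^ (p + 1) \<le> (X ^ p) ^ (p + 1)" using YX by linarith
  then have "2 * P * real K ^ p * Y ^ p \<le> X ^ p"
    unfolding Suc_eq_plus1[symmetric] by (rule power_le_imp_le_base[OF _ zero_le_power[OF X]])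
  then have "real K ^ p * (2 * P * Y ^ p) \<le> real K ^ p * (e ^ p / P ^ p)"
    by (simp add: X_def power_divide power_mult_distrib mult_ac)
  then have "2 * P * Y ^ p \<le> e ^ p / P ^ p"
    using K1 by (subst (asm) mult_le_cancel_left_pos) auto
  then have Yp: "Y ^ p \<le> e ^ p / (2 * P ^ (p + 1))"
    using P by (simp add: field_simps)
  have "dual_nrm B (step_subgrad B p c.M (contracted f a A x k) (z k (j + 1)) (z k (j + 2)))
      \<le> \<gamma>0 * (1 / 2) ^ (p - 1) * Y ^ p"
    using res(1)[of "j + 1"] by (simp add: Y_def)
  also have "\<dots> \<le> \<gamma>0 * (1 / 2) ^ (p - 1) * (e ^ p / (2 * P ^ (p + 1)))"
    using Yp gamma0 by (intro mult_left_mono) auto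
  also have "\<dots> = \<delta>"
  proof -
    obtain m where m: "p = Suc m" using p_pos by (cases p) auto
    have "(1 / 2 :: real) ^ (p - 1) = 2 / 2 ^ p" by (simp add: m power_one_over)
    then show ?thesis unfolding delta_eq P_def by (simp only:) simp
  qed
  finally show ?thesis by (simp add: inner_stop_def inner_const_eq)
qed

definition inner_bound :: nat where
  "inner_bound = nat \<lceil>(real p + 1) * ln (2 * (real p + 1) * real K ^ p) / (real p * ln (step_rate p))\<rceil>"

lemma inner_bound:
  assumes K1: "1 \<le> K"
  shows "(2 * (real p + 1) * real K ^ p) ^ (p + 1) \<le> (step_rate p ^ p) ^ inner_bound"
proof (rule power_ge_of_ln)
  let ?y = "2 * (real p + 1) * real K ^ p"
  have y: "0 < ?y" using K1 by (simp add: add_nonneg_pos)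
  show "1 < step_rate p ^ p" using step_rate_gt_1[OF p_pos] p_pos by (simp add: one_less_power)
  show "0 < ?y ^ (p + 1)" using y by (rule zero_less_power)
  have "ln (?y ^ (p + 1)) / ln (step_rate p ^ p) = (real p + 1) * ln ?y / (real p * ln (step_rate p))"
    using y step_rate_gt_1[OF p_pos] ln_realpow[of ?y "p + 1"] ln_realpow[of "step_rate p" p]
    by (simp only: of_nat_add of_nat_1)
  also have "\<dots> \<le> real inner_bound" unfolding inner_bound_def by (rule real_nat_ceiling_ge)
  finally show "ln (?y ^ (p + 1)) / ln (step_rate p ^ p) \<le> real inner_bound" .
qed

text \<open>The rounding up in \<open>inner_bound\<close> and the two extra steps of \<open>inner_stops\<close> make up the summand \<open>3\<close> of the complexity bound.\<close>

lemma inner_bound_le: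
  assumes K1: "1 \<le> K"
  shows "real inner_bound + 2 \<le> 3 + (real p + 1) / real p *
    ln (4 * (1 + 1 / \<gamma>0) * (real p + 1) powr (1 / real p) * real K ^ p)"
proof -
  let ?y = "(real p + 1) * ln (2 * (real p + 1) * real K ^ p) / (real p * ln (step_rate p))"
  have "1 * 1 \<le> (2 * (real p + 1)) * real K ^ p" using K1 by (intro mult_mono) auto
  then have "0 \<le> ln (2 * (real p + 1) * real K ^ p)" by (intro ln_ge_zero) simp
  moreover have "0 < ln (step_rate p)" using step_rate_gt_1[OF p_pos] by simp
  ultimately have "0 \<le> ?y" by (intro divide_nonneg_nonneg mult_nonneg_nonneg) auto
  then have "real inner_bound \<le> ?y + 1" unfolding inner_bound_def by linarith
  then show ?thesis using step_count_bound[OF p_pos K1 gamma0] by linarith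
qed

definition potential_bound :: "nat \<Rightarrow> real" where
  "potential_bound k = \<gamma>0 * bregman d x0 xstar + \<delta> * (\<Sum>i<k. N (v (Suc i) - xstar))"

definition s :: "nat \<Rightarrow> real" where "s k = potential_bound k powr (1 / (real p + 1))"

lemma s_nonneg: "0 \<le> s k" by (simp add: s_def)

lemma s_power: "s k ^ (p + 1) = potential_bound k"
  unfolding s_def using gamma0 bregman_prox_fn_nonneg[OF p_pos] delta_nonneg
  by (intro powr_root_power) (auto simp: potential_bound_def intro!: add_nonneg_nonneg mult_nonneg_nonneg sum_nonneg)

text \<open>
  The number under the floor is \<open>1 + X\<close> with \<open>X ^ p = 2 (s 0 / U) ^ p\<close>; the factor \<open>2 ^ (1 / p)\<close> in \<open>X\<close>
  leaves half of \<open>U ^ p * K ^ p\<close> for the errors.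
\<close>

lemma K_pos: "1 \<le> K" and s_0: "2 * s 0 ^ p \<le> U ^ p * real K ^ p"
proof -
  define Y where "Y = 2 ^ (p - 1) * (real p + 1) ^ (p + 2) * L * bregman d x0 xstar / (\<epsilon> * fact p)"
  define y where "y = Y powr (1 / (real p + 1))"
  define X where "X = 2 powr (1 / real p) * y"
  have K': "K = nat \<lfloor>1 + X\<rfloor>" unfolding X_def y_def Y_def by (rule K)
  have Y: "0 \<le> Y" unfolding Y_def using L_pos eps bregman_prox_fn_nonneg[OF p_pos] by simp
  have y: "0 \<le> y" "y ^ (p + 1) = Y" unfolding y_def by (simp, rule powr_root_power[OF Y])
  have X: "0 \<le> X" by (simp add: X_def y)
  then show "1 \<le> K" unfolding K' by linarith
  have XK: "X \<le> real K" unfolding K' using X by linarith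
  have "U ^ (p + 1) * Y = \<gamma>0 * bregman d x0 xstar"
    unfolding U_power Y_def contracting_scale_def using L_pos eps
    by (simp add: add_eq_0_iff_both_eq_0)
  then have "s 0 ^ (p + 1) = (U * y) ^ (p + 1)"
    by (simp only: s_power power_mult_distrib y) (simp add: potential_bound_def)
  then have "s 0 = U * y"
    using power_eq_imp_eq_base[of "s 0" "p + 1" "U * y"] s_nonneg U_pos y(1) by simp
  moreover have "X ^ p = 2 * y ^ p"
  proof -
    have "(2 powr (1 / real p)) ^ p = (2 :: real)"
      using p_pos by (simp add: powr_realpow[symmetric] powr_powr)
    then show ?thesis by (simp add: X_def power_mult_distrib)
  qed
  ultimately have "2 * s 0 ^ p = U ^ p * X ^ p" by (simp add: power_mult_distrib)
  also have "\<dots> \<le> U ^ p * real K ^ p"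
    using U_pos X XK by (intro mult_left_mono power_mono) auto
  finally show "2 * s 0 ^ p \<le> U ^ p * real K ^ p" .
qed

lemma s_le_of_power:
  assumes "2 * s k ^ p \<le> U ^ p * (real K ^ p + real k)" "k \<le> K"
  shows "s k \<le> U * real K"
proof -
  have "real k \<le> real K" using assms(2) by simp
  also have "real K ^ 1 \<le> real K ^ p" using K_pos p_pos by (intro power_increasing) auto
  finally have "real k \<le> real K ^ p" by simp
  then have "U ^ p * (real K ^ p + real k) \<le> U ^ p * (2 * real K ^ p)"
    using U_pos by (intro mult_left_mono) auto
  then have "s k ^ p \<le> (U * real K) ^ p" using assms(1) by (simp add: power_mult_distrib)
  then show ?thesis using U_pos p_pos power_mono_iff[of "s k" "U * real K" p] s_nonneg by simp
qed

text \<open>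
  Termination of the inner loop at \<open>k\<close> depends on the bound of the potential at \<open>k\<close>, and
  \<open>t k\<close> is meaningful only once it terminates; hence both are part of one induction. The new distance
  \<open>N (v (Suc k) - xstar)\<close> in the error is bounded by the new potential bound, which contains it;
  \<open>power_increment_transfer\<close> resolves this implicit inequality.
\<close>

lemma outer_invariant:
  "k \<le> K \<Longrightarrow> potential k \<le> potential_bound k \<and> 2 * s k ^ p \<le> U ^ p * (real K ^ p + real k)"
proof (induction k)
  case 0
  then show ?case using s_0 by (simp add: potential_def init potential_bound_def)
next
  case (Suc k)
  then have IH: "potential k \<le> potential_bound k" "2 * s k ^ p \<le> U ^ p * (real K ^ p + real k)" "k \<le> K" by auto
  have "s k \<le> U * real K" by (rule s_le_of_power[OF IH(2,3)])
  then have "inner_stop B p f L \<delta> a A x z k (inner_bound + 2)"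
    using IH(1) by (intro inner_stops[OF s_nonneg] K_pos inner_bound) (simp_all only: s_power)
  then have "inner_stop B p f L \<delta> a A x z k (t k)" unfolding t_eq by (rule LeastI)
  from potential_step[OF this] have pot: "potential (Suc k) \<le> potential_bound (Suc k)"
    using IH(1) by (simp add: potential_bound_def distrib_left)
  have "\<gamma>0 * bregman d (v (Suc k)) xstar \<le> potential (Suc k)"
  proof -
    have "x (Suc k) \<in> E" using iterates_in by blast
    then have "0 \<le> A (Suc k) * (Fr (x (Suc k)) - Fr xstar)"
      using xstar(2) A_nonneg by (intro mult_nonneg_nonneg) (simp_all add: algebra_simps)
    then show ?thesis unfolding potential_def by linarith
  qed
  then have "b ^ (p + 1) * (\<gamma>0 * bregman d (v (Suc k)) xstar) \<le> b ^ (p + 1) * s (Suc k) ^ (p + 1)"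
    using pot b_pos unfolding s_power by (intro mult_left_mono) auto
  with norm_power_le_bregman[of "v (Suc k)" xstar]
  have "N (v (Suc k) - xstar) \<le> b * s (Suc k)"
    by (intro root_le s_nonneg N_nonneg) (rule order_trans)
  then have "\<delta> * N (v (Suc k) - xstar) \<le> \<delta> * (b * s (Suc k))"
    using delta_nonneg by (rule mult_left_mono)
  then have "s (Suc k) ^ (p + 1) \<le> s k ^ (p + 1) + U ^ p / 2 * s (Suc k)"
    unfolding s_power delta_b[symmetric] by (simp add: potential_bound_def distrib_left mult.assoc)
  then have "s (Suc k) ^ p \<le> s k ^ p + U ^ p / 2"
    using U_pos power_increment_transfer[OF s_nonneg s_nonneg, of "U ^ p / 2" "Suc k" p k] by simp
  then have "2 * s (Suc k) ^ p \<le> U ^ p * (real K ^ p + real (Suc k))"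
    using IH(2) by (simp add: algebra_simps)
  with pot show ?case by blast
qed

lemma inner_stop_within:
  assumes "k < K"
  shows "inner_stop B p f L \<delta> a A x z k (inner_bound + 2)"
proof -
  have inv: "potential k \<le> potential_bound k" "2 * s k ^ p \<le> U ^ p * (real K ^ p + real k)"
    using outer_invariant[of k] assms by auto
  have "s k \<le> U * real K" using s_le_of_power[OF inv(2)] assms by simp
  then show ?thesis
    using inv(1) by (intro inner_stops[OF s_nonneg] K_pos inner_bound) (simp_all only: s_power)
qed

lemma accuracy: "Fr (x K) - Fr xstar \<le> \<epsilon>"
proof -
  have inv: "potential K \<le> potential_bound K" "2 * s K ^ p \<le> U ^ p * (real K ^ p + real K)"
    using outer_invariant[of K] by auto
  have "0 \<le> \<gamma>0 * bregman d (v K) xstar"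
    using gamma0 bregman_prox_fn_nonneg[OF p_pos] by simp
  then have "A K * (Fr (x K) - Fr xstar) \<le> s K ^ (p + 1)"
    using inv(1) unfolding potential_def s_power by linarith
  also have "\<dots> \<le> (U * real K) ^ (p + 1)"
    by (intro power_mono s_le_of_power[OF inv(2)] s_nonneg) simp
  also have "\<dots> = c * real K ^ (p + 1) * \<epsilon>"
    by (simp only: power_mult_distrib U_power mult_ac)
  also have "\<dots> \<le> A K * \<epsilon>"
    using A_ge eps by (intro mult_right_mono) auto
  finally have "A K * (Fr (x K) - Fr xstar) \<le> A K * \<epsilon>" .
  moreover have "0 < A K" using K_pos A_Suc_pos by (cases K) auto
  ultimately show ?thesis by (simp only: mult_le_cancel_left_pos)
qed

lemma oracle_calls:
  "real (\<Sum>k<K. t k) \<le> real K * (3 + (real p + 1) / real p *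
     ln (4 * (1 + 1 / \<gamma>0) * (real p + 1) powr (1 / real p) * real K ^ p))" (is "_ \<le> _ * ?b")
proof -
  have "real (t k) \<le> ?b" if "k < K" for k
  proof -
    have "t k \<le> inner_bound + 2"
      unfolding t_eq using inner_stop_within[OF that] by (rule Least_le)
    then have "real (t k) \<le> real inner_bound + 2" by linarith
    then show ?thesis using inner_bound_le[OF K_pos] by linarith
  qed
  then have "(\<Sum>k<K. real (t k)) \<le> (\<Sum>k<K. ?b)" by (intro sum_mono) auto
  then show ?thesis by simp
qed

end

theorem theorem4p6:
  fixes B :: "'a::euclidean_space \<Rightarrow> 'a \<Rightarrow> real"
    and f :: "'a \<Rightarrow> real" and D :: "'a set" and \<psi> F :: "'a \<Rightarrow> ereal"
    and p K :: nat and L \<sigma> \<gamma>0 \<delta> \<epsilon> :: real and x0 xstar :: 'a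
    and a A \<gamma> :: "nat \<Rightarrow> real" and x v :: "nat \<Rightarrow> 'a"
    and z :: "nat \<Rightarrow> nat \<Rightarrow> 'a" and t :: "nat \<Rightarrow> nat"
  assumes B: "pos_def_operator B"
    and p: "1 \<le> p"
    and D: "open D"
    and f_convex: "convex_on D f"
    and f_diff: "f differentiable_on D" "times_differentiable_on p f D"
    and f_lipschitz: "\<And>y y'. y \<in> D \<Longrightarrow> y' \<in> D \<Longrightarrow>
        form_nrm B p (\<lambda>hs. nderiv f hs y - nderiv f hs y') \<le> L * nrm B (y - y')"
    and L: "0 < L"
    and psi: "proper_closed_convex \<psi>"
    and dom: "edom \<psi> \<subseteq> D"
    and F: "F = (\<lambda>y. ereal (f y) + \<psi> y)"
    and solution: "is_arg_min F (\<lambda>_. True) xstar"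
    and sigma: "rel_convexity_const (prox_fn B p x0) \<psi> \<sigma>" "\<sigma> = 0"
    and x0: "x0 \<in> edom F"
    and gamma0: "0 < \<gamma>0"
    and eps: "0 < \<epsilon>"
    and delta: "\<delta> = (fact p * \<epsilon> / L) powr (real p / (real p + 1))
                  * (\<gamma>0 / (2 ^ p * (real p + 1) ^ (p + 1)))"
    and run: "cpt_run B p f \<psi> L \<sigma> \<gamma>0 \<delta> x0 a A \<gamma> x v z t"
    and K: "K = nat \<lfloor>1 + 2 powr (1 / real p) *
                  (2 ^ (p - 1) * (real p + 1) ^ (p + 2) * L * bregman (prox_fn B p x0) x0 xstar
                     / (\<epsilon> * fact p)) powr (1 / (real p + 1))\<rfloor>"
  shows "(\<forall>k<K. \<exists>i. inner_stop B p f L \<delta> a A x z k i) \<and>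
         F (x K) - F xstar \<le> ereal \<epsilon> \<and>
         real (\<Sum>k<K. t k) \<le> real K * (3 + (real p + 1) / real p *
           ln (4 * (1 + 1 / \<gamma>0) * (real p + 1) powr (1 / real p) * real K ^ p))"
proof -
  interpret pos_def_norm B by unfold_locales (rule B)
  interpret smooth_function p f D by unfold_locales (rule D f_diff(2))+
  have model: "tensor_model B p f D L"
    by (rule tensor_modelI[OF pos_def_norm_axioms p L f_convex f_lipschitz])
  have F_real: "F y = ereal (f y + real_of_ereal (\<psi> y))" if "y \<in> edom \<psi>" for y
    using edom_real[OF psi that] by (simp add: F) (metis plus_ereal.simps(1))
  have dom_F: "y \<in> edom \<psi>" if "F y < \<infinity>" for y
    using that not_edom[OF psi, of y] by (auto simp: F)
  have min: "F xstar \<le> F y" for y using solution by (simp add: is_arg_min_def not_less)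
  have x0_dom: "x0 \<in> edom \<psi>" using x0 dom_F by (simp add: edom_def)
  have "F xstar < \<infinity>" using le_less_trans[OF min[of x0], of \<infinity>] x0 by (simp add: edom_def)
  then have xstar_dom: "xstar \<in> edom \<psi>" by (rule dom_F)
  have xstar_min: "f xstar + real_of_ereal (\<psi> xstar) \<le> f y + real_of_ereal (\<psi> y)" if "y \<in> edom \<psi>" for y
    using min[of y] by (simp add: F_real that xstar_dom)
  interpret contracting_run B p f D L \<psi> \<gamma>0 \<delta> \<epsilon> x0 xstar K a A \<gamma> x v z t
    by (intro contracting_run.intro contracting_run_axioms.intro model psi dom xstar_dom xstar_min
        x0_dom gamma0 eps delta K run[unfolded sigma(2)])
  have "F (x K) - F xstar \<le> ereal \<epsilon>"
    using accuracy iterates_in[of K] by (simp add: F_real xstar_dom)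
  then show ?thesis using inner_stop_within oracle_calls by blast
qed

end
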